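(* Let $\mathcal M$ be a von Neumann algebra with countably decomposable center satisfying one of the following conditions: (a) $\mathcal M$ is of type II$_\infty$ or of type III; (b) $\mathcal M$ is of type II$_1$ with atomless center, or $\mathcal M$ is a II$_1$ factor. Let $(\mu,D)$ be a pair for $\mathcal M$ consisting of a probability measure and a dimension function. Then the $F$-norm $\|\cdot\|_{\mu,D}$ is uniquely determined by its values on $P(\mathcal M)$; that is, if $(\mu',D')$ is another such pair, with $\mu'$ on the same measurable space and with the same identification of $Z(\mathcal M)$, and $\|p\|_{\mu,D}=\|p\|_{\mu',D'}$ for all $p\in P(\mathcal M)$, then $\|x\|_{\mu,D}=\|x\|_{\mu',D'}$ for all $x\in LS(\mathcal M)$.
   Context: For a von Neumann algebra $\mathcal M$: $Z(\mathcal M)$ is its center, $P(\mathcal M)$ its projection lattice. A closed densely defined operator $x$ affiliated with $\mathcal M$ is measurable if the spectral projection $e_{(\lambda,\infty)}(|x|)$ is a finite projection for some $\lambda>0$; it is locally measurable if there are central projections $z_n\uparrow\mathbf 1$ with each $xz_n$ measurable. $LS(\mathcal M)$ is the $^*$-algebra of all locally measurable operators. Pairs. Let $(\Omega,\Sigma,\mu)$ be a probability space and $\varphi:Z(\mathcal M)\to L_\infty(\Omega,\Sigma,\mu)$ a $^*$-isomorphism. $L^+(\Omega,\Sigma,\mu)$ is the set of (a.e. classes of) measurable functions $\Omega\to[0,\infty]$. A dimension function is a map $D:P(\mathcal M)\to L^+(\Omega,\Sigma,\mu)$ such that: $D(p)\neq 0$ if $p\ne 0$; $D(p)$ is a.e.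 finite iff $p$ is finite; $D(p\vee q)=D(p)+D(q)$ if $pq=0$; $D(p)=D(q)$ if $p\sim q$; $D(zp)=\varphi(z)D(p)$ for $z\in P(Z(\mathcal M))$; $D(p)=\sup_i D(p_i)$ if $p_i\uparrow p$. A pair $(\mu,D)$ consists of such a probability measure and a dimension function. Both pairs use the same $(\Omega,\Sigma)$ and the same $\varphi$ (so $\mu,\mu'$ have the same null sets). $F$-norm. With $[f>\lambda]=\{\omega\in\Omega:f(\omega)>\lambda\}$, for $x\in LS(\mathcal M)$, $$\|x\|_{\mu,D}=\inf_{\lambda>0}\max\{\lambda,\ \mu([D(e_{(\lambda,\infty)}(|x|))>\lambda])\}.$$ *)

theory Defs
  imports "HOL-Probability.Probability"
begin

section \<open>Complex Hilbert spaces and bounded operators\<close>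

text \<open>The real inner product and the norm are those of the underlying real Hilbert space;
  positivity of the complex inner product follows from \<open>Re_cinner\<close>.\<close>

class complex_hilbert_space = real_inner + complete_space +
  fixes scaleC :: "complex \<Rightarrow> 'a \<Rightarrow> 'a"  (infixr "*\<^sub>C" 75)
    and cinner :: "'a \<Rightarrow> 'a \<Rightarrow> complex"
  assumes scaleC_of_real: "of_real r *\<^sub>C x = r *\<^sub>R x"
    and scaleC_add_right: "c *\<^sub>C (x + y) = c *\<^sub>C x + c *\<^sub>C y"
    and scaleC_add_left: "(c + d) *\<^sub>C x = c *\<^sub>C x + d *\<^sub>C x"
    and scaleC_scaleC: "c *\<^sub>C (d *\<^sub>C x) = (c * d) *\<^sub>C x"
    and cinner_commute: "cinner x y = cnj (cinner y x)"
    and cinner_add_left: "cinner (x + y) z = cinner x z + cinner y z"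
    and cinner_scaleC_left: "cinner (c *\<^sub>C x) y = c * cinner x y"
    and Re_cinner: "Re (cinner x y) = inner x y"

type_synonym 'h op = "'h \<Rightarrow> 'h"

definition bounded_clinear :: "'h::complex_hilbert_space op \<Rightarrow> bool" where
  "bounded_clinear T \<longleftrightarrow> bounded_linear T \<and> (\<forall>c \<xi>. T (c *\<^sub>C \<xi>) = c *\<^sub>C T \<xi>)"

definition cadj :: "'h::complex_hilbert_space op \<Rightarrow> 'h op" where
  "cadj T = (THE S. \<forall>\<xi> \<eta>. cinner (T \<xi>) \<eta> = cinner \<xi> (S \<eta>))"

definition unitary :: "'h::complex_hilbert_space op \<Rightarrow> bool" where
  "unitary u \<longleftrightarrow> bounded_clinear u \<and> cadj u \<circ> u = id \<and> u \<circ> cadj u = id"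

definition projection :: "'h::complex_hilbert_space op \<Rightarrow> bool" where
  "projection p \<longleftrightarrow> bounded_clinear p \<and> p \<circ> p = p \<and> cadj p = p"

definition zero_op :: "'h::complex_hilbert_space op" where
  "zero_op = (\<lambda>\<xi>. 0)"

definition proj_le :: "'h::complex_hilbert_space op \<Rightarrow> 'h op \<Rightarrow> bool" where
  "proj_le p q \<longleftrightarrow> q \<circ> p = p"

section \<open>Von Neumann algebras\<close>

definition commutant :: "'h::complex_hilbert_space op set \<Rightarrow> 'h op set" where
  "commutant M = {T. bounded_clinear T \<and> (\<forall>S\<in>M. T \<circ> S = S \<circ> T)}"

definition von_neumann_algebra :: "'h::complex_hilbert_space op set \<Rightarrow> bool" where
  "von_neumann_algebra M \<longleftrightarrow>
     M \<subseteq> Collect bounded_clinear \<and> (\<forall>T\<in>M. cadj T \<in> M) \<and> commutant (commutant M) = M"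

definition center :: "'h::complex_hilbert_space op set \<Rightarrow> 'h op set" where
  "center M = M \<inter> commutant M"

definition projections :: "'h::complex_hilbert_space op set \<Rightarrow> 'h op set" where
  "projections M = {p \<in> M. projection p}"

text \<open>Suprema in the projection lattice; \<open>r\<close> is \<open>p \<or> q\<close> iff \<open>is_proj_sup M {p, q} r\<close>.\<close>

definition is_proj_sup :: "'h::complex_hilbert_space op set \<Rightarrow> 'h op set \<Rightarrow> 'h op \<Rightarrow> bool" where
  "is_proj_sup M S r \<longleftrightarrow>
     r \<in> projections M \<and> (\<forall>p\<in>S. proj_le p r) \<and>
     (\<forall>q\<in>projections M. (\<forall>p\<in>S. proj_le p q) \<longrightarrow> proj_le r q)"

definition directed_projs :: "'h::complex_hilbert_space op set \<Rightarrow> bool" where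
  "directed_projs S \<longleftrightarrow>
     S \<noteq> {} \<and> (\<forall>p\<in>S. \<forall>q\<in>S. \<exists>r\<in>S. proj_le p r \<and> proj_le q r)"

definition mvn_equiv :: "'h::complex_hilbert_space op set \<Rightarrow> 'h op \<Rightarrow> 'h op \<Rightarrow> bool" where
  "mvn_equiv M p q \<longleftrightarrow> (\<exists>v\<in>M. cadj v \<circ> v = p \<and> v \<circ> cadj v = q)"

definition finite_proj :: "'h::complex_hilbert_space op set \<Rightarrow> 'h op \<Rightarrow> bool" where
  "finite_proj M p \<longleftrightarrow>
     p \<in> projections M \<and>
     (\<forall>q\<in>projections M. proj_le q p \<and> mvn_equiv M p q \<longrightarrow> q = p)"

definition abelian_proj :: "'h::complex_hilbert_space op set \<Rightarrow> 'h op \<Rightarrow> bool" where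
  "abelian_proj M p \<longleftrightarrow>
     p \<in> projections M \<and>
     (\<forall>S\<in>M. \<forall>T\<in>M. (p \<circ> S \<circ> p) \<circ> (p \<circ> T \<circ> p) = (p \<circ> T \<circ> p) \<circ> (p \<circ> S \<circ> p))"

definition type_II :: "'h::complex_hilbert_space op set \<Rightarrow> bool" where
  "type_II M \<longleftrightarrow>
     (\<forall>p. abelian_proj M p \<longrightarrow> p = zero_op) \<and>
     (\<forall>z\<in>projections (center M). z \<noteq> zero_op \<longrightarrow>
        (\<exists>p. finite_proj M p \<and> p \<noteq> zero_op \<and> proj_le p z))"

definition type_II_1 :: "'h::complex_hilbert_space op set \<Rightarrow> bool" where
  "type_II_1 M \<longleftrightarrow> type_II M \<and> finite_proj M id"

definition type_II_inf :: "'h::complex_hilbert_space op set \<Rightarrow> bool" where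
  "type_II_inf M \<longleftrightarrow>
     type_II M \<and> (\<forall>z\<in>projections (center M). finite_proj M z \<longrightarrow> z = zero_op)"

definition type_III :: "'h::complex_hilbert_space op set \<Rightarrow> bool" where
  "type_III M \<longleftrightarrow> (\<forall>p. finite_proj M p \<longrightarrow> p = zero_op)"

definition factor :: "'h::complex_hilbert_space op set \<Rightarrow> bool" where
  "factor M \<longleftrightarrow> center M = range (\<lambda>c \<xi>. c *\<^sub>C \<xi>)"

definition countably_decomposable :: "'h::complex_hilbert_space op set \<Rightarrow> bool" where
  "countably_decomposable N \<longleftrightarrow>
     (\<forall>S \<subseteq> projections N - {zero_op}.
        (\<forall>p\<in>S. \<forall>q\<in>S. p \<noteq> q \<longrightarrow> p \<circ> q = zero_op) \<longrightarrow> countable S)"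

definition atomless :: "'h::complex_hilbert_space op set \<Rightarrow> bool" where
  "atomless N \<longleftrightarrow>
     (\<forall>p\<in>projections N. p \<noteq> zero_op \<longrightarrow>
        (\<exists>q\<in>projections N. proj_le q p \<and> q \<noteq> zero_op \<and> q \<noteq> p))"

section \<open>Unbounded operators\<close>

text \<open>An unbounded operator is identified with its graph, a set of pairs \<open>(\<xi>, x \<xi>)\<close> with \<open>\<xi>\<close> in
  the domain.  Relational composition is read from left to right, so the graph of the product
  \<open>x y\<close> (\<open>y\<close> applied first), with its natural domain, is \<open>y O x\<close>.\<close>

type_synonym 'h uop = "('h \<times> 'h) set"

definition op_graph :: "'h::complex_hilbert_space op \<Rightarrow> 'h uop" where
  "op_graph T = {(\<xi>, T \<xi>) | \<xi>. True}"

definition closed_densely_defined :: "'h::complex_hilbert_space uop \<Rightarrow> bool" where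
  "closed_densely_defined x \<longleftrightarrow>
     single_valued x \<and>
     (\<forall>\<xi> \<eta> \<xi>' \<eta>'. (\<xi>, \<eta>) \<in> x \<and> (\<xi>', \<eta>') \<in> x \<longrightarrow> (\<xi> + \<xi>', \<eta> + \<eta>') \<in> x) \<and>
     (\<forall>c \<xi> \<eta>. (\<xi>, \<eta>) \<in> x \<longrightarrow> (c *\<^sub>C \<xi>, c *\<^sub>C \<eta>) \<in> x) \<and>
     closed x \<and> closure (Domain x) = UNIV"

definition uop_adj :: "'h::complex_hilbert_space uop \<Rightarrow> 'h uop" where
  "uop_adj x = {(\<eta>, \<zeta>). \<forall>(\<xi>, \<xi>')\<in>x. cinner \<xi>' \<eta> = cinner \<xi> \<zeta>}"

definition positive_selfadjoint :: "'h::complex_hilbert_space uop \<Rightarrow> bool" where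
  "positive_selfadjoint a \<longleftrightarrow>
     closed_densely_defined a \<and> uop_adj a = a \<and> (\<forall>(\<xi>, \<eta>)\<in>a. Re (cinner \<eta> \<xi>) \<ge> 0)"

text \<open>\<open>|x| = (x* x)\<^sup>1\<^sup>/\<^sup>2\<close>, the positive self-adjoint square root of \<open>x* x\<close>.\<close>

definition uop_abs :: "'h::complex_hilbert_space uop \<Rightarrow> 'h uop" where
  "uop_abs x = (THE a. positive_selfadjoint a \<and> a O a = x O uop_adj x)"

section \<open>Spectral projections\<close>

definition projection_valued_measure :: "(real set \<Rightarrow> 'h::complex_hilbert_space op) \<Rightarrow> bool" where
  "projection_valued_measure E \<longleftrightarrow>
     (\<forall>B\<in>sets borel. projection (E B)) \<and> E UNIV = id \<and>
     (\<forall>A :: nat \<Rightarrow> real set. range A \<subseteq> sets borel \<and> disjoint_family A \<longrightarrow>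
        (\<forall>\<xi>. (\<lambda>n. E (A n) \<xi>) sums E (\<Union>n. A n) \<xi>))"

definition scalar_measure :: "(real set \<Rightarrow> 'h::complex_hilbert_space op) \<Rightarrow> 'h \<Rightarrow> real measure" where
  "scalar_measure E \<xi> =
     measure_of UNIV (sets borel) (\<lambda>B. ennreal (Re (cinner (E B \<xi>) \<xi>)))"

text \<open>\<open>a\<close> is the integral of \<open>t\<close> with respect to \<open>E\<close>: a linear operator is determined by its domain
  and its quadratic form.\<close>

definition has_spectral_measure ::
  "'h::complex_hilbert_space uop \<Rightarrow> (real set \<Rightarrow> 'h op) \<Rightarrow> bool" where
  "has_spectral_measure a E \<longleftrightarrow>
     projection_valued_measure E \<and>
     Domain a = {\<xi>. (\<integral>\<^sup>+ t. ennreal (t\<^sup>2) \<partial>scalar_measure E \<xi>) < \<infinity>} \<and>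
     (\<forall>(\<xi>, \<eta>)\<in>a. cinner \<eta> \<xi> = of_real (\<integral>t. t \<partial>scalar_measure E \<xi>))"

text \<open>The description ranges over the projection rather than over \<open>E\<close>, since \<open>E\<close> is arbitrary on
  non-Borel sets.\<close>

definition spectral_projection :: "'h::complex_hilbert_space uop \<Rightarrow> real set \<Rightarrow> 'h op" where
  "spectral_projection a B = (THE p. \<exists>E. has_spectral_measure a E \<and> p = E B)"

section \<open>Locally measurable operators\<close>

definition affiliated :: "'h::complex_hilbert_space uop \<Rightarrow> 'h op set \<Rightarrow> bool" where
  "affiliated x M \<longleftrightarrow>
     (\<forall>u\<in>commutant M. unitary u \<longrightarrow> (\<forall>(\<xi>, \<eta>)\<in>x. (u \<xi>, u \<eta>) \<in> x))"

definition measurable_op :: "'h::complex_hilbert_space op set \<Rightarrow> 'h uop \<Rightarrow> bool" where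
  "measurable_op M x \<longleftrightarrow>
     closed_densely_defined x \<and> affiliated x M \<and>
     (\<exists>l>0. finite_proj M (spectral_projection (uop_abs x) {l<..}))"

definition LS :: "'h::complex_hilbert_space op set \<Rightarrow> 'h uop set" where
  "LS M = {x. closed_densely_defined x \<and> affiliated x M \<and>
     (\<exists>z :: nat \<Rightarrow> 'h op.
        range z \<subseteq> projections (center M) \<and>
        (\<forall>n. proj_le (z n) (z (Suc n))) \<and> is_proj_sup M (range z) id \<and>
        (\<forall>n. measurable_op M (op_graph (z n) O x)))}"

section \<open>Dimension functions and the F-norm\<close>

text \<open>Elements of \<open>L\<^sub>\<infinity>\<close> and of \<open>L\<^sup>+\<close> are represented by functions, and equality and order of
  classes by almost everywhere equality and order.\<close>

definition Linf :: "'w measure \<Rightarrow> ('w \<Rightarrow> complex) set" where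
  "Linf \<mu> = {f \<in> borel_measurable \<mu>. \<exists>C. AE \<omega> in \<mu>. cmod (f \<omega>) \<le> C}"

definition star_isomorphism ::
  "'h::complex_hilbert_space op set \<Rightarrow> 'w measure \<Rightarrow> ('h op \<Rightarrow> 'w \<Rightarrow> complex) \<Rightarrow> bool" where
  "star_isomorphism Z \<mu> \<phi> \<longleftrightarrow>
     (\<forall>S\<in>Z. \<phi> S \<in> Linf \<mu>) \<and>
     (\<forall>S\<in>Z. \<forall>T\<in>Z. AE \<omega> in \<mu>. \<phi> (\<lambda>\<xi>. S \<xi> + T \<xi>) \<omega> = \<phi> S \<omega> + \<phi> T \<omega>) \<and>
     (\<forall>c. \<forall>S\<in>Z. AE \<omega> in \<mu>. \<phi> (\<lambda>\<xi>. c *\<^sub>C S \<xi>) \<omega> = c * \<phi> S \<omega>) \<and>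
     (\<forall>S\<in>Z. \<forall>T\<in>Z. AE \<omega> in \<mu>. \<phi> (S \<circ> T) \<omega> = \<phi> S \<omega> * \<phi> T \<omega>) \<and>
     (\<forall>S\<in>Z. AE \<omega> in \<mu>. \<phi> (cadj S) \<omega> = cnj (\<phi> S \<omega>)) \<and>
     (\<forall>S\<in>Z. \<forall>T\<in>Z. (AE \<omega> in \<mu>. \<phi> S \<omega> = \<phi> T \<omega>) \<longrightarrow> S = T) \<and>
     (\<forall>f\<in>Linf \<mu>. \<exists>S\<in>Z. AE \<omega> in \<mu>. \<phi> S \<omega> = f \<omega>)"

text \<open>The last condition is normality for increasing nets: the supremum in \<open>L\<^sup>+\<close> is the least upper
  bound of the classes, which for uncountable families is not the pointwise supremum.  The function
  \<open>\<phi> z\<close> is almost everywhere 0 or 1 for a central projection \<open>z\<close>.\<close>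

definition dimension_function ::
  "'h::complex_hilbert_space op set \<Rightarrow> ('h op \<Rightarrow> 'w \<Rightarrow> complex) \<Rightarrow> 'w measure \<Rightarrow>
   ('h op \<Rightarrow> 'w \<Rightarrow> ennreal) \<Rightarrow> bool" where
  "dimension_function M \<phi> \<mu> D \<longleftrightarrow>
     (\<forall>p\<in>projections M. D p \<in> borel_measurable \<mu>) \<and>
     (\<forall>p\<in>projections M. p \<noteq> zero_op \<longrightarrow> \<not> (AE \<omega> in \<mu>. D p \<omega> = 0)) \<and>
     (\<forall>p\<in>projections M. (AE \<omega> in \<mu>. D p \<omega> < \<infinity>) \<longleftrightarrow> finite_proj M p) \<and>
     (\<forall>p\<in>projections M. \<forall>q\<in>projections M. \<forall>r.
        p \<circ> q = zero_op \<and> is_proj_sup M {p, q} r \<longrightarrow> (AE \<omega> in \<mu>. D r \<omega> = D p \<omega> + D q \<omega>)) \<and>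
     (\<forall>p\<in>projections M. \<forall>q\<in>projections M.
        mvn_equiv M p q \<longrightarrow> (AE \<omega> in \<mu>. D p \<omega> = D q \<omega>)) \<and>
     (\<forall>z\<in>projections (center M). \<forall>p\<in>projections M.
        AE \<omega> in \<mu>. D (z \<circ> p) \<omega> = ennreal (Re (\<phi> z \<omega>)) * D p \<omega>) \<and>
     (\<forall>S p. S \<subseteq> projections M \<and> directed_projs S \<and> is_proj_sup M S p \<longrightarrow>
        (\<forall>q\<in>S. AE \<omega> in \<mu>. D q \<omega> \<le> D p \<omega>) \<and>
        (\<forall>g\<in>borel_measurable \<mu>.
           (\<forall>q\<in>S. AE \<omega> in \<mu>. D q \<omega> \<le> g \<omega>) \<longrightarrow> (AE \<omega> in \<mu>. D p \<omega> \<le> g \<omega>)))"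

definition dimension_pair ::
  "'h::complex_hilbert_space op set \<Rightarrow> ('h op \<Rightarrow> 'w \<Rightarrow> complex) \<Rightarrow> 'w measure \<Rightarrow>
   ('h op \<Rightarrow> 'w \<Rightarrow> ennreal) \<Rightarrow> bool" where
  "dimension_pair M \<phi> \<mu> D \<longleftrightarrow>
     prob_space \<mu> \<and> star_isomorphism (center M) \<mu> \<phi> \<and> dimension_function M \<phi> \<mu> D"

definition F_norm ::
  "'w measure \<Rightarrow> ('h::complex_hilbert_space op \<Rightarrow> 'w \<Rightarrow> ennreal) \<Rightarrow> 'h uop \<Rightarrow> real" where
  "F_norm \<mu> D x =
     (INF l\<in>{0<..}. max l (measure \<mu>
        {\<omega> \<in> space \<mu>. D (spectral_projection (uop_abs x) {l<..}) \<omega> > ennreal l}))"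

end

theory Submission
  imports Defs "HOL-Computational_Algebra.Polynomial"
begin

text \<open>Projections have \<open>\<parallel>p\<parallel> = \<rho>(D(p))\<close> with \<open>\<rho>(f) = inf\<^sub>l max l (\<mu>[f > l])\<close>, so the hypothesis compares
  \<open>\<rho>(1\<^sub>A D(p))\<close> and \<open>\<rho>'(1\<^sub>A D'(p))\<close> for all measurable \<open>A\<close>, which are realised by central cut-downs.
  In a type II algebra every projection \<open>p\<close> has a half \<open>q\<close>, so that \<open>D(p) = 2 D(q)\<close> for every dimension
  function at once.  If \<open>D'(p) < a < b < D(p)\<close> on a set \<open>A\<close> of positive measure, cut down to \<open>A\<close> and
  halve until \<open>b / 2\<^sup>n \<le> \<mu>(A)\<close>: the two norms are separated by \<open>a / 2\<^sup>n < b / 2\<^sup>n\<close>.  Hence \<open>D = D'\<close>;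
  in type III both take only the values 0 and \<open>\<infinity>\<close>.  The measures agree because \<open>\<parallel>z\<^sub>A\<parallel> = \<mu>(A)\<close> for the central
  projection \<open>z\<^sub>A\<close> of a set \<open>A\<close>: always if \<open>D(1) = \<infinity>\<close>, and for all small \<open>A\<close> on which \<open>D(1)\<close> is bounded
  below otherwise, which suffices in the absence of atoms.  Thus the two norms agree on all \<open>x\<close> for which the
  spectral projections of \<open>|x|\<close> lie in the algebra; that they do, and that the projections themselves have
  the expected spectral projections, is the spectral theorem.\<close>

section \<open>Orthogonal projections in Hilbert spaces\<close>

text \<open>\<open>uop_abs\<close> and \<open>spectral_projection\<close> are definite descriptions,
  so nothing can be said about them before existence and uniqueness of square roots and spectral
  measures of unbounded operators are available. Both are reduced to a bounded operator, the
  resolvent R = 1 / (1 + b), once for the product of x with its adjoint and once for its root: R is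
  a positive contraction and b = 1 / R - 1. For positive contractions, positivity of Bernstein
  polynomials in R produces scalar measures through the moment problem on [0,1]. Uniqueness comes
  from a growth condition on the powers of the square, which describes the kernel of the projection
  for (l, \<infinity>); being phrased by the graph of x alone, it also shows that the projection
  commutes with the unitaries of the commutant. Halving rests on corners: a nonzero s that is not
  abelian has a nonzero corner e Y (s - e); it squares to zero, and its truncated polar part is a
  partial isometry between two orthogonal projections below s. Comparison theory is avoided:
  dimension functions are normal, so it suffices to match the finite partial sums of an exhausting
  family.\<close>

instance complex_hilbert_space \<subseteq> banach ..

lemma parallelogram_law:
  fixes x y :: "'a::real_inner"
  shows "(norm (x + y))\<^sup>2 + (norm (x - y))\<^sup>2 = 2 * (norm x)\<^sup>2 + 2 * (norm y)\<^sup>2"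
  by (simp add: power2_norm_eq_inner inner_add inner_diff inner_commute)

lemma norm_add_sq_orthogonal:
  fixes x y :: "'a::real_inner"
  assumes "inner x y = 0"
  shows "(norm (x + y))\<^sup>2 = (norm x)\<^sup>2 + (norm y)\<^sup>2"
  using assms by (simp add: power2_norm_eq_inner inner_add inner_commute)

text \<open>The parallelogram law makes a minimising sequence for the distance from \<open>x\<close>
  to \<open>K\<close> Cauchy, and its limit \<open>l\<close> is a nearest point; a nonzero component
  of \<open>x - l\<close> along some \<open>z\<close> in \<open>K\<close> would allow a nearer
  one.\<close>

lemma orthogonal_projection_exists:
  fixes K :: "'a::{real_inner,banach} set"
  assumes K: "subspace K" "closed K"
  shows "\<exists>y\<in>K. \<forall>z\<in>K. inner (x - y) z = 0"
proof -
  define d where "d = infdist x K"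
  have ne: "K \<noteq> {}" using subspace_0[OF K(1)] by auto
  have dle: "d \<le> norm (x - y)" if "y \<in> K" for y
    using infdist_le[OF that] by (simp add: d_def dist_norm)
  have d0: "0 \<le> d" by (simp add: d_def infdist_nonneg)
  have "\<exists>y\<in>K. (norm (x - y))\<^sup>2 < d\<^sup>2 + e" if "e > 0" for e
  proof -
    have lt: "d < sqrt (d\<^sup>2 + e)"
      using d0 that by (intro real_less_rsqrt) auto
    obtain y where "y \<in> K" "dist x y < sqrt (d\<^sup>2 + e)"
    proof -
      have "(INF a\<in>K. dist x a) < sqrt (d\<^sup>2 + e)"
        using lt ne by (simp add: d_def infdist_def)
      then show ?thesis
        using that ne by (subst (asm) cINF_less_iff) (auto intro!: bdd_belowI[where m = 0])
    qed
    then have "(norm (x - y))\<^sup>2 < (sqrt (d\<^sup>2 + e))\<^sup>2"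
      by (intro power_strict_mono) (auto simp: dist_norm)
    then show ?thesis using \<open>y \<in> K\<close> that by (auto simp: add_nonneg_nonneg)
  qed
  then have "\<forall>n. \<exists>y\<in>K. (norm (x - y))\<^sup>2 < d\<^sup>2 + inverse (Suc n)"
    by simp
  then obtain y where yK: "\<And>n. y n \<in> K" and y: "\<And>n. (norm (x - y n))\<^sup>2 < d\<^sup>2 + inverse (Suc n)"
    by metis
  have est: "(norm (y m - y n))\<^sup>2 \<le> 2 * inverse (Suc m) + 2 * inverse (Suc n)" for m n
  proof -
    \<comment> \<open>The midpoint of two almost nearest points lies in \<open>K\<close>, so it too
      has distance at least \<open>d\<close>; the parallelogram law then leaves little room for
      \<open>y m - y n\<close>.\<close>
    have half: "(1/2) *\<^sub>R (y m + y n) \<in> K"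
      using K(1) yK by (simp add: subspace_add subspace_scale)
    have "2 * d \<le> 2 * norm (x - (1/2) *\<^sub>R (y m + y n))" using dle[OF half] by simp
    also have "\<dots> = norm ((x - y m) + (x - y n))"
    proof -
      have "(x - y m) + (x - y n) = 2 *\<^sub>R (x - (1/2) *\<^sub>R (y m + y n))"
        by (simp add: algebra_simps scaleR_2)
      then show ?thesis by simp
    qed
    finally have "(2 * d)\<^sup>2 \<le> (norm ((x - y m) + (x - y n)))\<^sup>2"
      using d0 by (intro power_mono) auto
    moreover have "(norm ((x - y m) + (x - y n)))\<^sup>2 + (norm (y n - y m))\<^sup>2
        = 2 * (norm (x - y m))\<^sup>2 + 2 * (norm (x - y n))\<^sup>2"
      using parallelogram_law[of "x - y m" "x - y n"] by (simp add: norm_minus_commute)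
    ultimately show ?thesis using y[of m] y[of n] by (simp add: norm_minus_commute power_mult_distrib)
  qed
  have "Cauchy y"
  proof (rule CauchyI)
    fix e :: real assume e: "e > 0"
    obtain N where N: "inverse (Suc N) < e\<^sup>2 / 4"
      using reals_Archimedean[of "e\<^sup>2 / 4"] e by auto
    have "norm (y m - y n) < e" if "m \<ge> N" "n \<ge> N" for m n
    proof -
      have "inverse (real (Suc m)) \<le> inverse (real (Suc N))" "inverse (real (Suc n)) \<le> inverse (real (Suc N))"
        using that by (auto simp: field_simps)
      then have "(norm (y m - y n))\<^sup>2 < e\<^sup>2" using est[of m n] N by linarith
      then show ?thesis by (rule power2_less_imp_less) (use e in auto)
    qed
    then show "\<exists>M. \<forall>m\<ge>M. \<forall>n\<ge>M. norm (y m - y n) < e" by blast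
  qed
  then obtain l where l: "y \<longlonglongrightarrow> l" using Cauchy_convergent convergentD by blast
  have lK: "l \<in> K" using K(2) yK l closed_sequentially by blast
  have "(norm (x - l))\<^sup>2 \<le> d\<^sup>2 + 0"
  proof (rule LIMSEQ_le[OF _ _ ])
    show "(\<lambda>n. (norm (x - y n))\<^sup>2) \<longlonglongrightarrow> (norm (x - l))\<^sup>2" by (intro tendsto_intros l)
    show "(\<lambda>n. d\<^sup>2 + inverse (Suc n)) \<longlonglongrightarrow> d\<^sup>2 + 0"
      by (intro tendsto_intros LIMSEQ_inverse_real_of_nat)
    show "\<exists>N. \<forall>n\<ge>N. (norm (x - y n))\<^sup>2 \<le> d\<^sup>2 + inverse (Suc n)" using y less_imp_le by blast
  qed
  then have nl: "(norm (x - l))\<^sup>2 \<le> d\<^sup>2" by simp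
  have "inner (x - l) z = 0" if z: "z \<in> K" for z
  proof (cases "z = 0")
    case False
    \<comment> \<open>The coefficient of the projection of \<open>x - l\<close> on the line of
      \<open>z\<close>: moving by \<open>t\<close> along \<open>z\<close> lowers the squared
      distance by the square of \<open>inner (x - l) z / norm z\<close>.\<close>
    define t where "t = inner (x - l) z / (norm z)\<^sup>2"
    have "l + t *\<^sub>R z \<in> K" using K(1) lK z by (simp add: subspace_add subspace_scale)
    then have "d\<^sup>2 \<le> (norm (x - (l + t *\<^sub>R z)))\<^sup>2" using dle d0 by (intro power_mono) auto
    also have "\<dots> = (norm (x - l))\<^sup>2 - 2 * t * inner (x - l) z + t\<^sup>2 * (norm z)\<^sup>2"
      unfolding power2_norm_eq_inner
      by (simp add: inner_diff inner_add inner_commute algebra_simps power2_eq_square)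
    also have "\<dots> = (norm (x - l))\<^sup>2 - (inner (x - l) z)\<^sup>2 / (norm z)\<^sup>2"
      using False by (simp add: t_def field_simps power2_eq_square)
    finally have "(inner (x - l) z)\<^sup>2 / (norm z)\<^sup>2 \<le> 0" using nl by linarith
    moreover have "(norm z)\<^sup>2 > 0" using False by simp
    ultimately have "(inner (x - l) z)\<^sup>2 \<le> 0" by (simp add: divide_le_0_iff)
    then show ?thesis by simp
  qed simp
  then show ?thesis using lK by blast
qed

definition oproj :: "'a::{real_inner,banach} set \<Rightarrow> 'a \<Rightarrow> 'a" where
  "oproj K x = (SOME y. y \<in> K \<and> (\<forall>z\<in>K. inner (x - y) z = 0))"

context
  fixes K :: "'a::{real_inner,banach} set"
  assumes K: "subspace K" "closed K"
begin

lemma oproj_in: "oproj K x \<in> K"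
  and oproj_orthogonal: "z \<in> K \<Longrightarrow> inner (x - oproj K x) z = 0"
  using someI_ex[of "\<lambda>y. y \<in> K \<and> (\<forall>z\<in>K. inner (x - y) z = 0)"] orthogonal_projection_exists[OF K]
  unfolding oproj_def by blast+

lemma oproj_unique:
  assumes "y \<in> K" "\<And>z. z \<in> K \<Longrightarrow> inner (x - y) z = 0"
  shows "oproj K x = y"
proof -
  have d: "oproj K x - y \<in> K" using assms(1) oproj_in K(1) by (simp add: subspace_diff)
  have "inner (oproj K x - y) (oproj K x - y)
      = inner (x - y) (oproj K x - y) - inner (x - oproj K x) (oproj K x - y)"
    by (simp add: inner_diff)
  also have "\<dots> = 0" using assms(2)[OF d] oproj_orthogonal[OF d] by simp
  finally show ?thesis by simp
qed

lemma oproj_ident: "x \<in> K \<Longrightarrow> oproj K x = x"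
  by (rule oproj_unique) auto

lemma oproj_idem: "oproj K (oproj K x) = oproj K x"
  by (simp add: oproj_ident oproj_in)

lemma oproj_add: "oproj K (x + y) = oproj K x + oproj K y"
proof (rule oproj_unique)
  fix z assume "z \<in> K"
  then show "inner (x + y - (oproj K x + oproj K y)) z = 0"
    using oproj_orthogonal[of z x] oproj_orthogonal[of z y] by (simp add: inner_diff inner_add)
qed (simp add: oproj_in K subspace_add)

lemma oproj_scaleR: "oproj K (c *\<^sub>R x) = c *\<^sub>R oproj K x"
proof (rule oproj_unique)
  fix z assume "z \<in> K"
  then show "inner (c *\<^sub>R x - c *\<^sub>R oproj K x) z = 0"
    using oproj_orthogonal[of z x] by (simp add: inner_diff)
qed (simp add: oproj_in K subspace_scale)

lemma oproj_norm_sq: "(norm x)\<^sup>2 = (norm (oproj K x))\<^sup>2 + (norm (x - oproj K x))\<^sup>2"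
  using norm_add_sq_orthogonal[of "oproj K x" "x - oproj K x"] oproj_orthogonal[OF oproj_in]
  by (simp add: inner_commute)

lemma oproj_norm_le: "norm (oproj K x) \<le> norm x"
proof -
  have "(norm (oproj K x))\<^sup>2 \<le> (norm x)\<^sup>2" using oproj_norm_sq[of x] by simp
  then show ?thesis by (rule power2_le_imp_le) simp
qed

lemma bounded_linear_oproj: "bounded_linear (oproj K)"
  by (rule bounded_linear_intro[where K = 1]) (simp_all add: oproj_add oproj_scaleR oproj_norm_le)

lemma oproj_selfadjoint: "inner (oproj K x) y = inner x (oproj K y)"
proof -
  have "inner (oproj K x) y = inner (oproj K x) (oproj K y)"
    using oproj_orthogonal[OF oproj_in, of y x] by (simp add: inner_diff inner_commute)
  also have "\<dots> = inner x (oproj K y)"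
    using oproj_orthogonal[OF oproj_in, of x y] by (simp add: inner_diff inner_commute)
  finally show ?thesis .
qed

text \<open>Invariance of \<open>K\<close> under the adjoint \<open>S\<close> means that
  \<open>T\<close> also preserves the orthogonal complement, so \<open>T\<close> respects the
  decomposition of each vector.\<close>

lemma oproj_commute:
  assumes "bounded_linear T" and adj: "\<And>x y. inner (T x) y = inner x (S y)"
    and T: "\<And>x. x \<in> K \<Longrightarrow> T x \<in> K" and S: "\<And>x. x \<in> K \<Longrightarrow> S x \<in> K"
  shows "oproj K (T x) = T (oproj K x)"
proof (rule oproj_unique)
  fix z assume "z \<in> K"
  then have "inner (x - oproj K x) (S z) = 0" using S oproj_orthogonal by blast
  then show "inner (T x - T (oproj K x)) z = 0"
    using adj by (simp add: inner_diff)
qed (simp add: T oproj_in)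

end

text \<open>The kernel of a nonzero \<open>f\<close> has codimension one, so \<open>f\<close> is a
  multiple of the inner product with \<open>w\<close>, the component orthogonal to the kernel of any
  \<open>v\<close> outside it.\<close>

lemma riesz_representation:
  fixes f :: "'a::{real_inner,banach} \<Rightarrow> real"
  assumes "bounded_linear f"
  shows "\<exists>y. \<forall>x. f x = inner x y"
proof (cases "\<forall>x. f x = 0")
  case False
  interpret f: bounded_linear f by fact
  define K where "K = {x. f x = 0}"
  have K: "subspace K" "closed K"
    by (auto simp: K_def subspace_def f.add f.scale f.zero
        intro!: closed_Collect_eq continuous_intros linear_continuous_on assms)
  from False obtain v where v: "f v \<noteq> 0" by blast
  define w where "w = v - oproj K v"
  have fw: "f w \<noteq> 0" using oproj_in[OF K, of v] v by (simp add: w_def f.diff K_def)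
  then have w0: "inner w w \<noteq> 0" by (metis f.zero inner_eq_zero_iff)
  have "f x = inner x ((f w / inner w w) *\<^sub>R w)" for x
  proof -
    have "x - (f x / f w) *\<^sub>R w \<in> K" using fw by (simp add: K_def f.diff f.scale)
    then have "inner w (x - (f x / f w) *\<^sub>R w) = 0"
      unfolding w_def by (rule oproj_orthogonal[OF K])
    then show ?thesis using fw w0 by (simp add: inner_diff inner_commute field_simps)
  qed
  then show ?thesis by blast
qed (auto intro: exI[of _ 0])

lemma bounded_linear_adjoint_exists:
  fixes T :: "'a::{real_inner,banach} \<Rightarrow> 'a"
  assumes "bounded_linear T"
  shows "\<exists>S. bounded_linear S \<and> (\<forall>x y. inner (T x) y = inner x (S y))"
proof -
  interpret T: bounded_linear T by fact
  have "\<exists>s. \<forall>x. inner (T x) y = inner x s" for y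
    by (rule riesz_representation) (intro bounded_linear_intros assms)
  then obtain S where S: "\<And>x y. inner (T x) y = inner x (S y)" by metis
  obtain C where C: "\<And>x. norm (T x) \<le> norm x * C" using T.bounded by blast
  have "bounded_linear S"
  proof (rule bounded_linear_intro[where K = C])
    fix x y :: 'a and r :: real
    have "inner z (S (x + y)) = inner z (S x + S y)" for z
      by (simp add: S[symmetric] inner_add)
    then show "S (x + y) = S x + S y" by (rule iffD1[OF vector_eq_ldot, OF allI])
    have "inner z (S (r *\<^sub>R x)) = inner z (r *\<^sub>R S x)" for z
      by (simp add: S[symmetric])
    then show "S (r *\<^sub>R x) = r *\<^sub>R S x" by (rule iffD1[OF vector_eq_ldot, OF allI])
    have "norm (S x) * norm (S x) = inner (T (S x)) x"
      by (simp add: S power2_norm_eq_inner[symmetric] power2_eq_square[symmetric])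
    also have "\<dots> \<le> norm (T (S x)) * norm x" by (rule norm_cauchy_schwarz)
    also have "\<dots> \<le> (norm (S x) * C) * norm x" by (intro mult_right_mono C) simp
    finally have "norm (S x) * norm (S x) \<le> norm (S x) * (norm x * C)" by (simp add: algebra_simps)
    moreover have "0 \<le> norm x * C" using C[of x] norm_ge_zero order_trans by blast
    ultimately show "norm (S x) \<le> norm x * C" by (cases "norm (S x) = 0") auto
  qed
  then show ?thesis using S by blast
qed

text \<open>A rotation of the real plane also has vanishing quadratic form, so symmetry has to
  enter: at \<open>x + T x\<close> the two cross terms coincide, each being the squared norm of
  \<open>T x\<close>.\<close>

lemma selfadjoint_eq_0:
  fixes T :: "'a::real_inner \<Rightarrow> 'a"
  assumes "linear T" and sa: "\<And>x y. inner (T x) y = inner x (T y)"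
    and q: "\<And>x. inner (T x) x = 0"
  shows "T x = 0"
proof -
  interpret linear T by fact
  have "inner (T (x + T x)) (x + T x) = 0" by (rule q)
  then have "inner (T x) (T x) + inner (T (T x)) x = 0" by (simp add: add inner_add q)
  then have "2 * inner (T x) (T x) = 0" using sa[of "T x" x] by simp
  then show ?thesis by simp
qed

text \<open>This is what makes a spectral projection unique once its scalar measures are
  fixed.\<close>

lemma selfadjoint_eqI:
  fixes S T :: "'a::real_inner \<Rightarrow> 'a"
  assumes "linear S" "linear T" "\<And>x y. inner (S x) y = inner x (S y)"
    "\<And>x y. inner (T x) y = inner x (T y)" "\<And>x. inner (S x) x = inner (T x) x"
  shows "S = T"
proof
  fix x
  have "(\<lambda>x. S x - T x) x = 0"
    by (rule selfadjoint_eq_0) (use assms in \<open>auto simp: linear_compose_sub inner_diff\<close>)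
  then show "S x = T x" by simp
qed

section \<open>The Hausdorff moment problem\<close>

text \<open>The identity \<open>(n choose k) * (k choose j) = (n choose j) * (n - j choose (k -
  j))\<close> moves everything that depends on \<open>j\<close> alone out of the sum, and a binomial
  expansion remains. With \<open>a = X\<close> and \<open>b = 1 - X\<close> the power of
  \<open>a + b\<close> disappears.\<close>

lemma sum_choose_choose:
  fixes a b :: "'a::comm_ring_1"
  assumes "j \<le> n"
  shows "(\<Sum>k\<le>n. of_nat (k choose j) * (of_nat (n choose k) * (a ^ k * b ^ (n - k))))
       = of_nat (n choose j) * a ^ j * (a + b) ^ (n - j)"
proof -
  have "(\<Sum>k\<le>n. of_nat (k choose j) * (of_nat (n choose k) * (a ^ k * b ^ (n - k))))
      = (\<Sum>k\<in>{j..n}. of_nat (k choose j) * (of_nat (n choose k) * (a ^ k * b ^ (n - k))))"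
    by (rule sum.mono_neutral_right) (auto simp: not_le binomial_eq_0)
  also have "\<dots> = (\<Sum>k\<in>{j..n}. of_nat (n choose j) * a ^ j
      * (of_nat (n - j choose (k - j)) * a ^ (k - j) * b ^ (n - j - (k - j))))"
  proof (rule sum.cong[OF refl])
    fix k assume k: "k \<in> {j..n}"
    then have "(n choose k) * (k choose j) = (n choose j) * (n - j choose (k - j))"
      by (intro choose_mult) auto
    then have "of_nat (k choose j) * of_nat (n choose k)
        = (of_nat (n choose j) * of_nat (n - j choose (k - j)) :: 'a)"
      by (metis of_nat_mult mult.commute)
    moreover have "a ^ k = a ^ j * a ^ (k - j)" using k by (simp flip: power_add)
    moreover have "n - j - (k - j) = n - k" using k by auto
    moreover have "of_nat (k choose j) * (of_nat (n choose k) * (a ^ k * b ^ (n - k)))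
        = (of_nat (k choose j) * of_nat (n choose k)) * a ^ k * b ^ (n - k)"
      by (simp only: mult_ac)
    ultimately show "of_nat (k choose j) * (of_nat (n choose k) * (a ^ k * b ^ (n - k)))
      = of_nat (n choose j) * a ^ j * (of_nat (n - j choose (k - j)) * a ^ (k - j) * b ^ (n - j - (k - j)))"
      by (simp only: mult_ac)
  qed
  also have "\<dots> = of_nat (n choose j) * a ^ j
      * (\<Sum>i\<le>n - j. of_nat (n - j choose i) * a ^ i * b ^ (n - j - i))"
    unfolding sum_distrib_left
    by (rule sum.reindex_bij_witness[of _ "\<lambda>i. i + j" "\<lambda>k. k - j"]) (use assms in auto)
  finally show ?thesis by (simp add: binomial_ring)
qed

text \<open>The normalised factorial moments of the Bernstein measures of a functional are exact; this compares
  them with the moments.\<close>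

lemma choose_quotient_approx:
  assumes "j < n" "k \<le> n"
  shows "\<bar>real (k choose j) / real (n choose j) - (real k / real n) ^ j\<bar> \<le> real (j * j) / real (n - j)"
  using assms(1)
proof (induction j)
  case (Suc j)
  let ?g = "\<lambda>j. real (k choose j) / real (n choose j)"
  have jn: "j < n" using Suc by simp
  have step: "real (m choose Suc j) * real (Suc j) = real (m choose j) * (real m - real j)" for m
  proof (cases "j \<le> m")
    case True
    have "Suc j * (m choose Suc j) = (m choose j) * (m - j)"
    proof (cases "j = m")
      case False
      then show ?thesis using True
        by (metis binomial_absorb_comp binomial_absorption mult.commute)
    qed simp
    then have "real (Suc j * (m choose Suc j)) = real ((m choose j) * (m - j))" by simp
    then show ?thesis
      by (simp only: of_nat_mult of_nat_diff[OF True] mult.commute[of "real (m choose Suc j)"])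
  qed (simp add: not_le binomial_eq_0)
  have nz: "real (n choose j) \<noteq> 0" "real (n choose Suc j) \<noteq> 0" "real n - real j \<noteq> 0"
    using Suc.prems by auto
  have "?g (Suc j) = (real (k choose Suc j) * real (Suc j)) / (real (n choose Suc j) * real (Suc j))"
    by (simp del: of_nat_Suc)
  also have "\<dots> = ?g j * ((real k - real j) / (real n - real j))" unfolding step by simp
  \<comment> \<open>Raising \<open>j\<close> by one multiplies the quotient by
    \<open>(k - j) / (n - j)\<close>, but the power by \<open>k / n\<close>. The error
    \<open>one\<close> comes from exchanging these factors, the error \<open>two\<close> from the
    previous stage.\<close>
  finally have g: "?g (Suc j) = ?g j * ((real k - real j) / (real n - real j))" .
  have g01: "0 \<le> ?g j" "?g j \<le> 1"
    using assms(2) nz(1) binomial_right_mono[of k n j] by (auto simp: divide_le_eq_1)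
  have k01: "0 \<le> real k / real n" "real k / real n \<le> 1"
    using assms(2) by (auto simp: divide_le_eq_1)
  have one: "\<bar>?g j * ((real k - real j) / (real n - real j) - real k / real n)\<bar> \<le> real j / (real n - real j)"
  proof (cases "j \<le> k")
    case True
    have "(real k - real j) / (real n - real j) - real k / real n
        = - (real j * (real n - real k) / (real n * (real n - real j)))"
      using jn by (simp add: field_simps)
    moreover have "real j * (real n - real k) / (real n * (real n - real j)) \<le> real j / (real n - real j)"
      using jn assms(2) by (simp add: divide_simps mult_left_mono)
    moreover have "0 \<le> real j * (real n - real k) / (real n * (real n - real j))"
      using jn assms(2) by simp
    ultimately have "\<bar>(real k - real j) / (real n - real j) - real k / real n\<bar> \<le> real j / (real n - real j)"
      by (metis abs_minus_cancel abs_of_nonneg)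
    moreover have "\<bar>?g j\<bar> \<le> 1" using g01 by simp
    ultimately have "\<bar>?g j\<bar> * \<bar>(real k - real j) / (real n - real j) - real k / real n\<bar>
        \<le> 1 * (real j / (real n - real j))"
      by (intro mult_mono) auto
    then show ?thesis by (simp add: abs_mult)
  qed (use jn in \<open>simp add: not_le binomial_eq_0\<close>)
  have two: "\<bar>real k / real n * (?g j - (real k / real n) ^ j)\<bar> \<le> real (j * j) / (real n - real j)"
  proof -
    have "\<bar>real k / real n\<bar> * \<bar>?g j - (real k / real n) ^ j\<bar> \<le> 1 * (real (j * j) / (real n - real j))"
      using k01 Suc.IH[OF jn] jn by (intro mult_mono) (auto simp: of_nat_diff)
    then show ?thesis by (simp add: abs_mult)
  qed
  have "?g (Suc j) - (real k / real n) ^ Suc j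
      = ?g j * ((real k - real j) / (real n - real j) - real k / real n)
        + real k / real n * (?g j - (real k / real n) ^ j)"
    unfolding g by (simp add: algebra_simps)
  then have "\<bar>?g (Suc j) - (real k / real n) ^ Suc j\<bar> \<le> real j / (real n - real j) + real (j * j) / (real n - real j)"
    by (simp only: order_trans[OF abs_triangle_ineq add_mono[OF one two]])
  also have "\<dots> = real (j + j * j) / (real n - real j)" by (simp add: add_divide_distrib)
  also have "\<dots> \<le> real (Suc j * Suc j) / (real n - real (Suc j))"
    using Suc.prems by (intro frac_le) (auto simp del: of_nat_mult)
  finally show ?case using Suc.prems by (simp add: of_nat_diff)
qed simp

lemma poly_functional_sum:
  fixes L :: "real poly \<Rightarrow> real"
  assumes add: "\<And>p q. L (p + q) = L p + L q" and scale: "\<And>c p. L (smult c p) = c * L p"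
  shows "L (\<Sum>i\<in>A. f i) = (\<Sum>i\<in>A. L (f i))"
proof -
  have "L 0 = 0" using scale[of 0 0] by simp
  then show ?thesis by (induction A rule: infinite_finite_induct) (auto simp: add)
qed

lemma poly_functional_eq:
  fixes L :: "real poly \<Rightarrow> real"
  assumes add: "\<And>p q. L (p + q) = L p + L q" and scale: "\<And>c p. L (smult c p) = c * L p"
  shows "L p = (\<Sum>i\<le>degree p. coeff p i * L ([:0, 1:] ^ i))"
proof -
  have "L p = L (\<Sum>i\<le>degree p. smult (coeff p i) ([:0, 1:] ^ i))"
    by (subst poly_as_sum_of_monoms[symmetric]) (simp add: monom_altdef)
  then show ?thesis by (simp add: poly_functional_sum[OF add scale] scale)
qed

lemma integrable_bounded_on_unit:
  fixes f :: "real \<Rightarrow> real"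
  assumes "finite_measure \<nu>" "sets \<nu> = sets borel" "AE t in \<nu>. t \<in> {0..1}"
    and "f \<in> borel_measurable borel" "\<And>t. t \<in> {0..1} \<Longrightarrow> \<bar>f t\<bar> \<le> C"
  shows "integrable \<nu> f"
proof -
  interpret finite_measure \<nu> by fact
  have "f \<in> borel_measurable \<nu>" using assms(2,4) measurable_cong_sets by blast
  moreover have "AE t in \<nu>. norm (f t) \<le> C"
    using assms(3) by eventually_elim (use assms(5) in auto)
  ultimately show ?thesis by (intro integrable_const_bound) auto
qed

lemma poly_bounded_on_unit:
  "\<exists>C. \<forall>t\<in>{0..1}. \<bar>poly p t\<bar> \<le> (C::real)"
proof -
  have "compact (poly p ` {0..1})" by (intro compact_continuous_image continuous_intros compact_Icc)
  then have "bounded (poly p ` {0..1})" by (rule compact_imp_bounded)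
  then show ?thesis by (auto simp: bounded_iff)
qed

lemma borel_measurable_poly [measurable]: "poly p \<in> borel_measurable (borel :: real measure)"
  by (intro borel_measurable_continuous_onI continuous_intros)

lemma integrable_poly_unit:
  assumes "finite_measure \<nu>" "sets \<nu> = sets borel" "AE t in \<nu>. t \<in> {0..1::real}"
  shows "integrable \<nu> (poly p)"
  using poly_bounded_on_unit[of p] integrable_bounded_on_unit[OF assms borel_measurable_poly] by blast

text \<open>The measures with mass \<open>w n k\<close> at \<open>k / n\<close> live on [0,1], so a
  subsequence converges weakly; their moments are within O(1/n) of those prescribed by
  \<open>L\<close>, and the limit has exactly these.\<close>

theorem hausdorff_moment_problem:
  fixes L :: "real poly \<Rightarrow> real"
  assumes add: "\<And>p q. L (p + q) = L p + L q" and scale: "\<And>c p. L (smult c p) = c * L p"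
    and pos: "\<And>k m. 0 \<le> L ([:0, 1:] ^ k * [:1, -1:] ^ m)" and one: "L 1 = 1"
  shows "\<exists>\<nu>. real_distribution \<nu> \<and> (AE t in \<nu>. t \<in> {0..1}) \<and> (\<forall>p. (\<integral>t. poly p t \<partial>\<nu>) = L p)"
proof -
  \<comment> \<open>\<open>L\<close> evaluated at the Bernstein basis polynomial of degree
    \<open>n\<close> and index \<open>k\<close>.\<close>
  define w where "w n k = real (n choose k) * L ([:0, 1:] ^ k * [:1, -1:] ^ (n - k))" for n k
  have w0: "0 \<le> w n k" for n k by (simp add: w_def pos)
  have fact: "(\<Sum>k\<le>n. real (k choose j) * w n k) = real (n choose j) * L ([:0, 1:] ^ j)" if "j \<le> n" for j n
  proof -
    have "(\<Sum>k\<le>n. real (k choose j) * w n k)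
        = L (\<Sum>k\<le>n. of_nat (k choose j) * (of_nat (n choose k) * ([:0, 1:] ^ k * [:1, -1:] ^ (n - k))))"
      by (simp add: poly_functional_sum[OF add scale] of_nat_mult_conv_smult scale w_def mult_ac)
    also have "\<dots> = L (of_nat (n choose j) * [:0, 1:] ^ j * ([:0, 1:] + [:1, -1:]) ^ (n - j))"
      unfolding sum_choose_choose[OF that] ..
    also have "[:0, 1:] + [:1, -1:] = (1 :: real poly)" by simp
    finally show ?thesis by (simp add: of_nat_mult_conv_smult scale)
  qed
  have w1: "(\<Sum>k\<le>n. w n k) = 1" for n using fact[of 0 n] by (simp add: one)
  define P where "P n = embed_pmf (\<lambda>k. if k \<le> n then w n k else 0)" for n
  have pmfP: "pmf (P n) k = (if k \<le> n then w n k else 0)" for n k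
    unfolding P_def
  proof (rule pmf_embed_pmf)
    have "(\<integral>\<^sup>+ k. ennreal (if k \<le> n then w n k else 0) \<partial>count_space UNIV)
        = (\<Sum>k\<le>n. ennreal (if k \<le> n then w n k else 0))"
      by (rule nn_integral_count_space') auto
    also have "\<dots> = ennreal (\<Sum>k\<le>n. w n k)" by (simp add: sum_ennreal w0)
    finally show "(\<integral>\<^sup>+ k. ennreal (if k \<le> n then w n k else 0) \<partial>count_space UNIV) = 1" by (simp add: w1)
  qed (auto simp: w0)
  define B where "B n = distr (measure_pmf (P n)) borel (\<lambda>k. real k / real n)" for n
  have intB: "(\<integral>t. f t \<partial>B n) = (\<Sum>k\<le>n. f (real k / real n) * w n k)"
    if "f \<in> borel_measurable borel" for f :: "real \<Rightarrow> real" and n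
  proof -
    have "(\<integral>t. f t \<partial>B n) = (\<integral>k. f (real k / real n) \<partial>measure_pmf (P n))"
      unfolding B_def by (rule integral_distr) (use that in auto)
    also have "\<dots> = (\<Sum>k\<le>n. f (real k / real n) * pmf (P n) k)"
      by (rule integral_measure_pmf_real) (auto simp: set_pmf_iff pmfP split: if_splits)
    finally show ?thesis by (simp add: pmfP)
  qed
  have distB: "real_distribution (B n)" for n
  proof -
    interpret prob_space "B n" unfolding B_def by (rule prob_space.prob_space_distr) (auto intro: prob_space_measure_pmf)
    show ?thesis by unfold_locales (simp_all add: B_def)
  qed
  \<comment> \<open>\<open>tight\<close> is phrased with intervals open on the left, so the interval
    has to start below 0 to catch an atom at 0.\<close>
  have unitB: "measure (B n) {-1<..1} = 1" for n
  proof -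
    interpret real_distribution "B n" by (rule distB)
    have "measure (B n) {-1<..1} = (\<integral>t. indicator {-1<..1} t \<partial>B n)" by simp
    also have "\<dots> = (\<Sum>k\<le>n. indicator {-1<..1} (real k / real n) * w n k)"
      by (rule intB) auto
    also have "\<dots> = (\<Sum>k\<le>n. w n k)"
    proof (rule sum.cong[OF refl])
      fix k assume "k \<in> {..n}"
      then have "real k / real n \<le> 1" by (auto simp: divide_le_eq_1)
      moreover have "- 1 < real k / real n" by (rule less_le_trans[of _ 0]) auto
      ultimately show "indicator {-1<..1} (real k / real n) * w n k = w n k" by simp
    qed
    finally show ?thesis by (simp add: w1)
  qed
  have "tight B"
    unfolding tight_def
  proof (intro conjI allI impI distB)
    fix e :: real assume "0 < e"
    then show "\<exists>a b. a < b \<and> (\<forall>n. measure (B n) {a<..b} > 1 - e)"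
      by (intro exI[of _ "-1"] exI[of _ 1]) (simp add: unitB)
  qed
  then obtain r \<nu> where r: "strict_mono r" and \<nu>: "real_distribution \<nu>" "weak_conv_m (B \<circ> id \<circ> r) \<nu>"
    using tight_imp_convergent_subsubsequence[of B id] strict_mono_id by blast
  interpret \<nu>: real_distribution \<nu> by fact
  have conv: "(\<lambda>n. \<integral>t. f t \<partial>B (r n)) \<longlonglongrightarrow> (\<integral>t. f t \<partial>\<nu>)"
    if "\<And>t. isCont f t" "\<And>t. \<bar>f t\<bar> \<le> 1" for f :: "real \<Rightarrow> real"
    using weak_conv_imp_integral_bdd_continuous_conv[of "B \<circ> id \<circ> r" \<nu> f 1] that \<nu> distB by (simp add: comp_def)
  have grid: "0 \<le> real k / real n" "real k / real n \<le> 1" if "k \<le> n" for k n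
    using that by (auto simp: divide_le_eq_1)
  \<comment> \<open>A bounded continuous function whose zero set is exactly [0,1]: weak convergence
    transports the vanishing of its integral to the limit, which is therefore carried by
    [0,1].\<close>
  define h :: "real \<Rightarrow> real" where "h t = max 0 (min 1 (max (- t) (t - 1)))" for t
  have h0: "h t = 0" if "0 \<le> t" "t \<le> 1" for t using that by (simp add: h_def)
  have hb: "h \<in> borel_measurable borel" unfolding h_def[abs_def] by simp
  have "(\<lambda>n. \<integral>t. h t \<partial>B (r n)) \<longlonglongrightarrow> (\<integral>t. h t \<partial>\<nu>)"
    by (rule conv) (auto simp: h_def intro!: continuous_intros)
  moreover have "(\<integral>t. h t \<partial>B n) = 0" for n
    unfolding intB[OF hb]
  proof (intro sum.neutral ballI)
    fix k assume "k \<in> {..n}"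
    then show "h (real k / real n) * w n k = 0" using h0[OF grid[of k n]] by simp
  qed
  ultimately have "(\<integral>t. h t \<partial>\<nu>) = 0" by (simp add: LIMSEQ_const_iff)
  moreover have "integrable \<nu> h"
    using \<nu>.finite_measure_axioms \<nu>.events_eq_borel
    by (intro finite_measure.integrable_const_bound[of _ _ 1])
      (auto simp: h_def[abs_def] intro!: AE_I2)
  ultimately have "AE t in \<nu>. h t = 0"
    by (subst (asm) integral_nonneg_eq_0_iff_AE) (auto simp: h_def)
  then have unit: "AE t in \<nu>. t \<in> {0..1}" by eventually_elim (auto simp: h_def)
  have mom: "(\<integral>t. t ^ j \<partial>\<nu>) = L ([:0, 1:] ^ j)" for j
  proof -
    \<comment> \<open>Weak convergence tests bounded continuous functions only; the truncation
      agrees with the power on [0,1], where all the measures live.\<close>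
    define f where "f t = (max 0 (min 1 t)) ^ j" for t :: real
    have fb: "f \<in> borel_measurable borel" unfolding f_def[abs_def] by simp
    have A: "(\<lambda>n. \<integral>t. f t \<partial>B (r n)) \<longlonglongrightarrow> (\<integral>t. f t \<partial>\<nu>)"
      by (rule conv) (auto simp: f_def abs_mult power_abs intro!: continuous_intros power_le_one)
    have "(\<lambda>n. (\<integral>t. f t \<partial>B n) - L ([:0, 1:] ^ j)) \<longlonglongrightarrow> 0"
    proof (rule Lim_null_comparison)
      show "(\<lambda>n. real (j * j) / real (n - j)) \<longlonglongrightarrow> 0"
      proof -
        have "(\<lambda>n. real (j * j) / real n) \<longlonglongrightarrow> 0" by (rule lim_const_over_n)
        then have "(\<lambda>n. real (j * j) / real (n + j - j)) \<longlonglongrightarrow> 0" by simp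
        then show ?thesis by (rule LIMSEQ_offset)
      qed
      show "\<forall>\<^sub>F n in sequentially. norm ((\<integral>t. f t \<partial>B n) - L ([:0, 1:] ^ j)) \<le> real (j * j) / real (n - j)"
        using eventually_gt_at_top[of j]
      proof eventually_elim
        fix n assume n: "j < n"
        have cn: "real (n choose j) \<noteq> 0" using n by simp
        have "L ([:0, 1:] ^ j) = (\<Sum>k\<le>n. real (k choose j) * w n k) / real (n choose j)"
          using fact[of j n] n cn by simp
        then have E: "(\<integral>t. f t \<partial>B n) - L ([:0, 1:] ^ j)
            = (\<Sum>k\<le>n. f (real k / real n) * w n k - real (k choose j) * w n k / real (n choose j))"
          unfolding intB[OF fb] by (simp add: sum_subtractf sum_divide_distrib)
        have "norm ((\<integral>t. f t \<partial>B n) - L ([:0, 1:] ^ j))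
            \<le> (\<Sum>k\<le>n. \<bar>f (real k / real n) * w n k - real (k choose j) * w n k / real (n choose j)\<bar>)"
          unfolding E real_norm_def by (rule sum_abs)
        also have "\<dots> \<le> (\<Sum>k\<le>n. real (j * j) / real (n - j) * w n k)"
        proof (rule sum_mono)
          fix k assume "k \<in> {..n}"
          then have k: "k \<le> n" by simp
          have fk: "f (real k / real n) = (real k / real n) ^ j"
            using grid[OF k] by (simp add: f_def)
          have E: "f (real k / real n) * w n k - real (k choose j) * w n k / real (n choose j)
              = - ((real (k choose j) / real (n choose j) - (real k / real n) ^ j) * w n k)"
            by (simp add: fk algebra_simps)
          have "\<bar>f (real k / real n) * w n k - real (k choose j) * w n k / real (n choose j)\<bar>
              = \<bar>real (k choose j) / real (n choose j) - (real k / real n) ^ j\<bar> * w n k"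
            unfolding E by (simp add: abs_mult w0)
          also have "\<dots> \<le> real (j * j) / real (n - j) * w n k"
            by (rule mult_right_mono[OF choose_quotient_approx[OF n k] w0])
          finally show "\<bar>f (real k / real n) * w n k - real (k choose j) * w n k / real (n choose j)\<bar>
              \<le> real (j * j) / real (n - j) * w n k" .
        qed
        also have "\<dots> = real (j * j) / real (n - j)" by (subst sum_distrib_left[symmetric]) (simp add: w1)
        finally show "norm ((\<integral>t. f t \<partial>B n) - L ([:0, 1:] ^ j)) \<le> real (j * j) / real (n - j)" .
      qed
    qed
    then have "(\<lambda>n. \<integral>t. f t \<partial>B n) \<longlonglongrightarrow> L ([:0, 1:] ^ j)" by (simp add: LIM_zero_iff)
    then have "(\<lambda>n. \<integral>t. f t \<partial>B (r n)) \<longlonglongrightarrow> L ([:0, 1:] ^ j)"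
      using LIMSEQ_subseq_LIMSEQ[OF _ r] by (auto simp: comp_def)
    then have "(\<integral>t. f t \<partial>\<nu>) = L ([:0, 1:] ^ j)" using A LIMSEQ_unique by blast
    moreover have "(\<integral>t. f t \<partial>\<nu>) = (\<integral>t. t ^ j \<partial>\<nu>)"
      by (rule integral_cong_AE) (use unit in \<open>auto simp: f_def\<close>)
    ultimately show ?thesis by simp
  qed
  have "(\<integral>t. poly p t \<partial>\<nu>) = L p" for p
  proof -
    have "poly ([:0, 1:] ^ i) = (\<lambda>t. t ^ i :: real)" for i by (simp add: fun_eq_iff)
    then have int: "integrable \<nu> (\<lambda>t. t ^ i)" for i
      using integrable_poly_unit[OF \<nu>.finite_measure_axioms \<nu>.events_eq_borel unit, of "[:0,1:] ^ i"]
      by simp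
    have "(\<integral>t. poly p t \<partial>\<nu>) = (\<Sum>i\<le>degree p. coeff p i * L ([:0, 1:] ^ i))"
      unfolding poly_altdef by (subst Bochner_Integration.integral_sum) (auto simp: int mom)
    then show ?thesis using poly_functional_eq[OF add scale, of p] by simp
  qed
  then show ?thesis using \<nu>(1) unit by blast
qed

section \<open>Functional calculus for positive contractions\<close>

definition unit_measure :: "real measure \<Rightarrow> bool" where
  "unit_measure \<nu> \<longleftrightarrow> finite_measure \<nu> \<and> sets \<nu> = sets borel \<and> (AE t in \<nu>. t \<in> {0..1})"

lemma integrable_unit_measure:
  fixes f :: "real \<Rightarrow> real"
  assumes "unit_measure \<nu>" "f \<in> borel_measurable borel" "\<And>t. t \<in> {0..1} \<Longrightarrow> \<bar>f t\<bar> \<le> C"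
  shows "integrable \<nu> f"
  by (rule integrable_bounded_on_unit[where C = C]) (use assms in \<open>auto simp: unit_measure_def\<close>)

lemma borel_measurable_unit_measure:
  assumes "unit_measure \<nu>" "f \<in> borel_measurable borel"
  shows "f \<in> borel_measurable \<nu>"
  using assms measurable_cong_sets unfolding unit_measure_def by blast

text \<open>Bounded pointwise convergence is what dominated convergence needs to make the operators
  converge strongly. Only the values on [0,1] matter; as this leaves \<open>f\<close> free
  elsewhere, Borel measurability is a separate clause.\<close>

definition poly_lim :: "(nat \<Rightarrow> real poly) \<Rightarrow> (real \<Rightarrow> real) \<Rightarrow> bool" where
  "poly_lim p f \<longleftrightarrow> f \<in> borel_measurable borel \<and>
     (\<exists>C. \<forall>n. \<forall>t\<in>{0..1}. \<bar>poly (p n) t\<bar> \<le> C) \<and>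
     (\<forall>t\<in>{0..1}. (\<lambda>n. poly (p n) t) \<longlonglongrightarrow> f t)"

text \<open>These functions form an algebra containing the continuous ones and the indicators of
  open upper half-lines. Closure under limits fails; general Borel sets are reached later, at the
  level of projections.\<close>

definition bfun :: "(real \<Rightarrow> real) \<Rightarrow> bool" where
  "bfun f \<longleftrightarrow> (\<exists>p. poly_lim p f)"

lemma bfun_measurable: "bfun f \<Longrightarrow> f \<in> borel_measurable borel"
  by (auto simp: bfun_def poly_lim_def)

lemma poly_lim_bounded:
  assumes "poly_lim p f"
  shows "\<exists>C. (\<forall>n. \<forall>t\<in>{0..1}. \<bar>poly (p n) t\<bar> \<le> C) \<and> (\<forall>t\<in>{0..1}. \<bar>f t\<bar> \<le> C)"
proof -
  obtain C where C: "\<And>n t. t \<in> {0..1} \<Longrightarrow> \<bar>poly (p n) t\<bar> \<le> C"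
    and l: "\<And>t. t \<in> {0..1} \<Longrightarrow> (\<lambda>n. poly (p n) t) \<longlonglongrightarrow> f t"
    using assms unfolding poly_lim_def by blast
  have "\<bar>f t\<bar> \<le> C" if "t \<in> {0..1}" for t
    by (rule LIMSEQ_le_const2[OF tendsto_rabs[OF l[OF that]]]) (use C that in auto)
  then show ?thesis using C by blast
qed

lemma bfun_bounded:
  assumes "bfun f" shows "\<exists>C. \<forall>t\<in>{0..1}. \<bar>f t\<bar> \<le> C"
  using assms poly_lim_bounded unfolding bfun_def by blast

lemma poly_lim_const: "poly_lim (\<lambda>_. p) (poly p)"
  using poly_bounded_on_unit[of p] by (auto simp: poly_lim_def)

lemma poly_lim_add: "poly_lim p f \<Longrightarrow> poly_lim q g \<Longrightarrow> poly_lim (\<lambda>n. p n + q n) (\<lambda>t. f t + g t)"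
  unfolding poly_lim_def
proof (elim conjE exE, intro conjI)
  fix C D assume C: "\<forall>n. \<forall>t\<in>{0..1}. \<bar>poly (p n) t\<bar> \<le> C" and D: "\<forall>n. \<forall>t\<in>{0..1}. \<bar>poly (q n) t\<bar> \<le> D"
  have "\<bar>poly (p n + q n) t\<bar> \<le> C + D" if "t \<in> {0..1}" for n t
    using C[rule_format, OF that, of n] D[rule_format, OF that, of n] by simp
  then show "\<exists>C. \<forall>n. \<forall>t\<in>{0..1}. \<bar>poly (p n + q n) t\<bar> \<le> C" by blast
qed (auto intro!: tendsto_add)

lemma poly_lim_mult: "poly_lim p f \<Longrightarrow> poly_lim q g \<Longrightarrow> poly_lim (\<lambda>n. p n * q n) (\<lambda>t. f t * g t)"
  unfolding poly_lim_def
proof (elim conjE exE, intro conjI)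
  fix C D assume C: "\<forall>n. \<forall>t\<in>{0..1}. \<bar>poly (p n) t\<bar> \<le> C" and D: "\<forall>n. \<forall>t\<in>{0..1}. \<bar>poly (q n) t\<bar> \<le> D"
  have "\<bar>poly (p n * q n) t\<bar> \<le> C * D" if t: "t \<in> {0..1}" for n t
  proof -
    have "0 \<le> C" using C[rule_format, OF t, of n] by linarith
    then show ?thesis
      using C[rule_format, OF t, of n] D[rule_format, OF t, of n] by (auto simp: abs_mult intro!: mult_mono)
  qed
  then show "\<exists>C. \<forall>n. \<forall>t\<in>{0..1}. \<bar>poly (p n * q n) t\<bar> \<le> C" by blast
qed (auto intro!: tendsto_mult)

lemma poly_lim_cong:
  "poly_lim p f \<Longrightarrow> g \<in> borel_measurable borel \<Longrightarrow> (\<And>t. t \<in> {0..1} \<Longrightarrow> f t = g t) \<Longrightarrow> poly_lim p g"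
  by (simp add: poly_lim_def)

lemma bfun_poly: "bfun (poly p)"
  using poly_lim_const bfun_def by blast

lemma bfun_const: "bfun (\<lambda>_. c)"
proof -
  have "poly [:c:] = (\<lambda>_. c)" by auto
  then show ?thesis using bfun_poly[of "[:c:]"] by simp
qed

lemma bfun_id: "bfun (\<lambda>t. t)"
proof -
  have "poly [:0, 1:] = (\<lambda>t. t :: real)" by auto
  then show ?thesis using bfun_poly[of "[:0, 1:]"] by simp
qed

lemma bfun_add: "bfun f \<Longrightarrow> bfun g \<Longrightarrow> bfun (\<lambda>t. f t + g t)"
  using poly_lim_add unfolding bfun_def by blast

lemma bfun_mult: "bfun f \<Longrightarrow> bfun g \<Longrightarrow> bfun (\<lambda>t. f t * g t)"
  using poly_lim_mult unfolding bfun_def by blast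

lemma bfun_diff: "bfun f \<Longrightarrow> bfun g \<Longrightarrow> bfun (\<lambda>t. f t - g t)"
  using bfun_add[of f "\<lambda>t. -1 * g t"] bfun_mult[OF bfun_const[of "-1"], of g] by simp

lemma bfun_power2: "bfun f \<Longrightarrow> bfun (\<lambda>t. (f t)\<^sup>2)"
  using bfun_mult[of f f] by (simp add: power2_eq_square)

lemma weierstrass_poly:
  fixes f :: "real \<Rightarrow> real"
  assumes "continuous_on {0..1} f" "e > 0"
  shows "\<exists>p. \<forall>t\<in>{0..1}. \<bar>f t - poly p t\<bar> < e"
proof -
  obtain g where g: "real_polynomial_function g" "\<And>t. t \<in> {0..1} \<Longrightarrow> \<bar>f t - g t\<bar> < e"
    using Stone_Weierstrass_real_polynomial_function[OF compact_Icc assms] by blast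
  then obtain a n where "g = (\<lambda>x. \<Sum>i\<le>n. a i * x ^ i)"
    using real_polynomial_function_imp_sum by blast
  then have "g t = poly (\<Sum>i\<le>n. monom (a i) i) t" for t
    by (simp add: poly_sum poly_monom)
  then show ?thesis using g(2) by metis
qed

text \<open>A polynomial chosen within \<open>1 / (n + 1)\<close> of \<open>h n\<close> on [0,1]
  inherits both the bound, up to 1, and the limit.\<close>

lemma bfun_limit:
  assumes f: "f \<in> borel_measurable borel" and cont: "\<And>n. continuous_on {0..1} (h n)"
    and bd: "\<And>n t. t \<in> {0..1} \<Longrightarrow> \<bar>h n t\<bar> \<le> C"
    and lim: "\<And>t. t \<in> {0..1} \<Longrightarrow> (\<lambda>n. h n t) \<longlonglongrightarrow> f t"
  shows "bfun f"
proof -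
  have "\<forall>n. \<exists>p. \<forall>t\<in>{0..1}. \<bar>h n t - poly p t\<bar> < inverse (Suc n)"
    using weierstrass_poly[OF cont] by simp
  then obtain p where p: "\<And>n t. t \<in> {0..1} \<Longrightarrow> \<bar>h n t - poly (p n) t\<bar> < inverse (Suc n)"
    by metis
  have "\<bar>poly (p n) t\<bar> \<le> C + 1" if t: "t \<in> {0..1}" for n t
  proof -
    have "inverse (Suc n) \<le> (1 :: real)" by (simp add: inverse_le_1_iff)
    then show ?thesis using p[OF t, of n] bd[OF t, of n] by linarith
  qed
  moreover have "(\<lambda>n. poly (p n) t) \<longlonglongrightarrow> f t" if t: "t \<in> {0..1}" for t
  proof -
    have "(\<lambda>n. h n t - poly (p n) t) \<longlonglongrightarrow> 0"
      by (rule Lim_null_comparison[OF _ LIMSEQ_inverse_real_of_nat])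
        (use p[OF t] in \<open>auto intro!: always_eventually less_imp_le\<close>)
    from tendsto_diff[OF lim[OF t] this] show ?thesis by simp
  qed
  ultimately show ?thesis using f unfolding bfun_def poly_lim_def by blast
qed

lemma bfun_continuous:
  assumes "f \<in> borel_measurable borel" "continuous_on {0..1} f"
  shows "bfun f"
proof -
  have "bounded (f ` {0..1})"
    by (intro compact_imp_bounded compact_continuous_image assms compact_Icc)
  then obtain C where "\<And>t. t \<in> {0..1} \<Longrightarrow> \<bar>f t\<bar> \<le> C" unfolding bounded_iff real_norm_def by blast
  then show ?thesis by (intro bfun_limit[of f "\<lambda>_. f" C]) (auto simp: assms)
qed

lemma bfun_greaterThan: "bfun (indicator {l<..})"
proof (rule bfun_limit)
  \<comment> \<open>Ramps of slope \<open>n\<close> starting at \<open>l\<close>; they vanish at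
    \<open>l\<close> itself, hence the open half-line.\<close>
  let ?h = "\<lambda>n t. max 0 (min 1 (real n * (t - l)))"
  show "continuous_on {0..1} (?h n)" for n by (intro continuous_intros)
  show "\<bar>?h n t\<bar> \<le> 1" for n t by simp
  show "(\<lambda>n. ?h n t) \<longlonglongrightarrow> indicator {l<..} t" for t
  proof (cases "t > l")
    case True
    obtain N :: nat where "1 / (t - l) < real N" using reals_Archimedean2 by blast
    then have N: "1 \<le> real N * (t - l)" using True by (simp add: field_simps)
    have "?h n t = 1" if "n \<ge> N" for n
    proof -
      have "real N * (t - l) \<le> real n * (t - l)" using that True by (intro mult_right_mono) auto
      then show ?thesis using N by simp
    qed
    then have "\<forall>\<^sub>F n in sequentially. ?h n t = 1" using eventually_sequentially by blast
    then show ?thesis using True by (simp add: tendsto_eventually)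
  next
    case False
    then have "real n * (t - l) \<le> 0" for n by (simp add: mult_nonneg_nonpos)
    then have "?h n t = 0" for n by (intro max_absorb1 order_trans[OF min.cobounded2])
    then show ?thesis using False by simp
  qed
qed simp

text \<open>The first part carries identities of moments over to limits of polynomials; the second,
  mean square convergence, will make operator sequences Cauchy.\<close>

lemma poly_lim_integral:
  assumes "unit_measure \<nu>" "poly_lim p f"
  shows "(\<lambda>n. \<integral>t. poly (p n) t \<partial>\<nu>) \<longlonglongrightarrow> (\<integral>t. f t \<partial>\<nu>)"
    and "(\<lambda>n. \<integral>t. (poly (p n) t - f t)\<^sup>2 \<partial>\<nu>) \<longlonglongrightarrow> 0"
proof -
  interpret finite_measure \<nu> using assms(1) by (simp add: unit_measure_def)
  have unit: "AE t in \<nu>. t \<in> {0..1}" using assms(1) by (simp add: unit_measure_def)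
  have m: "f \<in> borel_measurable \<nu>" "\<And>q. poly q \<in> borel_measurable \<nu>"
    using assms(2) borel_measurable_unit_measure[OF assms(1)]
      borel_measurable_unit_measure[OF assms(1) borel_measurable_poly] by (auto simp: poly_lim_def)
  obtain C where C: "\<And>n t. t \<in> {0..1} \<Longrightarrow> \<bar>poly (p n) t\<bar> \<le> C" "\<And>t. t \<in> {0..1} \<Longrightarrow> \<bar>f t\<bar> \<le> C"
    using poly_lim_bounded[OF assms(2)] by blast
  have l: "\<And>t. t \<in> {0..1} \<Longrightarrow> (\<lambda>n. poly (p n) t) \<longlonglongrightarrow> f t"
    using assms(2) by (simp add: poly_lim_def)
  show "(\<lambda>n. \<integral>t. poly (p n) t \<partial>\<nu>) \<longlonglongrightarrow> (\<integral>t. f t \<partial>\<nu>)"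
  proof (rule integral_dominated_convergence[where w = "\<lambda>_. C"])
    show "AE t in \<nu>. (\<lambda>n. poly (p n) t) \<longlonglongrightarrow> f t" using unit by eventually_elim (rule l)
    show "AE t in \<nu>. norm (poly (p n) t) \<le> C" for n using unit by eventually_elim (use C in auto)
  qed (use m in auto)
  have "(\<lambda>n. \<integral>t. (poly (p n) t - f t)\<^sup>2 \<partial>\<nu>) \<longlonglongrightarrow> (\<integral>t. 0 \<partial>\<nu>)"
  proof (rule integral_dominated_convergence[where w = "\<lambda>_. (2 * C)\<^sup>2"])
    show "AE t in \<nu>. (\<lambda>n. (poly (p n) t - f t)\<^sup>2) \<longlonglongrightarrow> 0"
      using unit
    proof eventually_elim
      fix t :: real assume "t \<in> {0..1}"
      from tendsto_power[OF tendsto_diff[OF l[OF this] tendsto_const[of "f t"]], of 2]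
      show "(\<lambda>n. (poly (p n) t - f t)\<^sup>2) \<longlonglongrightarrow> 0" by simp
    qed
    show "AE t in \<nu>. norm ((poly (p n) t - f t)\<^sup>2) \<le> (2 * C)\<^sup>2" for n
      using unit
    proof eventually_elim
      fix t :: real assume "t \<in> {0..1}"
      then have "\<bar>poly (p n) t - f t\<bar> \<le> 2 * C" using C(1)[of t n] C(2)[of t] by linarith
      then have "\<bar>poly (p n) t - f t\<bar>\<^sup>2 \<le> (2 * C)\<^sup>2" by (intro power_mono) auto
      then show "norm ((poly (p n) t - f t)\<^sup>2) \<le> (2 * C)\<^sup>2" by simp
    qed
  qed (use m in auto)
  then show "(\<lambda>n. \<integral>t. (poly (p n) t - f t)\<^sup>2 \<partial>\<nu>) \<longlonglongrightarrow> 0" by simp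
qed

text \<open>Equal moments give equal integrals of all bounded limits of polynomials, in particular
  of the indicators of half-lines, which determine a finite Borel measure.\<close>

lemma unit_measure_unique:
  assumes \<nu>: "unit_measure \<nu>" "unit_measure \<nu>'"
    and eq: "\<And>p. (\<integral>t. poly p t \<partial>\<nu>) = (\<integral>t. poly p t \<partial>\<nu>')"
  shows "\<nu> = \<nu>'"
proof (rule measure_eqI_lessThan)
  interpret a: finite_measure \<nu> using \<nu> by (simp add: unit_measure_def)
  interpret b: finite_measure \<nu>' using \<nu> by (simp add: unit_measure_def)
  show s: "sets \<nu> = sets borel" "sets \<nu>' = sets borel" using \<nu> by (auto simp: unit_measure_def)
  show "emeasure \<nu> {x<..} < \<infinity>" for x by (simp add: less_top[symmetric])
  show "emeasure \<nu> {x<..} = emeasure \<nu>' {x<..}" for x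
  proof -
    obtain p where p: "poly_lim p (indicator {x<..})" using bfun_greaterThan[of x] by (auto simp: bfun_def)
    have "(\<integral>t. indicator {x<..} t \<partial>\<nu>) = (\<integral>t. indicator {x<..} t \<partial>\<nu>' :: real)"
      using poly_lim_integral(1)[OF \<nu>(1) p] poly_lim_integral(1)[OF \<nu>(2) p]
      unfolding eq by (rule LIMSEQ_unique)
    then have "measure \<nu> {x<..} = measure \<nu>' {x<..}" using s by simp
    then show ?thesis by (simp add: a.emeasure_eq_measure b.emeasure_eq_measure)
  qed
qed

section \<open>Polynomials in an operator\<close>

definition pop :: "('a::real_vector \<Rightarrow> 'a) \<Rightarrow> real poly \<Rightarrow> 'a \<Rightarrow> 'a" where
  "pop T p x = (\<Sum>i\<le>degree p. coeff p i *\<^sub>R (T ^^ i) x)"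

lemma pop_altdef:
  assumes "degree p \<le> n"
  shows "pop T p x = (\<Sum>i\<le>n. coeff p i *\<^sub>R (T ^^ i) x)"
  unfolding pop_def
  by (rule sum.mono_neutral_left) (use assms in \<open>auto simp: coeff_eq_0\<close>)

lemma pop_0 [simp]: "pop T 0 x = 0"
  by (simp add: pop_def)

lemma pop_const [simp]: "pop T [:c:] x = c *\<^sub>R x"
  by (simp add: pop_def)

lemma pop_1 [simp]: "pop T 1 x = x"
  by (simp add: pop_def)

lemma pop_add: "pop T (p + q) x = pop T p x + pop T q x"
proof -
  let ?n = "max (degree p) (degree q)"
  have "degree (p + q) \<le> ?n" by (rule degree_add_le_max)
  then show ?thesis
    by (simp add: pop_altdef[of _ ?n] sum.distrib scaleR_add_left)
qed

lemma pop_smult: "pop T (smult c p) x = c *\<^sub>R pop T p x"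
  by (simp add: pop_altdef[of "smult c p" "degree p"] degree_smult_le pop_def scaleR_sum_right)

lemma pop_diff: "pop T (p - q) x = pop T p x - pop T q x"
proof -
  have "p - q = p + smult (-1) q" by simp
  then show ?thesis by (simp only: pop_add pop_smult) simp
qed

lemma pop_pCons:
  assumes "linear T"
  shows "pop T (pCons a p) x = a *\<^sub>R x + T (pop T p x)"
proof -
  interpret linear T by fact
  have "pop T (pCons a p) x = (\<Sum>i\<le>Suc (degree p). coeff (pCons a p) i *\<^sub>R (T ^^ i) x)"
    by (rule pop_altdef) (rule degree_pCons_le)
  also have "\<dots> = a *\<^sub>R x + (\<Sum>i\<le>degree p. coeff p i *\<^sub>R (T ^^ Suc i) x)"
    by (simp add: sum.atMost_Suc_shift del: sum.atMost_Suc)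
  finally show ?thesis by (simp add: pop_def sum scale)
qed

lemma pop_mult:
  assumes "linear T"
  shows "pop T (p * q) x = pop T p (pop T q x)"
  by (induction p) (auto simp: mult_pCons_left pop_add pop_smult pop_pCons[OF assms])

lemma pop_commute:
  assumes "linear T" "linear S" "\<And>x. S (T x) = T (S x)"
  shows "S (pop T p x) = pop T p (S x)"
proof -
  interpret S: linear S by fact
  show ?thesis by (induction p) (auto simp: pop_pCons[OF assms(1)] assms(3) S.add S.scale S.zero)
qed

text \<open>The calculus is developed for the real structure. Complex linearity is recovered
  afterwards from \<open>fc_commute\<close>, since multiplication by a complex scalar is a real
  bounded operator that commutes with \<open>T\<close>.\<close>

locale positive_contraction =
  fixes T :: "'a::{real_inner,banach} \<Rightarrow> 'a"
  assumes bounded_linear: "bounded_linear T"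
    and selfadjoint: "inner (T x) y = inner x (T y)"
    and nonneg: "0 \<le> inner (T x) x"
    and le_one: "inner (T x) x \<le> inner x x"
begin

sublocale bounded_linear T by (rule bounded_linear)

lemma linear_T: "linear T" by (rule linear_axioms)

lemma bounded_linear_pop: "bounded_linear (pop T p)"
proof (induction p)
  case 0
  have "pop T 0 = (\<lambda>_. 0)" by auto
  then show ?case by simp
next
  case (pCons a p)
  have "pop T (pCons a p) = (\<lambda>x. a *\<^sub>R x + T (pop T p x))"
    using pop_pCons[OF linear_T] by auto
  then show ?case
    using pCons bounded_linear by (auto intro!: bounded_linear_add bounded_linear_scaleR_right
        bounded_linear_compose[OF bounded_linear])
qed

lemma pop_selfadjoint: "inner (pop T p x) y = inner x (pop T p y)"
proof (induction p arbitrary: x y)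
  case (pCons a p)
  then show ?case
    by (simp add: pop_pCons[OF linear_T] inner_add selfadjoint pop_commute[OF linear_T linear_T])
qed simp

lemma pop_X: "pop T [:0, 1:] x = T x" and pop_1_minus_X: "pop T [:1, -1:] x = x - T x"
  by (simp_all add: pop_pCons[OF linear_T] zero linear_neg[OF linear_T])

text \<open>Even powers can be shared between the two sides of the inner product, so only the
  exponents modulo 2 matter; 1, \<open>T\<close>, \<open>1 - T\<close> and \<open>T (1 - T)\<close>
  remain.\<close>

lemma inner_pop_bernstein_nonneg: "0 \<le> inner (pop T ([:0, 1:] ^ k * [:1, -1:] ^ m) x) x"
proof -
  let ?X = "[:0, 1:] :: real poly" and ?Y = "[:1, -1:] :: real poly"
  \<comment> \<open>\<open>T - T\<^sup>2 = (1 - T) T (1 - T) + T (1 - T) T\<close> writes the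
    product as a sum of two positive operators.\<close>
  have mixed: "0 \<le> inner (T y - T (T y)) y" for y
  proof -
    let ?u = "y - T y" and ?v = "T y"
    have "0 \<le> inner (T ?u) ?u + (inner ?v ?v - inner (T ?v) ?v)"
      using nonneg[of ?u] le_one[of ?v] by simp
    also have "\<dots> = inner (T y - T (T y)) y"
      using selfadjoint[of "T y" y] by (simp add: inner_diff diff inner_commute)
    finally show ?thesis .
  qed
  define r where "r = ?X ^ (k div 2) * ?Y ^ (m div 2)"
  define s where "s = ?X ^ (k mod 2) * ?Y ^ (m mod 2)"
  have split: "q ^ j = q ^ (j div 2) * q ^ (j div 2) * q ^ (j mod 2)" for q :: "real poly" and j
  proof -
    have "q ^ j = q ^ (j div 2 + j div 2 + j mod 2)" by (rule arg_cong[where f = "(^) q"]) presburger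
    then show ?thesis by (simp only: power_add)
  qed
  have "?X ^ k * ?Y ^ m = r * (s * r)"
    unfolding r_def s_def by (subst split[of ?X k], subst split[of ?Y m]) (simp only: mult_ac)
  then have "inner (pop T (?X ^ k * ?Y ^ m) x) x = inner (pop T s (pop T r x)) (pop T r x)"
    by (simp only: pop_mult[OF linear_T] pop_selfadjoint)
  moreover have "0 \<le> inner (pop T s y) y" for y
  proof -
    have "k mod 2 = 0 \<or> k mod 2 = 1" "m mod 2 = 0 \<or> m mod 2 = 1" by auto
    then show ?thesis
      using nonneg[of y] le_one[of y] mixed[of y]
      by (auto simp: s_def pop_mult[OF linear_T] pop_X pop_1_minus_X inner_diff diff inner_commute)
  qed
  ultimately show ?thesis by simp
qed

text \<open>For the unit vector \<open>y\<close> along \<open>x\<close>, the functional taking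
  \<open>p\<close> to \<open>inner (pop T p y) y\<close> satisfies the hypotheses of the moment
  problem; the factor \<open>(norm x)\<^sup>2\<close> is restored by a constant density.\<close>

lemma moment_measure_exists:
  "\<exists>\<nu>. unit_measure \<nu> \<and> (\<forall>p. (\<integral>t. poly p t \<partial>\<nu>) = inner (pop T p x) x)"
proof -
  have "\<exists>\<nu>. real_distribution \<nu> \<and> (AE t in \<nu>. t \<in> {0..1})
      \<and> (\<forall>p. (norm x)\<^sup>2 * (\<integral>t. poly p t \<partial>\<nu>) = inner (pop T p x) x)"
  proof (cases "x = 0")
    case True
    \<comment> \<open>For \<open>x = 0\<close> the measure will be multiplied by 0, so any law on
      [0,1] will do.\<close>
    have "real_distribution (return borel 0)"
      by (intro real_distribution.intro real_distribution_axioms.intro prob_space_return) auto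
    moreover have "pop T p 0 = 0" for p using bounded_linear_pop linear_0 bounded_linear.linear by blast
    ultimately show ?thesis using True by (intro exI[of _ "return borel 0"]) (auto simp: AE_return)
  next
    case False
    define y where "y = x /\<^sub>R norm x"
    interpret P: bounded_linear "pop T p" for p by (rule bounded_linear_pop)
    have x: "x = norm x *\<^sub>R y" using False by (simp add: y_def)
    have "norm y = 1" using False by (simp add: y_def)
    then have "\<exists>\<nu>. real_distribution \<nu> \<and> (AE t in \<nu>. t \<in> {0..1}) \<and> (\<forall>p. (\<integral>t. poly p t \<partial>\<nu>) = inner (pop T p y) y)"
      by (intro hausdorff_moment_problem)
        (auto simp: pop_add inner_add pop_smult norm_eq_1 intro: inner_pop_bernstein_nonneg)
    moreover have "inner (pop T p x) x = (norm x)\<^sup>2 * inner (pop T p y) y" for p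
      by (subst (1 2) x) (simp add: P.scaleR power2_eq_square)
    ultimately show ?thesis by auto
  qed
  then obtain \<nu> where \<nu>: "real_distribution \<nu>" "AE t in \<nu>. t \<in> {0..1}"
    "\<And>p. (norm x)\<^sup>2 * (\<integral>t. poly p t \<partial>\<nu>) = inner (pop T p x) x" by blast
  interpret real_distribution \<nu> by fact
  let ?d = "density \<nu> (\<lambda>_. ennreal ((norm x)\<^sup>2))"
  have "finite_measure ?d"
    by (rule finite_measureI) (simp add: emeasure_density emeasure_eq_measure ennreal_mult_eq_top_iff)
  then have "unit_measure ?d" using \<nu>(2) by (auto simp: unit_measure_def AE_density)
  moreover have "(\<integral>t. poly p t \<partial>?d) = inner (pop T p x) x" for p
    by (subst integral_density) (auto simp: \<nu>(3))
  ultimately show ?thesis by blast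
qed

text \<open>The scalar spectral measure \<open>B \<mapsto> inner (E B x) x\<close> of
  \<open>T\<close> at \<open>x\<close>, obtained from its moments before any projection
  \<open>E B\<close> is available.\<close>

definition spm :: "'a \<Rightarrow> real measure" where
  "spm x = (SOME \<nu>. unit_measure \<nu> \<and> (\<forall>p. (\<integral>t. poly p t \<partial>\<nu>) = inner (pop T p x) x))"

lemma unit_measure_spm: "unit_measure (spm x)"
  and integral_poly_spm: "(\<integral>t. poly p t \<partial>spm x) = inner (pop T p x) x"
  using someI_ex[OF moment_measure_exists[of x]] unfolding spm_def by blast+

lemma finite_measure_spm: "finite_measure (spm x)"
  and sets_spm [measurable_cong, simp]: "sets (spm x) = sets borel"
  and space_spm [simp]: "space (spm x) = UNIV"
  and AE_spm_unit: "AE t in spm x. t \<in> {0..1}"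
  using unit_measure_spm[of x] sets_eq_imp_space_eq[of "spm x" borel] by (auto simp: unit_measure_def)

lemma spm_eqI:
  assumes "unit_measure \<nu>" "\<And>p. (\<integral>t. poly p t \<partial>\<nu>) = inner (pop T p x) x"
  shows "spm x = \<nu>"
  by (rule unit_measure_unique) (auto simp: unit_measure_spm integral_poly_spm assms)

lemma measure_spm_UNIV: "measure (spm x) UNIV = inner x x"
  using integral_poly_spm[where p = 1 and x = x] by simp

text \<open>The map from \<open>p\<close> to \<open>pop T p x\<close> is thus isometric for the mean
  square norm of \<open>spm x\<close>, and convergence of operators becomes a question about
  integrals.\<close>

lemma norm_pop_sq: "(norm (pop T p x))\<^sup>2 = (\<integral>t. (poly p t)\<^sup>2 \<partial>spm x)"
proof -
  have "(norm (pop T p x))\<^sup>2 = inner (pop T (p * p) x) x"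
    by (simp add: power2_norm_eq_inner pop_mult[OF linear_T] pop_selfadjoint)
  also have "\<dots> = (\<integral>t. poly (p * p) t \<partial>spm x)" by (simp only: integral_poly_spm)
  finally show ?thesis by (simp add: power2_eq_square)
qed

lemma bfun_integrable: "bfun f \<Longrightarrow> integrable (spm x) f"
  using bfun_bounded[of f] bfun_measurable[of f] integrable_unit_measure[OF unit_measure_spm] by blast

text \<open>Two sequences are compared so that one estimate yields both the Cauchy property and, in
  \<open>fc_limit\<close>, independence of the chosen polynomials.\<close>

lemma norm_pop_diff_sq_le:
  assumes "poly_lim p f" "poly_lim q f"
  shows "(norm (pop T (p m) x - pop T (q n) x))\<^sup>2
    \<le> 2 * (\<integral>t. (poly (p m) t - f t)\<^sup>2 \<partial>spm x) + 2 * (\<integral>t. (poly (q n) t - f t)\<^sup>2 \<partial>spm x)"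
proof -
  have f: "bfun f" using assms bfun_def by blast
  have int: "integrable (spm x) (\<lambda>t. (poly r t - f t)\<^sup>2)" for r
    by (rule bfun_integrable[OF bfun_power2[OF bfun_diff[OF bfun_poly f]]])
  have "(norm (pop T (p m) x - pop T (q n) x))\<^sup>2 = (\<integral>t. (poly (p m - q n) t)\<^sup>2 \<partial>spm x)"
    by (simp add: norm_pop_sq flip: pop_diff)
  also have "\<dots> \<le> (\<integral>t. 2 * (poly (p m) t - f t)\<^sup>2 + 2 * (poly (q n) t - f t)\<^sup>2 \<partial>spm x)"
  proof (rule integral_mono)
    show "integrable (spm x) (\<lambda>t. (poly (p m - q n) t)\<^sup>2)"
      by (rule bfun_integrable[OF bfun_power2[OF bfun_poly]])
    show "(poly (p m - q n) t)\<^sup>2 \<le> 2 * (poly (p m) t - f t)\<^sup>2 + 2 * (poly (q n) t - f t)\<^sup>2" for t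
    proof -
      have "0 \<le> ((poly (p m) t - f t) + (poly (q n) t - f t))\<^sup>2" by simp
      then show ?thesis by (simp add: power2_eq_square algebra_simps)
    qed
  qed (use int in auto)
  also have "\<dots> = 2 * (\<integral>t. (poly (p m) t - f t)\<^sup>2 \<partial>spm x) + 2 * (\<integral>t. (poly (q n) t - f t)\<^sup>2 \<partial>spm x)"
    using int by simp
  finally show ?thesis .
qed

lemma convergent_pop:
  assumes "poly_lim p f"
  shows "convergent (\<lambda>n. pop T (p n) x)"
proof -
  let ?e = "\<lambda>n. \<integral>t. (poly (p n) t - f t)\<^sup>2 \<partial>spm x"
  have e: "?e \<longlonglongrightarrow> 0" by (rule poly_lim_integral(2)[OF unit_measure_spm assms])
  have "Cauchy (\<lambda>n. pop T (p n) x)"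
  proof (rule CauchyI)
    fix \<epsilon> :: real assume "\<epsilon> > 0"
    then have "\<forall>\<^sub>F n in sequentially. ?e n < \<epsilon>\<^sup>2 / 4" using e by (intro order_tendstoD) auto
    then obtain N where N: "\<And>n. n \<ge> N \<Longrightarrow> ?e n < \<epsilon>\<^sup>2 / 4" by (auto simp: eventually_sequentially)
    have "norm (pop T (p m) x - pop T (p n) x) < \<epsilon>" if "m \<ge> N" "n \<ge> N" for m n
    proof -
      have "(norm (pop T (p m) x - pop T (p n) x))\<^sup>2 < \<epsilon>\<^sup>2"
        using norm_pop_diff_sq_le[OF assms assms, of m x n] N[OF that(1)] N[OF that(2)] by linarith
      then show ?thesis by (rule power2_less_imp_less) (use \<open>\<epsilon> > 0\<close> in auto)
    qed
    then show "\<exists>M. \<forall>m\<ge>M. \<forall>n\<ge>M. norm (pop T (p m) x - pop T (p n) x) < \<epsilon>" by blast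
  qed
  then show ?thesis by (rule Cauchy_convergent)
qed

definition fc :: "(real \<Rightarrow> real) \<Rightarrow> 'a \<Rightarrow> 'a" where
  "fc f x = lim (\<lambda>n. pop T ((SOME p. poly_lim p f) n) x)"

text \<open>\<open>fc\<close> fixes an arbitrary approximating sequence; any other one has the same
  limit, since both approach \<open>f\<close> in mean square.\<close>

lemma fc_limit:
  assumes p: "poly_lim p f"
  shows "(\<lambda>n. pop T (p n) x) \<longlonglongrightarrow> fc f x"
proof -
  define q where "q = (SOME p. poly_lim p f)"
  have q: "poly_lim q f" unfolding q_def by (rule someI[of "\<lambda>p. poly_lim p f", OF p])
  have lq: "(\<lambda>n. pop T (q n) x) \<longlonglongrightarrow> fc f x"
    unfolding fc_def q_def[symmetric] by (rule convergent_LIMSEQ_iff[THEN iffD1, OF convergent_pop[OF q]])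
  let ?b = "\<lambda>n. 2 * (\<integral>t. (poly (p n) t - f t)\<^sup>2 \<partial>spm x) + 2 * (\<integral>t. (poly (q n) t - f t)\<^sup>2 \<partial>spm x)"
  have "?b \<longlonglongrightarrow> 2 * 0 + 2 * 0"
    by (intro tendsto_intros poly_lim_integral(2)[OF unit_measure_spm] p q)
  then have "(\<lambda>n. (norm (pop T (p n) x - pop T (q n) x))\<^sup>2) \<longlonglongrightarrow> 0"
    using norm_pop_diff_sq_le[OF p q]
    by (intro Lim_null_comparison[of "\<lambda>n. (norm (pop T (p n) x - pop T (q n) x))\<^sup>2" ?b]) auto
  from tendsto_real_sqrt[OF this] have "(\<lambda>n. pop T (p n) x - pop T (q n) x) \<longlonglongrightarrow> 0"
    by (simp add: tendsto_norm_zero_iff)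
  from tendsto_add[OF this lq] show ?thesis by simp
qed

lemma fc_cong:
  assumes "bfun f" "g \<in> borel_measurable borel" "\<And>t. t \<in> {0..1} \<Longrightarrow> f t = g t"
  shows "fc f x = fc g x"
  using assms fc_limit poly_lim_cong LIMSEQ_unique unfolding bfun_def by metis

lemma fc_poly: "fc (poly p) x = pop T p x"
  using LIMSEQ_unique[OF fc_limit[OF poly_lim_const] tendsto_const] .

lemma fc_id: "fc (\<lambda>t. t) x = T x"
proof -
  have "poly [:0, 1:] = (\<lambda>t. t :: real)" by auto
  then show ?thesis using fc_poly[of "[:0, 1:]" x] by (simp add: pop_X)
qed

lemma fc_const: "fc (\<lambda>_. c) x = c *\<^sub>R x"
proof -
  have "poly [:c:] = (\<lambda>_. c)" by auto
  then show ?thesis using fc_poly[of "[:c:]" x] by simp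
qed

lemma fc_add:
  assumes "bfun f" "bfun g" shows "fc (\<lambda>t. f t + g t) x = fc f x + fc g x"
proof -
  obtain p q where p: "poly_lim p f" and q: "poly_lim q g" using assms bfun_def by blast
  show ?thesis
    using fc_limit[OF poly_lim_add[OF p q], of x] tendsto_add[OF fc_limit[OF p] fc_limit[OF q], of x x]
    unfolding pop_add by (rule LIMSEQ_unique)
qed

lemma fc_inner:
  assumes "bfun f" shows "inner (fc f x) x = (\<integral>t. f t \<partial>spm x)"
proof -
  obtain p where p: "poly_lim p f" using assms bfun_def by blast
  show ?thesis
    using tendsto_inner[OF fc_limit[OF p, of x] tendsto_const[of x]]
      poly_lim_integral(1)[OF unit_measure_spm p, of x]
    unfolding integral_poly_spm by (rule LIMSEQ_unique)
qed

lemma fc_selfadjoint: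
  assumes "bfun f" shows "inner (fc f x) y = inner x (fc f y)"
proof -
  obtain p where p: "poly_lim p f" using assms bfun_def by blast
  show ?thesis
    using tendsto_inner[OF fc_limit[OF p, of x] tendsto_const[of y]]
      tendsto_inner[OF tendsto_const[of x] fc_limit[OF p, of y]]
    unfolding pop_selfadjoint by (rule LIMSEQ_unique)
qed

lemma fc_commute:
  assumes "bfun f" "bounded_linear S" "\<And>x. S (T x) = T (S x)"
  shows "S (fc f x) = fc f (S x)"
proof -
  interpret S: bounded_linear S by fact
  obtain p where p: "poly_lim p f" using assms bfun_def by blast
  show ?thesis
    using S.tendsto[OF fc_limit[OF p, of x]] fc_limit[OF p, of "S x"]
    unfolding pop_commute[OF linear_T S.linear_axioms assms(3)] by (rule LIMSEQ_unique)
qed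

lemma norm_pop_le:
  assumes C: "\<And>t. t \<in> {0..1} \<Longrightarrow> \<bar>poly p t\<bar> \<le> C"
  shows "norm (pop T p x) \<le> C * norm x"
proof -
  have C0: "0 \<le> C" using C[of 0] by auto
  have "(norm (pop T p x))\<^sup>2 \<le> (\<integral>t. C\<^sup>2 \<partial>spm x)"
    unfolding norm_pop_sq
  proof (rule integral_mono_AE)
    show "integrable (spm x) (\<lambda>t. (poly p t)\<^sup>2)"
      by (rule bfun_integrable[OF bfun_power2[OF bfun_poly]])
    show "integrable (spm x) (\<lambda>t. C\<^sup>2)"
      using finite_measure_spm by (simp add: finite_measure.integrable_const)
    show "AE t in spm x. (poly p t)\<^sup>2 \<le> C\<^sup>2"
      using AE_spm_unit by eventually_elim (use C C0 in \<open>auto simp: abs_le_square_iff[symmetric]\<close>)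
  qed
  also have "\<dots> = (C * norm x)\<^sup>2"
    by (simp add: measure_spm_UNIV power_mult_distrib power2_norm_eq_inner)
  finally show ?thesis by (rule power2_le_imp_le) (simp add: C0)
qed

lemma bounded_linear_fc:
  assumes "bfun f" shows "bounded_linear (fc f)"
proof -
  obtain p where p: "poly_lim p f" using assms bfun_def by blast
  obtain C where C: "\<And>n t. t \<in> {0..1} \<Longrightarrow> \<bar>poly (p n) t\<bar> \<le> C"
    using poly_lim_bounded[OF p] by blast
  interpret P: bounded_linear "pop T q" for q by (rule bounded_linear_pop)
  show ?thesis
  proof (rule bounded_linear_intro[where K = C])
    show "fc f (x + y) = fc f x + fc f y" for x y
      using fc_limit[OF p, of "x + y"] tendsto_add[OF fc_limit[OF p, of x] fc_limit[OF p, of y]]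
      unfolding P.add by (rule LIMSEQ_unique)
    show "fc f (r *\<^sub>R x) = r *\<^sub>R fc f x" for r x
      using fc_limit[OF p, of "r *\<^sub>R x"] tendsto_scaleR[OF tendsto_const[of r] fc_limit[OF p, of x]]
      unfolding P.scaleR by (rule LIMSEQ_unique)
    show "norm (fc f x) \<le> norm x * C" for x
      using tendsto_norm[OF fc_limit[OF p, of x]]
      by (rule LIMSEQ_le_const2) (use norm_pop_le[OF C] in \<open>auto simp: mult.commute\<close>)
  qed
qed

lemma fc_mult:
  assumes "bfun f" "bfun g" shows "fc (\<lambda>t. f t * g t) x = fc f (fc g x)"
proof -
  obtain p q where p: "poly_lim p f" and q: "poly_lim q g" using assms bfun_def by blast
  obtain C where C: "\<And>n t. t \<in> {0..1} \<Longrightarrow> \<bar>poly (p n) t\<bar> \<le> C"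
    using poly_lim_bounded[OF p] by blast
  \<comment> \<open>\<open>pop T (p n)\<close> varies with \<open>n\<close>, so strong convergence
    alone does not suffice: the uniform bound on the polynomials bounds all these operators at
    once.\<close>
  have "(\<lambda>n. pop T (p n) (pop T (q n) x - fc g x)) \<longlonglongrightarrow> 0"
  proof (rule Lim_null_comparison)
    have "(\<lambda>n. C * norm (pop T (q n) x - fc g x)) \<longlonglongrightarrow> C * norm (fc g x - fc g x)"
      by (intro tendsto_intros fc_limit[OF q])
    then show "(\<lambda>n. C * norm (pop T (q n) x - fc g x)) \<longlonglongrightarrow> 0" by simp
  qed (use norm_pop_le[OF C] in auto)
  from tendsto_add[OF this fc_limit[OF p, of "fc g x"]]
  have "(\<lambda>n. pop T (p n * q n) x) \<longlonglongrightarrow> fc f (fc g x)"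
    by (simp add: pop_mult[OF linear_T] bounded_linear_pop linear_diff bounded_linear.linear)
  then show ?thesis using fc_limit[OF poly_lim_mult[OF p q], of x] LIMSEQ_unique by blast
qed

lemma fc_diff:
  assumes "bfun f" "bfun g" shows "fc (\<lambda>t. f t - g t) x = fc f x - fc g x"
proof -
  have "fc (\<lambda>t. f t + -1 * g t) x = fc f x + fc (\<lambda>t. -1 * g t) x"
    by (rule fc_add[OF assms(1) bfun_mult[OF bfun_const assms(2)]])
  also have "fc (\<lambda>t. -1 * g t) x = -1 *\<^sub>R fc g x"
    by (simp only: fc_mult[OF bfun_const assms(2)] fc_const)
  finally show ?thesis by simp
qed

lemma norm_fc_sq:
  assumes "bfun f" shows "(norm (fc f x))\<^sup>2 = (\<integral>t. (f t)\<^sup>2 \<partial>spm x)"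
proof -
  have "(norm (fc f x))\<^sup>2 = inner (fc (\<lambda>t. f t * f t) x) x"
    by (simp add: fc_mult[OF assms assms] power2_norm_eq_inner fc_selfadjoint[OF assms])
  then show ?thesis using fc_inner[OF bfun_mult[OF assms assms]] by (simp add: power2_eq_square)
qed

end

section \<open>Spectral projections, adjoints and von Neumann algebras\<close>

lemma norm_sum_sq_orthogonal:
  fixes v :: "nat \<Rightarrow> 'a::real_inner"
  assumes "\<And>i j. i \<noteq> j \<Longrightarrow> inner (v i) (v j) = 0" "finite I"
  shows "(norm (sum v I))\<^sup>2 = (\<Sum>i\<in>I. (norm (v i))\<^sup>2)"
  using assms(2)
proof (induction I rule: finite_induct)
  case (insert i I)
  have "inner (v i) (sum v I) = 0"
    unfolding inner_sum_right using insert.hyps by (intro sum.neutral ballI assms(1)) auto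
  then show ?case using insert by (simp add: norm_add_sq_orthogonal)
qed simp

lemma summable_orthogonal:
  fixes v :: "nat \<Rightarrow> 'a::{real_inner,banach}"
  assumes orth: "\<And>i j. i \<noteq> j \<Longrightarrow> inner (v i) (v j) = 0" and s: "summable (\<lambda>i. (norm (v i))\<^sup>2)"
  shows "summable v"
  unfolding summable_Cauchy
proof (intro allI impI)
  fix e :: real assume e: "0 < e"
  then have "0 < e\<^sup>2" by simp
  then obtain N where N: "\<And>m n. m \<ge> N \<Longrightarrow> norm (\<Sum>i=m..<n. (norm (v i))\<^sup>2) < e\<^sup>2"
    using s unfolding summable_Cauchy by blast
  have "norm (sum v {m..<n}) < e" if "m \<ge> N" for m n
  proof -
    have "(norm (sum v {m..<n}))\<^sup>2 < e\<^sup>2"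
      using N[OF that, of n] norm_sum_sq_orthogonal[OF orth, where I = "{m..<n}"] by (simp add: sum_nonneg)
    then show ?thesis by (rule power2_less_imp_less) (use e in auto)
  qed
  then show "\<exists>N. \<forall>m\<ge>N. \<forall>n. norm (sum v {m..<n}) < e" by blast
qed

section \<open>Spectral projections of a positive contraction\<close>

context positive_contraction
begin

text \<open>The quadratic form determines \<open>P\<close>, see \<open>is_sp_unique\<close>. The
  clause on \<open>S\<close> says that \<open>P\<close> commutes with everything that commutes with
  \<open>T\<close>; it is carried along because it later makes the projections complex
  linear.\<close>

definition is_sp :: "real set \<Rightarrow> ('a \<Rightarrow> 'a) \<Rightarrow> bool" where
  "is_sp B P \<longleftrightarrow> bounded_linear P \<and> (\<forall>x y. inner (P x) y = inner x (P y)) \<and>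
     (\<forall>x. P (P x) = P x) \<and> (\<forall>x. inner (P x) x = measure (spm x) B) \<and>
     (\<forall>S. bounded_linear S \<and> (\<forall>x. S (T x) = T (S x)) \<longrightarrow> (\<forall>x. S (P x) = P (S x)))"

lemma is_sp_norm_sq: "is_sp B P \<Longrightarrow> (norm (P x))\<^sup>2 = measure (spm x) B"
  unfolding is_sp_def power2_norm_eq_inner by metis

lemma is_sp_greaterThan: "is_sp {l<..} (fc (indicator {l<..}))"
proof -
  have b: "bfun (indicator {l<..})" by (rule bfun_greaterThan)
  have "fc (indicator {l<..}) (fc (indicator {l<..}) x) = fc (indicator {l<..}) x" for x
    by (simp flip: fc_mult[OF b b] indicator_inter_arith)
  moreover have "inner (fc (indicator {l<..}) x) x = measure (spm x) {l<..}" for x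
    by (simp add: fc_inner[OF b])
  ultimately show ?thesis
    unfolding is_sp_def
    using bounded_linear_fc[OF b] fc_selfadjoint[OF b] fc_commute[OF b] by blast
qed

lemma is_sp_compl:
  assumes "B \<in> sets borel" "is_sp B P"
  shows "is_sp (UNIV - B) (\<lambda>x. x - P x)"
proof -
  interpret P: bounded_linear P using assms by (simp add: is_sp_def)
  have "S (x - P x) = S x - P (S x)" if "bounded_linear S" "\<forall>x. S (T x) = T (S x)" for S x
    using assms that by (simp add: is_sp_def linear_diff bounded_linear.linear)
  moreover have "measure (spm x) (UNIV - B) = measure (spm x) UNIV - measure (spm x) B" for x
    using finite_measure.finite_measure_compl[OF finite_measure_spm, of B x] assms(1) by simp
  ultimately show ?thesis
    using assms(2) unfolding is_sp_def
    by (auto simp: P.diff inner_diff measure_spm_UNIV intro!: bounded_linear_sub P.bounded_linear_axioms)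
qed

text \<open>For \<open>y = Q x\<close> the measure \<open>spm y\<close> has its whole mass
  \<open>(norm y)\<^sup>2\<close> on \<open>B\<close>, so nothing is left for the disjoint set
  \<open>A\<close>.\<close>

lemma is_sp_orthogonal:
  assumes "is_sp A P" "is_sp B Q" "A \<inter> B = {}" "A \<in> sets borel" "B \<in> sets borel"
  shows "P (Q x) = 0"
proof -
  let ?y = "Q x"
  interpret finite_measure "spm ?y" by (rule finite_measure_spm)
  have "measure (spm ?y) A + measure (spm ?y) B = measure (spm ?y) (A \<union> B)"
    using assms by (simp add: finite_measure_Union)
  also have "\<dots> \<le> measure (spm ?y) UNIV" using assms by (intro finite_measure_mono) auto
  also have "\<dots> = (norm ?y)\<^sup>2" by (simp add: measure_spm_UNIV power2_norm_eq_inner)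
  also have "\<dots> = measure (spm ?y) B"
    using is_sp_norm_sq[OF assms(2), of ?y] assms(2) by (simp add: is_sp_def)
  finally have "(norm (P ?y))\<^sup>2 \<le> 0" using is_sp_norm_sq[OF assms(1), of ?y] by simp
  then show ?thesis by simp
qed

text \<open>The summands are pairwise orthogonal and their squared norms are the masses of the sets
  \<open>A i\<close>, so the series converges by countable additivity of \<open>spm x\<close>; the
  remaining clauses pass to the sum.\<close>

lemma is_sp_Union:
  assumes P: "\<And>i. is_sp (A i) (P i)" and A: "disjoint_family A" "range A \<subseteq> sets borel"
  shows "summable (\<lambda>i. P i x)" "is_sp (\<Union>i. A i) (\<lambda>x. \<Sum>i. P i x)"
proof -
  have bl: "\<And>i. bounded_linear (P i)" and sa: "\<And>i x y. inner (P i x) y = inner x (P i y)"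
    and idem: "\<And>i x. P i (P i x) = P i x" and q: "\<And>i x. inner (P i x) x = measure (spm x) (A i)"
    and comm: "\<And>i S x. bounded_linear S \<Longrightarrow> (\<And>x. S (T x) = T (S x)) \<Longrightarrow> S (P i x) = P i (S x)"
    using P unfolding is_sp_def by blast+
  have orth: "P i (P j x) = 0" if "i \<noteq> j" for i j x
    using is_sp_orthogonal[OF P P] A that by (auto simp: disjoint_family_on_def)
  have m: "(\<lambda>i. measure (spm x) (A i)) sums measure (spm x) (\<Union>i. A i)" for x
    using finite_measure.finite_measure_UNION[OF finite_measure_spm, of A x] A by simp
  have s: "summable (\<lambda>i. P i x)" for x
  proof (rule summable_orthogonal)
    show "inner (P i x) (P j x) = 0" if "i \<noteq> j" for i j
      using orth[OF that, of x] sa[of i x "P j x"] by simp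
    show "summable (\<lambda>i. (norm (P i x))\<^sup>2)"
      using m[of x] is_sp_norm_sq[OF P] by (simp add: sums_iff)
  qed
  then show "summable (\<lambda>i. P i x)" .
  let ?P = "\<lambda>x. \<Sum>i. P i x"
  have add: "?P (x + y) = ?P x + ?P y" for x y
    using bl by (simp add: suminf_add[OF s s] linear_add bounded_linear.linear)
  have scale: "?P (r *\<^sub>R x) = r *\<^sub>R ?P x" for r x
    using bl by (simp add: suminf_scaleR_right[OF s, symmetric] linear_scale bounded_linear.linear)
  have sa': "inner (?P x) y = inner x (?P y)" for x y
  proof -
    have "inner (?P x) y = (\<Sum>i. inner (P i x) y)"
      by (rule bounded_linear.suminf[OF bounded_linear_inner_left s, symmetric, THEN sym])
    also have "\<dots> = inner x (?P y)" unfolding sa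
      by (rule bounded_linear.suminf[OF bounded_linear_inner_right s, symmetric])
    finally show ?thesis .
  qed
  have q': "inner (?P x) x = measure (spm x) (\<Union>i. A i)" for x
  proof -
    have "inner (?P x) x = (\<Sum>i. inner (P i x) x)"
      by (rule bounded_linear.suminf[OF bounded_linear_inner_left s, symmetric, THEN sym])
    then show ?thesis using m[of x] by (simp add: q sums_iff)
  qed
  have idem1: "P j (?P x) = P j x" for j x
  proof -
    have "P j (?P x) = (\<Sum>i. P j (P i x))"
      by (rule bounded_linear.suminf[OF bl s])
    also have "(\<lambda>i. P j (P i x)) = (\<lambda>i. if i = j then P j x else 0)"
      using orth idem by (auto simp: fun_eq_iff)
    also have "(\<Sum>i. if i = j then P j x else 0) = P j x"
      using sums_single[of j "\<lambda>_. P j x"] by (simp add: sums_iff)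
    finally show ?thesis .
  qed
  then have idem': "?P (?P x) = ?P x" for x by simp
  have bound: "norm (?P x) \<le> norm x * 1" for x
  proof -
    have "norm (?P x) * norm (?P x) = inner (?P x) x"
      using sa'[of "?P x" x] idem'[of x] by (simp flip: power2_eq_square add: power2_norm_eq_inner)
    also have "\<dots> \<le> norm (?P x) * norm x" by (rule norm_cauchy_schwarz)
    finally show ?thesis by (cases "norm (?P x) = 0") auto
  qed
  have bl': "bounded_linear ?P" by (rule bounded_linear_intro[where K = 1]) (fact add scale bound)+
  have "S (?P x) = ?P (S x)" if S: "bounded_linear S" "\<And>x. S (T x) = T (S x)" for S x
    using bounded_linear.suminf[OF S(1) s, of x] comm[OF S] by simp
  then show "is_sp (\<Union>i. A i) ?P"
    unfolding is_sp_def using bl' sa' idem' q' by blast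
qed

text \<open>Dynkin's lemma: open upper half-lines are stable under intersection, and complements and
  disjoint unions are matched by \<open>1 - P\<close> and by orthogonal sums.\<close>

lemma is_sp_exists:
  assumes "B \<in> sets borel" shows "\<exists>P. is_sp B P"
proof -
  have eq: "sets borel = sigma_sets UNIV (range greaterThan :: real set set)"
    by (subst borel_Ioi) (simp add: sets_measure_of)
  have "Int_stable (range greaterThan :: real set set)"
    unfolding Int_stable_def
  proof (intro ballI)
    fix a b :: "real set" assume "a \<in> range greaterThan" "b \<in> range greaterThan"
    then obtain l m where "a = {l<..}" "b = {m<..}" by blast
    then have "a \<inter> b = {max l m<..}" by auto
    then show "a \<inter> b \<in> range greaterThan" by blast
  qed
  moreover have "range greaterThan \<subseteq> Pow (UNIV :: real set)" by simp
  moreover have "B \<in> sigma_sets UNIV (range greaterThan)" using assms eq by simp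
  ultimately show ?thesis
  proof (induction rule: sigma_sets_induct_disjoint)
    case (basic A)
    then show ?case using is_sp_greaterThan by blast
  next
    case empty
    have "is_sp {} (\<lambda>_. 0)"
      by (auto simp: is_sp_def linear_0 bounded_linear.linear)
    then show ?case by blast
  next
    case (compl A)
    then show ?case using is_sp_compl eq by blast
  next
    case (union A)
    then obtain P where "\<And>i. is_sp (A i) (P i)" by metis
    then show ?case using is_sp_Union(2) union(1,2) eq by blast
  qed
qed

lemma is_sp_unique: "is_sp B P \<Longrightarrow> is_sp B Q \<Longrightarrow> P = Q"
  by (rule selfadjoint_eqI) (auto simp: is_sp_def bounded_linear.linear)

definition sp :: "real set \<Rightarrow> 'a \<Rightarrow> 'a" where
  "sp B = (SOME P. is_sp B P)"

lemma is_sp_sp: "B \<in> sets borel \<Longrightarrow> is_sp B (sp B)"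
  unfolding sp_def by (rule someI_ex[OF is_sp_exists])

lemma sp_eqI: "is_sp B P \<Longrightarrow> B \<in> sets borel \<Longrightarrow> sp B = P"
  using is_sp_sp is_sp_unique by blast

lemma sp_sums:
  assumes "disjoint_family A" "range A \<subseteq> sets borel"
  shows "(\<lambda>i. sp (A i) x) sums sp (\<Union>i. A i) x"
proof -
  have P: "\<And>i. is_sp (A i) (sp (A i))" using assms is_sp_sp by blast
  have "sp (\<Union>i. A i) = (\<lambda>x. \<Sum>i. sp (A i) x)"
    by (rule sp_eqI[OF is_sp_Union(2)[OF P assms]]) (use assms in blast)
  then show ?thesis using is_sp_Union(1)[OF P assms, of x] by (simp add: sums_iff)
qed

end

section \<open>Complex scalars, adjoints and projections\<close>

lemma Im_cinner: "Im (cinner x y) = - inner (\<i> *\<^sub>C x) y"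
  using Re_cinner[of "\<i> *\<^sub>C x" y] by (simp add: cinner_scaleC_left)

lemma cinner_add_right: "cinner x (y + z) = cinner x y + cinner x z"
  by (metis cinner_add_left cinner_commute complex_cnj_add)

lemma cinner_scaleC_right: "cinner x (c *\<^sub>C y) = cnj c * cinner x y"
  by (metis cinner_scaleC_left cinner_commute complex_cnj_mult)

lemma scaleC_one [simp]: "1 *\<^sub>C x = (x :: 'a::complex_hilbert_space)"
  using scaleC_of_real[of 1 x] by simp

lemma scaleC_0_left [simp]: "0 *\<^sub>C x = (0 :: 'a::complex_hilbert_space)"
  using scaleC_of_real[of 0 x] by simp

lemma scaleC_scaleR: "c *\<^sub>C (r *\<^sub>R x) = r *\<^sub>R (c *\<^sub>C (x :: 'a::complex_hilbert_space))"
  by (simp add: scaleC_of_real[symmetric] scaleC_scaleC mult.commute)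

lemma cinner_self: "cinner x x = of_real (inner x x)"
proof -
  have "Im (cinner x x) = 0" using cinner_commute[of x x] by (simp add: complex_eq_iff)
  then show ?thesis by (simp add: complex_eq_iff Re_cinner)
qed

lemma inner_scaleC_left: "inner (c *\<^sub>C x) y = inner x (cnj c *\<^sub>C (y :: 'a::complex_hilbert_space))"
  by (simp add: Re_cinner[symmetric] cinner_scaleC_left cinner_scaleC_right)

lemma norm_scaleC: "norm (c *\<^sub>C x) = cmod c * norm (x :: 'a::complex_hilbert_space)"
proof -
  have "(norm (c *\<^sub>C x))\<^sup>2 = inner x ((cnj c * c) *\<^sub>C x)"
    by (simp add: power2_norm_eq_inner inner_scaleC_left scaleC_scaleC)
  also have "cnj c * c = of_real ((cmod c)\<^sup>2)" by (metis complex_norm_square mult.commute)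
  also have "inner x (of_real ((cmod c)\<^sup>2) *\<^sub>C x) = (cmod c * norm x)\<^sup>2"
    by (simp only: scaleC_of_real) (simp add: power_mult_distrib power2_norm_eq_inner)
  finally show ?thesis by (rule power2_eq_imp_eq) auto
qed

lemma bounded_linear_scaleC: "bounded_linear ((*\<^sub>C) c :: 'a::complex_hilbert_space \<Rightarrow> 'a)"
  by (rule bounded_linear_intro[where K = "cmod c"])
    (simp_all add: scaleC_add_right scaleC_scaleR norm_scaleC)

lemma scaleC_minus_left: "(- c) *\<^sub>C x = - (c *\<^sub>C (x :: 'a::complex_hilbert_space))"
  using scaleC_add_left[of "- c" c x] by (simp add: eq_neg_iff_add_eq_0)

lemma scaleC_diff_right: "c *\<^sub>C (x - y) = c *\<^sub>C x - c *\<^sub>C (y :: 'a::complex_hilbert_space)"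
  by (rule linear_diff[OF bounded_linear.linear[OF bounded_linear_scaleC]])

lemma scaleC_0_right [simp]: "c *\<^sub>C 0 = (0 :: 'a::complex_hilbert_space)"
  by (rule linear_0[OF bounded_linear.linear[OF bounded_linear_scaleC]])

lemma cinner_0_left [simp]: "cinner 0 y = 0"
  using cinner_scaleC_left[of 0 0 y] by simp

text \<open>The imaginary part of \<open>cinner x y\<close> is, up to sign, the real inner product
  of \<open>\<i> *\<^sub>C x\<close> with \<open>y\<close>, so complex identities can be tested with
  the real inner product.\<close>

lemma cinner_eqI:
  fixes x y x' y' :: "'a::complex_hilbert_space"
  assumes "\<And>c. inner (c *\<^sub>C x) y = inner (c *\<^sub>C x') y'"
  shows "cinner x y = cinner x' y'"
  using assms[of 1] assms[of \<i>] by (simp add: complex_eq_iff Re_cinner Im_cinner)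

lemma cinner_ext:
  assumes "\<And>z. cinner z x = cinner z y" shows "x = (y :: 'a::complex_hilbert_space)"
proof -
  have "inner z x = inner z y" for z using assms[of z] by (metis Re_cinner)
  then show ?thesis by (rule iffD1[OF vector_eq_ldot, OF allI])
qed

lemma bounded_clinear_linear: "bounded_clinear T \<Longrightarrow> bounded_linear T"
  and bounded_clinear_scaleC: "bounded_clinear T \<Longrightarrow> T (c *\<^sub>C x) = c *\<^sub>C T x"
  by (simp_all add: bounded_clinear_def)

lemma bounded_clinear_simps:
  assumes "bounded_clinear T"
  shows "T (x + y) = T x + T y" "T (x - y) = T x - T y" "T (- x) = - T x" "T 0 = 0"
    "T (r *\<^sub>R x) = r *\<^sub>R T x" "T (c *\<^sub>C x) = c *\<^sub>C T x"
  using assms bounded_linear.linear[OF bounded_clinear_linear[OF assms]]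
  by (auto simp: linear_add linear_diff linear_neg linear_0 linear_scale bounded_clinear_scaleC)

lemma cadj_eqI:
  assumes "\<And>x y. cinner (T x) y = cinner x (S y)" shows "cadj T = S"
  unfolding cadj_def
proof (rule the_equality)
  fix R assume "\<forall>x y. cinner (T x) y = cinner x (R y)"
  then have "cinner x (R y) = cinner x (S y)" for x y using assms by metis
  then show "R = S" using cinner_ext by blast
qed (use assms in blast)

text \<open>This lets the real adjoint obtained from the Riesz theorem serve as
  \<open>cadj\<close>.\<close>

lemma clinear_adjoint:
  fixes T S :: "'a::complex_hilbert_space op"
  assumes "\<And>c x. T (c *\<^sub>C x) = c *\<^sub>C T x" "\<And>x y. inner (T x) y = inner x (S y)"
  shows "cinner (T x) y = cinner x (S y)"
  by (rule cinner_eqI) (simp flip: assms)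

lemma cadj_eqI_inner:
  fixes T S :: "'a::complex_hilbert_space op"
  assumes "bounded_clinear T" "\<And>x y. inner (T x) y = inner x (S y)"
  shows "cadj T = S"
  by (rule cadj_eqI, rule clinear_adjoint) (use assms in \<open>auto simp: bounded_clinear_def\<close>)

context
  fixes T :: "'a::complex_hilbert_space op"
  assumes T: "bounded_clinear T"
begin

lemma cadj_exists: "\<exists>S. bounded_linear S \<and> (\<forall>x y. inner (T x) y = inner x (S y)) \<and> cadj T = S"
  using bounded_linear_adjoint_exists[OF bounded_clinear_linear[OF T]] cadj_eqI_inner[OF T] by blast

lemma inner_cadj: "inner (T x) y = inner x (cadj T y)"
  using cadj_exists by blast

lemma inner_cadj_left: "inner (cadj T x) y = inner x (T y)"
  using inner_cadj[of y x] by (simp add: inner_commute)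

lemma cinner_cadj: "cinner (T x) y = cinner x (cadj T y)"
  by (rule clinear_adjoint) (auto simp: inner_cadj bounded_clinear_simps[OF T])

lemma bounded_clinear_cadj: "bounded_clinear (cadj T)"
  unfolding bounded_clinear_def
proof (intro conjI allI)
  show "bounded_linear (cadj T)" using cadj_exists by blast
  show "cadj T (c *\<^sub>C x) = c *\<^sub>C cadj T x" for c x
    by (rule cinner_ext) (simp add: cinner_scaleC_right flip: cinner_cadj)
qed

lemma cadj_cadj: "cadj (cadj T) = T"
  by (rule cadj_eqI_inner[OF bounded_clinear_cadj]) (rule inner_cadj_left)

end

lemma bounded_clinear_comp: "bounded_clinear S \<Longrightarrow> bounded_clinear T \<Longrightarrow> bounded_clinear (S \<circ> T)"
  unfolding bounded_clinear_def by (auto simp: o_def intro: bounded_linear_compose)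

lemma bounded_clinear_add: "bounded_clinear S \<Longrightarrow> bounded_clinear T \<Longrightarrow> bounded_clinear (\<lambda>x. S x + T x)"
  unfolding bounded_clinear_def by (auto intro: bounded_linear_add simp: scaleC_add_right)

lemma bounded_clinear_diff: "bounded_clinear S \<Longrightarrow> bounded_clinear T \<Longrightarrow> bounded_clinear (\<lambda>x. S x - T x)"
  unfolding bounded_clinear_def by (auto intro: bounded_linear_sub simp: scaleC_diff_right)

lemma bounded_clinear_scale: "bounded_clinear T \<Longrightarrow> bounded_clinear (\<lambda>x. c *\<^sub>C T x)"
  unfolding bounded_clinear_def
  by (auto intro: bounded_linear_compose[OF bounded_linear_scaleC] simp: scaleC_scaleC mult.commute)

lemma bounded_clinear_id: "bounded_clinear id"
  by (simp add: bounded_clinear_def id_def)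

lemma bounded_clinear_zero: "bounded_clinear zero_op"
  by (simp add: bounded_clinear_def zero_op_def)

lemma cadj_comp: "bounded_clinear S \<Longrightarrow> bounded_clinear T \<Longrightarrow> cadj (S \<circ> T) = cadj T \<circ> cadj S"
  by (rule cadj_eqI_inner) (auto simp: bounded_clinear_comp inner_cadj)

lemma projection_iff:
  "projection p \<longleftrightarrow> bounded_clinear p \<and> (\<forall>x. p (p x) = p x) \<and> (\<forall>x y. inner (p x) y = inner x (p y))"
  (is "?l \<longleftrightarrow> ?r")
proof
  assume ?l
  then show ?r unfolding projection_def using inner_cadj by (metis comp_apply)
next
  assume ?r
  then show ?l unfolding projection_def using cadj_eqI_inner by (auto simp: fun_eq_iff)
qed

lemma projectionD:
  assumes "projection p"
  shows "bounded_clinear p" "p (p x) = p x" "inner (p x) y = inner x (p y)"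
  using assms by (auto simp: projection_iff)

lemma projection_norm_sq: "projection p \<Longrightarrow> (norm (p x))\<^sup>2 = inner (p x) x"
  using projectionD[of p] by (metis power2_norm_eq_inner)

lemma projection_norm_le: "projection p \<Longrightarrow> norm (p x) \<le> norm x"
proof -
  assume p: "projection p"
  have "norm (p x) * norm (p x) \<le> norm (p x) * norm x"
    using projection_norm_sq[OF p, of x] norm_cauchy_schwarz[of "p x" x] by (simp add: power2_eq_square)
  then show ?thesis by (cases "norm (p x) = 0") auto
qed

text \<open>Spectral projections will be accessible through their kernels only. As
  \<open>x - p x\<close> lies in both kernels, \<open>q = q p\<close>, and similarly
  \<open>p = p q p\<close>, which makes the norm of \<open>p x - q (p x)\<close> vanish.\<close>

lemma projection_eq_of_kernel:
  assumes p: "projection p" and q: "projection q" and ker: "\<And>x. p x = 0 \<longleftrightarrow> q x = 0"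
  shows "p = q"
proof
  fix x
  note ps = bounded_clinear_simps[OF projectionD(1)[OF p]] and qs = bounded_clinear_simps[OF projectionD(1)[OF q]]
  have "p (x - p x) = 0" by (simp add: ps projectionD(2)[OF p])
  then have 1: "q x = q (p x)" using ker qs by (metis eq_iff_diff_eq_0)
  have "q (p x - q (p x)) = 0" by (simp add: qs projectionD(2)[OF q])
  then have 2: "p x = p (q (p x))" using ker ps projectionD(2)[OF p] by (metis eq_iff_diff_eq_0)
  have "(norm (p x - q (p x)))\<^sup>2 = (norm (p x))\<^sup>2 - inner (q (p x)) (p x)"
    using projectionD(2,3)[OF q] by (simp add: power2_norm_eq_inner inner_diff inner_commute)
  also have "inner (q (p x)) (p x) = inner (p (q (p x))) x"
    using projectionD(3)[OF p] by simp
  also have "\<dots> = (norm (p x))\<^sup>2" using 2 projection_norm_sq[OF p] by simp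
  finally show "p x = q x" using 1 by simp
qed

lemma projection_oproj:
  fixes K :: "'a::complex_hilbert_space set"
  assumes K: "subspace K" "closed K" "\<And>c x. x \<in> K \<Longrightarrow> c *\<^sub>C x \<in> K"
  shows "projection (oproj K)"
  unfolding projection_iff bounded_clinear_def
  using oproj_idem[OF K(1,2)] oproj_selfadjoint[OF K(1,2)] bounded_linear_oproj[OF K(1,2)]
    oproj_commute[OF K(1,2) bounded_linear_scaleC inner_scaleC_left K(3) K(3)] by blast

section \<open>Commutants and von Neumann algebras\<close>

lemma commutantD: "T \<in> commutant M \<Longrightarrow> S \<in> M \<Longrightarrow> T (S x) = S (T x)"
  unfolding commutant_def by (metis (mono_tags, lifting) comp_apply mem_Collect_eq)

lemma commutant_bounded_clinear: "T \<in> commutant M \<Longrightarrow> bounded_clinear T"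
  by (simp add: commutant_def)

lemma commutantI:
  "bounded_clinear T \<Longrightarrow> (\<And>S x. S \<in> M \<Longrightarrow> T (S x) = S (T x)) \<Longrightarrow> T \<in> commutant M"
  by (auto simp: commutant_def fun_eq_iff)

text \<open>Used with \<open>A + \<i> W\<close> and \<open>A - \<i> W\<close>, and with
  \<open>T + cadj T\<close> and \<open>T - cadj T\<close>, to recover the first term.\<close>

lemma eq_if_sum_diff_eq:
  fixes p q r s :: "'a::real_vector"
  assumes "p + q = r + s" "p - q = r - s" shows "p = r"
proof -
  have "2 *\<^sub>R p = (p + q) + (p - q)" by (simp add: scaleR_2)
  also have "\<dots> = (r + s) + (r - s)" by (simp only: assms)
  also have "\<dots> = 2 *\<^sub>R r" by (simp add: scaleR_2)
  finally show ?thesis by simp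
qed

locale von_neumann =
  fixes M :: "'h::complex_hilbert_space op set"
  assumes vN: "von_neumann_algebra M"
begin

lemma M_bounded_clinear: "T \<in> M \<Longrightarrow> bounded_clinear T"
  and M_cadj: "T \<in> M \<Longrightarrow> cadj T \<in> M"
  and bicommutant: "commutant (commutant M) = M"
  using vN by (auto simp: von_neumann_algebra_def)

lemma M_I: "bounded_clinear T \<Longrightarrow> (\<And>S x. S \<in> commutant M \<Longrightarrow> T (S x) = S (T x)) \<Longrightarrow> T \<in> M"
  using commutantI[of T "commutant M"] bicommutant by simp

lemma M_commute: "T \<in> M \<Longrightarrow> S \<in> commutant M \<Longrightarrow> T (S x) = S (T x)"
  using commutantD by metis

lemma commutant_cadj:
  assumes T: "T \<in> commutant M" shows "cadj T \<in> commutant M"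
proof (rule commutantI)
  note bT = commutant_bounded_clinear[OF T]
  show "bounded_clinear (cadj T)" by (rule bounded_clinear_cadj[OF bT])
  fix S x assume S: "S \<in> M"
  note bS = M_bounded_clinear[OF S]
  show "cadj T (S x) = S (cadj T x)"
  proof (rule iffD1[OF vector_eq_ldot, OF allI])
    fix z
    have "inner z (cadj T (S x)) = inner (cadj S (T z)) x"
      by (simp add: inner_cadj_left[OF bS] inner_cadj[OF bT])
    also have "\<dots> = inner (T (cadj S z)) x" using commutantD[OF T M_cadj[OF S]] by simp
    also have "\<dots> = inner z (S (cadj T x))"
      by (simp add: inner_cadj_left[OF bS] inner_cadj[OF bT])
    finally show "inner z (cadj T (S x)) = inner z (S (cadj T x))" .
  qed
qed

lemma M_comp: "S \<in> M \<Longrightarrow> T \<in> M \<Longrightarrow> S \<circ> T \<in> M"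
  by (rule M_I) (auto simp: M_bounded_clinear bounded_clinear_comp M_commute)

lemma M_add: "S \<in> M \<Longrightarrow> T \<in> M \<Longrightarrow> (\<lambda>x. S x + T x) \<in> M"
  by (rule M_I) (auto simp: M_bounded_clinear bounded_clinear_add M_commute
      bounded_clinear_simps[OF commutant_bounded_clinear])

lemma M_diff: "S \<in> M \<Longrightarrow> T \<in> M \<Longrightarrow> (\<lambda>x. S x - T x) \<in> M"
  by (rule M_I) (auto simp: M_bounded_clinear bounded_clinear_diff M_commute
      bounded_clinear_simps[OF commutant_bounded_clinear])

lemma M_scale: "S \<in> M \<Longrightarrow> (\<lambda>x. c *\<^sub>C S x) \<in> M"
  by (rule M_I) (auto simp: M_bounded_clinear bounded_clinear_scale M_commute
      bounded_clinear_simps[OF commutant_bounded_clinear])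

lemma M_id: "id \<in> M"
  by (rule M_I) (auto simp: bounded_clinear_id)

lemma M_zero: "zero_op \<in> M"
  by (rule M_I[OF bounded_clinear_zero]) (auto simp: zero_op_def bounded_clinear_simps[OF commutant_bounded_clinear])

end

text \<open>Every self-adjoint contraction \<open>A\<close> is the real part of the unitary
  \<open>A + i (1 - A\<^sup>2)\<^sup>1\<^sup>/\<^sup>2\<close>, so the unitaries span the commutant.\<close>

lemma (in von_neumann) commutes_with_contraction:
  assumes X: "bounded_clinear X" and unit: "\<And>u x. u \<in> commutant M \<Longrightarrow> unitary u \<Longrightarrow> X (u x) = u (X x)"
    and A: "A \<in> commutant M" and sa: "\<And>x y. inner (A x) y = inner x (A y)"
    and le: "\<And>x. norm (A x) \<le> norm x"
  shows "X (A x) = A (X x)"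
proof -
  note bA = commutant_bounded_clinear[OF A]
  note As = bounded_clinear_simps[OF bA]
  interpret T: positive_contraction "\<lambda>x. A (A x)"
  proof (rule positive_contraction.intro)
    show "bounded_linear (\<lambda>x. A (A x))"
      using bounded_linear_compose bounded_clinear_linear[OF bA] by blast
    show "inner (A (A x)) y = inner x (A (A y))" for x y by (simp add: sa)
    show "0 \<le> inner (A (A x)) x" for x using sa[of "A x" x] by simp
    show "inner (A (A x)) x \<le> inner x x" for x
      using sa[of "A x" x] power_mono[OF le[of x], of 2] by (simp add: power2_norm_eq_inner)
  qed
  let ?f = "\<lambda>t::real. sqrt (1 - t)"
  have f: "bfun ?f" by (rule bfun_continuous) (auto intro!: continuous_intros)
  define W where "W = T.fc ?f"
  have Wbl: "bounded_linear W" unfolding W_def by (rule T.bounded_linear_fc[OF f])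
  have Wsa: "inner (W x) y = inner x (W y)" for x y unfolding W_def by (rule T.fc_selfadjoint[OF f])
  \<comment> \<open>Whatever commutes with \<open>A\<close> commutes with its square and so with
    \<open>W\<close>; this covers complex scalars, \<open>A\<close> itself and the elements of
    \<open>M\<close>.\<close>
  have WC: "S (W x) = W (S x)" if "bounded_linear S" "\<And>x. S (A x) = A (S x)" for S x
    unfolding W_def by (rule T.fc_commute[OF f that(1)]) (simp add: that(2))
  have Wc: "W (c *\<^sub>C x) = c *\<^sub>C W x" for c x
    by (rule WC[symmetric]) (auto simp: bounded_linear_scaleC As)
  have bW: "bounded_clinear W" using Wbl Wc by (simp add: bounded_clinear_def)
  note Ws = bounded_clinear_simps[OF bW]
  have WA: "A (W x) = W (A x)" for x by (rule WC) (auto intro: bounded_clinear_linear[OF bA])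
  have WM: "W \<in> commutant M"
    by (rule commutantI[OF bW], rule WC[symmetric])
      (auto intro: bounded_clinear_linear M_bounded_clinear simp: commutantD[OF A])
  have WW: "W (W x) = x - A (A x)" for x
  proof -
    have "W (W x) = T.fc (\<lambda>t. ?f t * ?f t) x" unfolding W_def by (rule T.fc_mult[OF f f, symmetric])
    also have "\<dots> = T.fc (poly [:1, -1:]) x"
      by (rule T.fc_cong[OF bfun_mult[OF f f]]) auto
    finally show ?thesis by (simp add: T.fc_poly T.pop_1_minus_X)
  qed
  \<comment> \<open>Both signs of \<open>\<i>\<close> are treated at once, since the adjoint of
    \<open>A + c W\<close> is \<open>A + cnj c W\<close>.\<close>
  have inM: "(\<lambda>x. A x + c *\<^sub>C W x) \<in> commutant M" for c
    by (rule commutantI)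
      (auto simp: bounded_clinear_add bA bounded_clinear_scale bW commutantD[OF A] commutantD[OF WM]
        bounded_clinear_simps[OF M_bounded_clinear])
  have adj: "cadj (\<lambda>x. A x + c *\<^sub>C W x) = (\<lambda>x. A x + cnj c *\<^sub>C W x)" for c
    by (rule cadj_eqI_inner[OF commutant_bounded_clinear[OF inM]])
      (simp add: inner_add sa inner_scaleC_left Wsa Wc)
  have unitary: "unitary (\<lambda>x. A x + c *\<^sub>C W x)" if "c = \<i> \<or> c = - \<i>" for c
    unfolding unitary_def adj
  proof (intro conjI commutant_bounded_clinear[OF inM])
    have cc: "c * cnj c = 1" "cnj c * c = 1" using that by auto
    have "(A (A x + c *\<^sub>C W x) + cnj c *\<^sub>C W (A x + c *\<^sub>C W x)) = x" if "cnj c = - c" "cnj c * c = 1" for c x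
    proof -
      have "A (A x + c *\<^sub>C W x) + cnj c *\<^sub>C W (A x + c *\<^sub>C W x)
          = A (A x) + c *\<^sub>C W (A x) + cnj c *\<^sub>C W (A x) + W (W x)"
        by (simp add: As Ws WA scaleC_add_right scaleC_scaleC that(2))
      moreover have "c *\<^sub>C W (A x) + cnj c *\<^sub>C W (A x) = 0"
        using that(1) by (simp flip: scaleC_add_left)
      ultimately show ?thesis by (simp add: WW add.assoc)
    qed note * = this
    have "cnj c = - c" "cnj (cnj c) = - cnj c" "cnj (cnj c) * cnj c = 1" using that by auto
    then show "(\<lambda>x. A x + cnj c *\<^sub>C W x) \<circ> (\<lambda>x. A x + c *\<^sub>C W x) = id"
      and "(\<lambda>x. A x + c *\<^sub>C W x) \<circ> (\<lambda>x. A x + cnj c *\<^sub>C W x) = id"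
      using *[of c] *[of "cnj c"] cc by (auto simp: fun_eq_iff)
  qed
  have "X (A x + \<i> *\<^sub>C W x) = A (X x) + \<i> *\<^sub>C W (X x)"
    by (rule unit[OF inM unitary]) simp
  moreover have "X (A x + (- \<i>) *\<^sub>C W x) = A (X x) + (- \<i>) *\<^sub>C W (X x)"
    by (rule unit[OF inM unitary]) simp
  ultimately have "X (A x) + \<i> *\<^sub>C X (W x) = A (X x) + \<i> *\<^sub>C W (X x)"
    "X (A x) - \<i> *\<^sub>C X (W x) = A (X x) - \<i> *\<^sub>C W (X x)"
    by (simp_all add: bounded_clinear_simps[OF X] scaleC_minus_left)
  then show ?thesis by (rule eq_if_sum_diff_eq)
qed

text \<open>\<open>affiliated\<close> tests with unitaries of the commutant only. By the preceding
  lemma, commuting with these implies commuting with the self-adjoint elements of the commutant, and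
  these span it.\<close>

lemma (in von_neumann) M_I_unitary:
  assumes X: "bounded_clinear X" and unit: "\<And>u x. u \<in> commutant M \<Longrightarrow> unitary u \<Longrightarrow> X (u x) = u (X x)"
  shows "X \<in> M"
proof (rule M_I[OF X])
  fix T x assume T: "T \<in> commutant M"
  note bT = commutant_bounded_clinear[OF T] and bT' = commutant_bounded_clinear[OF commutant_cadj[OF T]]
  note Xs = bounded_clinear_simps[OF X]
  have sa: "X (A x) = A (X x)" if A: "A \<in> commutant M" and sa: "\<And>x y. inner (A x) y = inner x (A y)" for A x
  proof -
    note bA = commutant_bounded_clinear[OF A]
    obtain K where K: "0 < K" "\<And>x. norm (A x) \<le> norm x * K"
      using bounded_linear.pos_bounded[OF bounded_clinear_linear[OF bA]] by blast
    define r where "r = 1 / K"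
    have rc: "r *\<^sub>R y = of_real r *\<^sub>C y" for y :: 'h by (rule scaleC_of_real[symmetric])
    have "X (r *\<^sub>R A x) = r *\<^sub>R A (X x)"
    proof (rule commutes_with_contraction[OF X unit])
      show "(\<lambda>x. r *\<^sub>R A x) \<in> commutant M"
        unfolding rc
        by (rule commutantI) (auto simp: bounded_clinear_scale[OF bA] commutantD[OF A]
            bounded_clinear_simps[OF M_bounded_clinear])
      show "norm (r *\<^sub>R A x) \<le> norm x" for x using K(1) K(2)[of x] by (simp add: r_def field_simps)
    qed (auto simp: sa)
    moreover have "r \<noteq> 0" using K(1) by (simp add: r_def)
    ultimately show ?thesis by (simp add: Xs)
  qed
  \<comment> \<open>Twice the real part of \<open>T\<close> and, up to sign, twice its imaginary
    part; both are self-adjoint elements of the commutant.\<close>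
  let ?A = "\<lambda>x. T x + cadj T x" and ?B = "\<lambda>x. \<i> *\<^sub>C (T x - cadj T x)"
  have "X (?A x) = ?A (X x)"
    by (rule sa)
      (auto intro!: commutantI bounded_clinear_add bT bT' simp: commutantD[OF T] commutantD[OF commutant_cadj[OF T]]
        bounded_clinear_simps[OF M_bounded_clinear] inner_add inner_cadj[OF bT] inner_cadj_left[OF bT])
  moreover have "X (?B x) = ?B (X x)"
  proof (rule sa)
    show "inner (?B x) y = inner x (?B y)" for x y
    proof -
      have "inner (?B x) y = inner (T x - cadj T x) (- (\<i> *\<^sub>C y))"
        by (simp add: inner_scaleC_left scaleC_minus_left)
      also have "\<dots> = inner x (\<i> *\<^sub>C T y - \<i> *\<^sub>C cadj T y)"
        by (simp add: inner_diff inner_cadj[OF bT] inner_cadj_left[OF bT] bounded_clinear_simps[OF bT]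
            bounded_clinear_simps[OF bT'])
      finally show ?thesis by (simp add: scaleC_diff_right)
    qed
  qed (auto intro!: commutantI bounded_clinear_scale bounded_clinear_diff bT bT'
      simp: commutantD[OF T] commutantD[OF commutant_cadj[OF T]]
        bounded_clinear_simps[OF M_bounded_clinear])
  then have "\<i> *\<^sub>C X (T x - cadj T x) = \<i> *\<^sub>C (T (X x) - cadj T (X x))" by (simp add: Xs)
  then have "(- \<i>) *\<^sub>C (\<i> *\<^sub>C X (T x - cadj T x)) = (- \<i>) *\<^sub>C (\<i> *\<^sub>C (T (X x) - cadj T (X x)))" by simp
  then have "X (T x) - X (cadj T x) = T (X x) - cadj T (X x)" by (simp add: scaleC_scaleC Xs)
  ultimately show "X (T x) = T (X x)"
    unfolding Xs by (rule eq_if_sum_diff_eq)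
qed

section \<open>Resolvents and square roots of unbounded operators\<close>

text \<open>Complex linear relations: products and adjoints of graphs stay in this class without any
  knowledge of single-valuedness, closedness or density.\<close>

definition graph_subspace :: "'h::complex_hilbert_space uop \<Rightarrow> bool" where
  "graph_subspace x \<longleftrightarrow> (0, 0) \<in> x \<and>
     (\<forall>\<xi> \<eta> \<xi>' \<eta>'. (\<xi>, \<eta>) \<in> x \<longrightarrow> (\<xi>', \<eta>') \<in> x \<longrightarrow> (\<xi> + \<xi>', \<eta> + \<eta>') \<in> x) \<and>
     (\<forall>c \<xi> \<eta>. (\<xi>, \<eta>) \<in> x \<longrightarrow> (c *\<^sub>C \<xi>, c *\<^sub>C \<eta>) \<in> x)"

lemma graph_subspaceD:
  assumes "graph_subspace x"
  shows "(0, 0) \<in> x"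
    and "(\<xi>, \<eta>) \<in> x \<Longrightarrow> (\<xi>', \<eta>') \<in> x \<Longrightarrow> (\<xi> + \<xi>', \<eta> + \<eta>') \<in> x"
    and "(\<xi>, \<eta>) \<in> x \<Longrightarrow> (c *\<^sub>C \<xi>, c *\<^sub>C \<eta>) \<in> x"
    and "(\<xi>, \<eta>) \<in> x \<Longrightarrow> (r *\<^sub>R \<xi>, r *\<^sub>R \<eta>) \<in> x"
    and "(\<xi>, \<eta>) \<in> x \<Longrightarrow> (\<xi>', \<eta>') \<in> x \<Longrightarrow> (\<xi> - \<xi>', \<eta> - \<eta>') \<in> x"
proof -
  show "(0, 0) \<in> x" and add: "(\<xi>, \<eta>) \<in> x \<Longrightarrow> (\<xi>', \<eta>') \<in> x \<Longrightarrow> (\<xi> + \<xi>', \<eta> + \<eta>') \<in> x"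
    and "(\<xi>, \<eta>) \<in> x \<Longrightarrow> (c *\<^sub>C \<xi>, c *\<^sub>C \<eta>) \<in> x" for \<xi> \<eta> \<xi>' \<eta>' c
    using assms unfolding graph_subspace_def by blast+
  show scale: "(\<xi>, \<eta>) \<in> x \<Longrightarrow> (r *\<^sub>R \<xi>, r *\<^sub>R \<eta>) \<in> x" for \<xi> \<eta> r
    using assms unfolding graph_subspace_def by (metis scaleC_of_real)
  show "(\<xi>, \<eta>) \<in> x \<Longrightarrow> (\<xi>', \<eta>') \<in> x \<Longrightarrow> (\<xi> - \<xi>', \<eta> - \<eta>') \<in> x"
    using add[of \<xi> \<eta> "-1 *\<^sub>R \<xi>'" "-1 *\<^sub>R \<eta>'"] scale[of \<xi>' \<eta>' "-1"] by simp
qed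

lemma graph_subspace_comp: "graph_subspace x \<Longrightarrow> graph_subspace y \<Longrightarrow> graph_subspace (x O y)"
  unfolding graph_subspace_def by (intro conjI allI impI; blast)

lemma closed_densely_defined_graph_subspace:
  assumes "closed_densely_defined x" shows "graph_subspace x"
proof -
  have "Domain x \<noteq> {}" using assms by (auto simp: closed_densely_defined_def)
  then obtain \<xi> \<eta> where "(\<xi>, \<eta>) \<in> x" by blast
  moreover have scale: "\<And>c \<xi> \<eta>. (\<xi>, \<eta>) \<in> x \<Longrightarrow> (c *\<^sub>C \<xi>, c *\<^sub>C \<eta>) \<in> x"
    using assms by (auto simp: closed_densely_defined_def)
  ultimately have "(0 *\<^sub>C \<xi>, 0 *\<^sub>C \<eta>) \<in> x" by blast
  then have "(0, 0) \<in> x" by simp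
  then show ?thesis using assms by (auto simp: graph_subspace_def closed_densely_defined_def)
qed

text \<open>A linear graph is invariant under complex scalars, so testing with the real inner
  product loses nothing.\<close>

lemma uop_adj_iff:
  assumes "graph_subspace x"
  shows "(\<eta>, \<zeta>) \<in> uop_adj x \<longleftrightarrow> (\<forall>\<xi> \<xi>'. (\<xi>, \<xi>') \<in> x \<longrightarrow> inner \<xi>' \<eta> = inner \<xi> \<zeta>)"
proof
  assume "(\<eta>, \<zeta>) \<in> uop_adj x"
  then have "\<forall>\<xi> \<xi>'. (\<xi>, \<xi>') \<in> x \<longrightarrow> cinner \<xi>' \<eta> = cinner \<xi> \<zeta>" by (auto simp: uop_adj_def)
  then show "\<forall>\<xi> \<xi>'. (\<xi>, \<xi>') \<in> x \<longrightarrow> inner \<xi>' \<eta> = inner \<xi> \<zeta>" by (metis Re_cinner)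
next
  assume *: "\<forall>\<xi> \<xi>'. (\<xi>, \<xi>') \<in> x \<longrightarrow> inner \<xi>' \<eta> = inner \<xi> \<zeta>"
  have "cinner \<xi>' \<eta> = cinner \<xi> \<zeta>" if "(\<xi>, \<xi>') \<in> x" for \<xi> \<xi>'
    by (rule cinner_eqI) (use * graph_subspaceD(3)[OF assms that] in blast)
  then show "(\<eta>, \<zeta>) \<in> uop_adj x" by (auto simp: uop_adj_def)
qed

lemma graph_subspace_adj:
  assumes x: "graph_subspace x" shows "graph_subspace (uop_adj x)"
  unfolding graph_subspace_def
proof (intro conjI allI impI)
  show "(0, 0) \<in> uop_adj x" by (simp add: uop_adj_iff[OF x])
  fix \<xi> \<eta> \<xi>' \<eta>' assume "(\<xi>, \<eta>) \<in> uop_adj x" "(\<xi>', \<eta>') \<in> uop_adj x"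
  then show "(\<xi> + \<xi>', \<eta> + \<eta>') \<in> uop_adj x" by (simp add: uop_adj_iff[OF x] inner_add)
next
  fix c \<xi> \<eta> assume "(\<xi>, \<eta>) \<in> uop_adj x"
  then show "(c *\<^sub>C \<xi>, c *\<^sub>C \<eta>) \<in> uop_adj x"
    by (auto simp: uop_adj_def cinner_scaleC_right)
qed

lemma closed_uop_adj:
  assumes "graph_subspace x" shows "closed (uop_adj x)"
proof -
  have "uop_adj x = (\<Inter>q\<in>x. {p. inner (snd q) (fst p) = inner (fst q) (snd p)})"
    by (force simp: uop_adj_iff[OF assms])
  then show ?thesis by (auto intro!: closed_INT closed_Collect_eq continuous_intros)
qed

lemma subspace_closure_set:
  fixes K :: "'a::real_normed_vector set"
  assumes "subspace K" shows "subspace (closure K)"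
  unfolding subspace_def
proof (intro conjI ballI allI)
  show "0 \<in> closure K" using subspace_0[OF assms] closure_subset by blast
  fix x assume "x \<in> closure K"
  then obtain f where f: "\<And>n. f n \<in> K" "f \<longlonglongrightarrow> x" unfolding closure_sequential by blast
  show "c *\<^sub>R x \<in> closure K" for c
    unfolding closure_sequential using subspace_scale[OF assms] f tendsto_scaleR[OF tendsto_const f(2)]
    by (intro exI[of _ "\<lambda>n. c *\<^sub>R f n"]) auto
  fix y assume "y \<in> closure K"
  then obtain g where g: "\<And>n. g n \<in> K" "g \<longlonglongrightarrow> y" unfolding closure_sequential by blast
  show "x + y \<in> closure K"
    unfolding closure_sequential using subspace_add[OF assms] f g tendsto_add[OF f(2) g(2)]
    by (intro exI[of _ "\<lambda>n. f n + g n"]) auto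
qed

text \<open>The orthogonal complement of the range of a symmetric operator is its kernel, which is
  trivial here.\<close>

lemma densely_definedI:
  fixes T :: "'a::{real_inner,banach} \<Rightarrow> 'a"
  assumes "linear T" "\<And>x y. inner (T x) y = inner x (T y)" "\<And>x. T x = 0 \<Longrightarrow> x = 0"
  shows "closure (range T) = UNIV"
proof -
  let ?K = "closure (range T)"
  have K: "subspace ?K" "closed ?K"
    using subspace_closure_set[OF linear_subspace_image[OF assms(1) subspace_UNIV]] by auto
  have "x \<in> ?K" for x
  proof -
    let ?v = "x - oproj ?K x"
    have "inner (T ?v) w = 0" for w
      using oproj_orthogonal[OF K, of "T w" x] closure_subset[of "range T"] assms(2) by auto
    then have "inner (T ?v) (T ?v) = 0" by blast
    then have "T ?v = 0" by simp
    then have "?v = 0" by (rule assms(3))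
    then show ?thesis using oproj_in[OF K, of x] by simp
  qed
  then show ?thesis by blast
qed

lemma inner_eq_on_dense:
  fixes x y :: "'a::real_inner"
  assumes "closure S = UNIV" "\<And>z. z \<in> S \<Longrightarrow> inner x z = inner y z"
  shows "x = y"
proof -
  have "closed {z. inner x z = inner y z}" by (intro closed_Collect_eq continuous_intros)
  then have "closure S \<subseteq> {z. inner x z = inner y z}" using assms(2) by (intro closure_minimal) auto
  then have "inner x z = inner y z" for z using assms(1) by blast
  then show ?thesis by (metis inner_commute vector_eq_ldot)
qed

text \<open>That is, \<open>R = (1 + b)\<^sup>-\<^sup>1\<close> with \<open>b \<ge> 0\<close>.\<close>

definition resolvent_of :: "'h::complex_hilbert_space uop \<Rightarrow> 'h op \<Rightarrow> bool" where
  "resolvent_of b R \<longleftrightarrow> positive_contraction R \<and> bounded_clinear R \<and> (\<forall>x. R x = 0 \<longrightarrow> x = 0) \<and>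
     b = {(R \<zeta>, \<zeta> - R \<zeta>) | \<zeta>. True}"

text \<open>\<open>(\<xi>, \<zeta> - \<xi>) \<in> b\<close> says that \<open>1 + b\<close> maps
  \<open>\<xi>\<close> to \<open>\<zeta>\<close>. Positivity makes this solution unique, hence
  \<open>R\<close> linear, and bounds it; symmetry of \<open>b\<close> passes to \<open>R\<close>,
  and single-valuedness at 0 makes \<open>R\<close> injective.\<close>

lemma resolvent_exists:
  fixes b :: "'h::complex_hilbert_space uop"
  assumes b: "graph_subspace b"
    and surj: "\<And>\<zeta>. \<exists>\<xi>. (\<xi>, \<zeta> - \<xi>) \<in> b"
    and sym: "\<And>\<xi> \<eta> \<xi>' \<eta>'. (\<xi>, \<eta>) \<in> b \<Longrightarrow> (\<xi>', \<eta>') \<in> b \<Longrightarrow> inner \<xi> \<eta>' = inner \<eta> \<xi>'"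
    and pos: "\<And>\<xi> \<eta>. (\<xi>, \<eta>) \<in> b \<Longrightarrow> 0 \<le> inner \<xi> \<eta>"
    and sv: "\<And>\<eta>. (0, \<eta>) \<in> b \<Longrightarrow> \<eta> = 0"
  shows "\<exists>R. resolvent_of b R"
proof -
  note bD = graph_subspaceD[OF b]
  obtain R where R: "\<And>\<zeta>. (R \<zeta>, \<zeta> - R \<zeta>) \<in> b" using surj by metis
  have R_eq: "R (\<xi> + \<eta>) = \<xi>" if "(\<xi>, \<eta>) \<in> b" for \<xi> \<eta>
  proof -
    define \<delta> where "\<delta> = R (\<xi> + \<eta>) - \<xi>"
    have "(\<delta>, (\<xi> + \<eta> - R (\<xi> + \<eta>)) - \<eta>) \<in> b" unfolding \<delta>_def by (rule bD(5)[OF R that])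
    then have "(\<delta>, - \<delta>) \<in> b" by (simp add: \<delta>_def)
    from pos[OF this] have "inner \<delta> \<delta> \<le> 0" by simp
    then have "\<delta> = 0" by (metis inner_gt_zero_iff not_less)
    then show ?thesis by (simp add: \<delta>_def)
  qed
  have add: "R (\<zeta> + \<zeta>') = R \<zeta> + R \<zeta>'" for \<zeta> \<zeta>'
    using R_eq[OF bD(2)[OF R[of \<zeta>] R[of \<zeta>']]] by (simp add: algebra_simps)
  have scaleC: "R (c *\<^sub>C \<zeta>) = c *\<^sub>C R \<zeta>" for c \<zeta>
    using R_eq[OF bD(3)[OF R[of \<zeta>], of c]] by (simp add: scaleC_diff_right)
  have scaleR: "R (r *\<^sub>R \<zeta>) = r *\<^sub>R R \<zeta>" for r \<zeta> using scaleC[of "of_real r" \<zeta>] by (simp add: scaleC_of_real)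
  have sq: "(norm (R \<zeta>))\<^sup>2 \<le> inner (R \<zeta>) \<zeta>" for \<zeta>
    using pos[OF R[of \<zeta>]] by (simp add: inner_diff power2_norm_eq_inner)
  have bound: "norm (R \<zeta>) \<le> norm \<zeta> * 1" for \<zeta>
  proof -
    have "norm (R \<zeta>) * norm (R \<zeta>) \<le> norm (R \<zeta>) * norm \<zeta>"
      using sq[of \<zeta>] norm_cauchy_schwarz[of "R \<zeta>" \<zeta>] by (simp add: power2_eq_square)
    then show ?thesis by (cases "norm (R \<zeta>) = 0") auto
  qed
  have bl: "bounded_linear R" by (rule bounded_linear_intro[where K = 1]) (fact add scaleR bound)+
  have "positive_contraction R"
  proof (rule positive_contraction.intro[OF bl])
    show "inner (R x) y = inner x (R y)" for x y
      using sym[OF R[of x] R[of y]] by (simp add: inner_diff inner_commute)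
    show "0 \<le> inner (R x) x" for x using sq[of x] zero_le_power2[of "norm (R x)"] by linarith
    show "inner (R x) x \<le> inner x x" for x
      using pos[OF R[of x]] inner_ge_zero[of "x - R x"] by (simp add: inner_diff inner_commute)
  qed
  moreover have "x = 0" if "R x = 0" for x using R[of x] that sv by simp
  moreover have "b = {(R \<zeta>, \<zeta> - R \<zeta>) | \<zeta>. True}"
  proof -
    have "\<exists>\<zeta>. \<xi> = R \<zeta> \<and> \<eta> = \<zeta> - R \<zeta>" if "(\<xi>, \<eta>) \<in> b" for \<xi> \<eta>
      using R_eq[OF that] by (intro exI[of _ "\<xi> + \<eta>"]) simp
    then have "b \<subseteq> {(R \<zeta>, \<zeta> - R \<zeta>) | \<zeta>. True}" by auto
    moreover have "{(R \<zeta>, \<zeta> - R \<zeta>) | \<zeta>. True} \<subseteq> b" using R by auto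
    ultimately show ?thesis by (rule subset_antisym)
  qed
  ultimately show ?thesis unfolding resolvent_of_def bounded_clinear_def using bl scaleC by blast
qed

lemma graph_subspace_imp_subspace: "graph_subspace x \<Longrightarrow> subspace (x :: ('h::complex_hilbert_space \<times> 'h) set)"
  by (auto simp: subspace_def zero_prod_def graph_subspaceD)

text \<open>The orthogonal projection of \<open>(\<zeta>, 0)\<close> to the graph of \<open>x\<close> is \<open>(\<xi>, x \<xi>)\<close> with
  \<open>\<xi> = (1 + x\<^sup>* x)\<^sup>-\<^sup>1 \<zeta>\<close>.\<close>

lemma resolvent_adj_comp:
  fixes x :: "'h::complex_hilbert_space uop"
  assumes x: "closed_densely_defined x"
  shows "\<exists>R. resolvent_of (x O uop_adj x) R"
proof (rule resolvent_exists)
  have gx: "graph_subspace x" by (rule closed_densely_defined_graph_subspace[OF x])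
  note adj = uop_adj_iff[OF gx]
  show "graph_subspace (x O uop_adj x)" by (intro graph_subspace_comp gx graph_subspace_adj)
  have cx: "closed x" using x by (simp add: closed_densely_defined_def)
  note sx = graph_subspace_imp_subspace[OF gx]
  show "\<exists>\<xi>. (\<xi>, \<zeta> - \<xi>) \<in> x O uop_adj x" for \<zeta>
  proof -
    obtain \<xi> \<eta> where p: "oproj x (\<zeta>, 0) = (\<xi>, \<eta>)" by fastforce
    have in_x: "(\<xi>, \<eta>) \<in> x" using oproj_in[OF sx cx, of "(\<zeta>, 0)"] p by simp
    have "inner \<xi>' \<eta> = inner \<xi>0 (\<zeta> - \<xi>)" if "(\<xi>0, \<xi>') \<in> x" for \<xi>0 \<xi>'
      using oproj_orthogonal[OF sx cx that, of "(\<zeta>, 0)"] by (simp add: p inner_commute)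
    then have "(\<eta>, \<zeta> - \<xi>) \<in> uop_adj x" by (simp add: adj)
    then show ?thesis using in_x by blast
  qed
  fix \<xi> \<theta> assume "(\<xi>, \<theta>) \<in> x O uop_adj x"
  then obtain \<eta> where \<eta>: "(\<xi>, \<eta>) \<in> x" "(\<eta>, \<theta>) \<in> uop_adj x" by blast
  show "0 \<le> inner \<xi> \<theta>" using \<eta> adj by (metis inner_ge_zero)
  fix \<xi>' \<theta>' assume "(\<xi>', \<theta>') \<in> x O uop_adj x"
  then obtain \<eta>' where \<eta>': "(\<xi>', \<eta>') \<in> x" "(\<eta>', \<theta>') \<in> uop_adj x" by blast
  show "inner \<xi> \<theta>' = inner \<theta> \<xi>'"
    using \<eta> \<eta>' adj by (metis inner_commute)
next
  have gx: "graph_subspace x" by (rule closed_densely_defined_graph_subspace[OF x])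
  note adj = uop_adj_iff[OF gx]
  fix \<theta> assume "(0, \<theta>) \<in> x O uop_adj x"
  then obtain \<eta> where \<eta>: "(0, \<eta>) \<in> x" "(\<eta>, \<theta>) \<in> uop_adj x" by blast
  have "\<eta> = 0" using \<eta>(1) graph_subspaceD(1)[OF gx] x by (auto simp: closed_densely_defined_def single_valued_def)
  then have *: "inner \<theta> z = inner 0 z" if "z \<in> Domain x" for z
    using \<eta>(2) that adj by (auto simp: inner_commute)
  show "\<theta> = 0"
    using inner_eq_on_dense[OF _ *] x unfolding closed_densely_defined_def by blast
qed

section \<open>Positive self-adjoint operators\<close>

context
  fixes a :: "'h::complex_hilbert_space uop"
  assumes a: "positive_selfadjoint a"
begin

lemma possa_graph_subspace: "graph_subspace a"
  using a closed_densely_defined_graph_subspace by (auto simp: positive_selfadjoint_def)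

lemma possa_sym: "(\<xi>, \<eta>) \<in> a \<Longrightarrow> (\<xi>', \<eta>') \<in> a \<Longrightarrow> inner \<xi> \<eta>' = inner \<eta> \<xi>'"
  using a uop_adj_iff[OF possa_graph_subspace, of \<xi>' \<eta>'] by (auto simp: positive_selfadjoint_def)

lemma possa_pos: "(\<xi>, \<eta>) \<in> a \<Longrightarrow> 0 \<le> inner \<eta> \<xi>"
  using a by (auto simp: positive_selfadjoint_def Re_cinner)

lemma possa_sv: "(\<xi>, \<eta>) \<in> a \<Longrightarrow> (\<xi>, \<eta>') \<in> a \<Longrightarrow> \<eta> = \<eta>'"
  using a by (auto simp: positive_selfadjoint_def closed_densely_defined_def single_valued_def)

lemma possa_dense: "closure (Domain a) = UNIV"
  using a by (auto simp: positive_selfadjoint_def closed_densely_defined_def)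

text \<open>Self-adjointness as maximality: a pair that is formally adjoint to the whole graph
  already lies in it.\<close>

lemma possa_I:
  assumes "\<And>\<xi>' \<eta>'. (\<xi>', \<eta>') \<in> a \<Longrightarrow> inner \<xi>' \<eta> = inner \<eta>' \<xi>"
  shows "(\<xi>, \<eta>) \<in> a"
  using assms a uop_adj_iff[OF possa_graph_subspace, of \<xi> \<eta>] by (auto simp: positive_selfadjoint_def)

lemma possa_closed: "closed a"
  using a by (auto simp: positive_selfadjoint_def closed_densely_defined_def)

text \<open>The range \<open>K\<close> of \<open>1 + a\<close> is closed because positivity bounds a
  graph element by its image, see \<open>est\<close>. A vector \<open>v\<close> orthogonal to
  \<open>K\<close> satisfies \<open>(v, - v) \<in> a\<close> by maximality of \<open>a\<close>, and
  positivity forces \<open>v = 0\<close>.\<close>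

lemma possa_range_one_plus: "\<exists>\<xi>. (\<xi>, \<zeta> - \<xi>) \<in> a"
proof -
  note aD = graph_subspaceD[OF possa_graph_subspace]
  define K where "K = {\<xi> + \<eta> | \<xi> \<eta>. (\<xi>, \<eta>) \<in> a}"
  have sub: "subspace K"
    unfolding subspace_def
  proof (intro conjI ballI allI)
    show "0 \<in> K" using aD(1) unfolding K_def by force
    fix u assume "u \<in> K"
    then obtain \<xi> \<eta> where u: "u = \<xi> + \<eta>" "(\<xi>, \<eta>) \<in> a" unfolding K_def by blast
    show "r *\<^sub>R u \<in> K" for r
      using aD(4)[OF u(2), of r] unfolding K_def u(1) by (metis (mono_tags, lifting) mem_Collect_eq scaleR_add_right)
    fix v assume "v \<in> K"
    then obtain \<xi>' \<eta>' where v: "v = \<xi>' + \<eta>'" "(\<xi>', \<eta>') \<in> a" unfolding K_def by blast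
    have "u + v = (\<xi> + \<xi>') + (\<eta> + \<eta>')" by (simp add: u v)
    then show "u + v \<in> K" using aD(2)[OF u(2) v(2)] unfolding K_def by blast
  qed
  have est: "(norm (fst p))\<^sup>2 + (norm (snd p))\<^sup>2 \<le> (norm (fst p + snd p))\<^sup>2" if "p \<in> a" for p
    using possa_pos[of "fst p" "snd p"] that
    by (simp add: power2_norm_eq_inner inner_add inner_commute)
  have "closed K"
    unfolding closed_sequential_limits
  proof (intro allI impI, elim conjE)
    fix u l assume "\<forall>n. u n \<in> K" and l: "u \<longlonglongrightarrow> l"
    then have "\<forall>n. \<exists>p. p \<in> a \<and> u n = fst p + snd p" unfolding K_def by fastforce
    then obtain p where p: "\<And>n. p n \<in> a" "\<And>n. u n = fst (p n) + snd (p n)" by metis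
    have "Cauchy p"
    proof (rule CauchyI)
      fix e :: real assume "e > 0"
      then obtain N where N: "\<And>m n. m \<ge> N \<Longrightarrow> n \<ge> N \<Longrightarrow> norm (u m - u n) < e"
        using LIMSEQ_imp_Cauchy[OF l] unfolding Cauchy_iff by blast
      have "norm (p m - p n) < e" if "m \<ge> N" "n \<ge> N" for m n
      proof -
        have "p m - p n \<in> a"
          using aD(5)[of "fst (p m)" "snd (p m)" "fst (p n)" "snd (p n)"] p(1) by (simp add: minus_prod_def)
        from est[OF this] have "(norm (p m - p n))\<^sup>2 \<le> (norm (u m - u n))\<^sup>2"
          by (simp add: norm_prod_def p(2) algebra_simps)
        then have "norm (p m - p n) \<le> norm (u m - u n)" by (rule power2_le_imp_le) simp
        then show ?thesis using N[OF that] by simp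
      qed
      then show "\<exists>M. \<forall>m\<ge>M. \<forall>n\<ge>M. norm (p m - p n) < e" by blast
    qed
    then obtain q where q: "p \<longlonglongrightarrow> q" using Cauchy_convergent convergentD by blast
    have "q \<in> a" using possa_closed p(1) q closed_sequentially by blast
    moreover have "u \<longlonglongrightarrow> fst q + snd q"
      unfolding p(2) by (intro tendsto_intros q)
    then have "l = fst q + snd q" using l LIMSEQ_unique by blast
    ultimately show "l \<in> K" unfolding K_def by (metis (mono_tags, lifting) mem_Collect_eq prod.collapse)
  qed
  note K = sub this
  define v where "v = \<zeta> - oproj K \<zeta>"
  have "(v, - v) \<in> a"
  proof (rule possa_I)
    fix \<xi>' \<eta>' assume "(\<xi>', \<eta>') \<in> a"
    then have "\<xi>' + \<eta>' \<in> K" unfolding K_def by blast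
    from oproj_orthogonal[OF K this, of \<zeta>] show "inner \<xi>' (- v) = inner \<eta>' v"
      by (simp add: v_def[symmetric] inner_add inner_commute)
  qed
  from possa_pos[OF this] have "inner v v \<le> 0" by simp
  then have "v = 0" by (metis inner_gt_zero_iff not_less)
  then have "\<zeta> \<in> K" using oproj_in[OF K, of \<zeta>] by (simp add: v_def)
  then obtain \<xi> \<eta> where "\<zeta> = \<xi> + \<eta>" "(\<xi>, \<eta>) \<in> a" unfolding K_def by blast
  then show ?thesis by (intro exI[of _ \<xi>]) simp
qed

lemma possa_resolvent: "\<exists>R. resolvent_of a R"
proof (rule resolvent_exists[OF possa_graph_subspace possa_range_one_plus])
  fix \<xi> \<eta> \<xi>' \<eta>' assume 1: "(\<xi>, \<eta>) \<in> a"
  then show "0 \<le> inner \<xi> \<eta>" by (subst inner_commute) (rule possa_pos)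
  assume "(\<xi>', \<eta>') \<in> a"
  with 1 show "inner \<xi> \<eta>' = inner \<eta> \<xi>'" by (rule possa_sym)
next
  fix \<eta> assume "(0, \<eta>) \<in> a"
  then show "\<eta> = 0" using possa_sv graph_subspaceD(1)[OF possa_graph_subspace] by blast
qed

end

text \<open>If \<open>R = (1 + b)\<^sup>-\<^sup>1\<close>, then \<open>b\<^sup>1\<^sup>/\<^sup>2 = C S\<^sup>-\<^sup>1\<close> for \<open>S = R\<^sup>1\<^sup>/\<^sup>2\<close> and \<open>C = (1 - R)\<^sup>1\<^sup>/\<^sup>2\<close>.\<close>

lemma square_root_exists:
  fixes b :: "'h::complex_hilbert_space uop"
  assumes R: "resolvent_of b R"
  shows "\<exists>a. positive_selfadjoint a \<and> a O a = b"
proof -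
  interpret R: positive_contraction R using R by (simp add: resolvent_of_def)
  have bR: "bounded_clinear R" and inj: "\<And>x. R x = 0 \<Longrightarrow> x = 0" and b: "b = {(R \<zeta>, \<zeta> - R \<zeta>) | \<zeta>. True}"
    using R unfolding resolvent_of_def by blast+
  have s: "bfun sqrt" by (rule bfun_continuous) (auto intro!: continuous_intros)
  have c: "bfun (\<lambda>t. sqrt (1 - t))" by (rule bfun_continuous) (auto intro!: continuous_intros)
  define S where "S = R.fc sqrt"
  define C where "C = R.fc (\<lambda>t. sqrt (1 - t))"
  have "bounded_clinear (R.fc f)" if "bfun f" for f
    using R.bounded_linear_fc[OF that] R.fc_commute[OF that bounded_linear_scaleC]
      bounded_clinear_scaleC[OF bR] unfolding bounded_clinear_def by metis
  then have bS: "bounded_clinear S" and bC: "bounded_clinear C" using s c by (auto simp: S_def C_def)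
  note Ss = bounded_clinear_simps[OF bS] and Cs = bounded_clinear_simps[OF bC]
  have SS: "S (S x) = R x" for x
  proof -
    have "S (S x) = R.fc (\<lambda>t. sqrt t * sqrt t) x" unfolding S_def by (rule R.fc_mult[OF s s, symmetric])
    also have "\<dots> = R.fc (\<lambda>t. t) x" by (rule R.fc_cong[OF bfun_mult[OF s s]]) auto
    finally show ?thesis by (simp add: R.fc_id)
  qed
  have CC: "C (C x) = x - R x" for x
  proof -
    have "C (C x) = R.fc (\<lambda>t. sqrt (1 - t) * sqrt (1 - t)) x" unfolding C_def by (rule R.fc_mult[OF c c, symmetric])
    also have "\<dots> = R.fc (poly [:1, -1:]) x" by (rule R.fc_cong[OF bfun_mult[OF c c]]) auto
    finally show ?thesis by (simp add: R.fc_poly R.pop_1_minus_X)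
  qed
  have SC: "S (C x) = C (S x)" for x
  proof -
    have "S (C x) = R.fc (\<lambda>t. sqrt t * sqrt (1 - t)) x" unfolding S_def C_def by (rule R.fc_mult[OF s c, symmetric])
    also have "\<dots> = R.fc (\<lambda>t. sqrt (1 - t) * sqrt t) x" by (simp only: mult.commute)
    also have "\<dots> = C (S x)" unfolding S_def C_def by (rule R.fc_mult[OF c s])
    finally show ?thesis .
  qed
  have one: "S (S x) + C (C x) = x" for x by (simp add: SS CC)
  have Ssa: "inner (S x) y = inner x (S y)" and Csa: "inner (C x) y = inner x (C y)" for x y
    unfolding S_def C_def by (rule R.fc_selfadjoint[OF s] R.fc_selfadjoint[OF c])+
  have Sinj: "x = 0" if "S x = 0" for x using inj[of x] SS[of x] that by (simp add: Ss)
  \<comment> \<open>A product of positive operators need not be positive; this one is a nonnegative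
    function of \<open>R\<close>, integrated against a scalar measure.\<close>
  have SCpos: "0 \<le> inner (S (C x)) x" for x
  proof -
    have "inner (S (C x)) x = (\<integral>t. sqrt t * sqrt (1 - t) \<partial>R.spm x)"
      unfolding S_def C_def R.fc_mult[OF s c, symmetric] by (rule R.fc_inner[OF bfun_mult[OF s c]])
    also have "\<dots> \<ge> 0"
      by (rule integral_nonneg_AE) (use R.AE_spm_unit[of x] in \<open>eventually_elim, auto\<close>)
    finally show ?thesis .
  qed
  define a where "a = {(S \<eta>, C \<eta>) | \<eta>. True}"
  have ga: "graph_subspace a"
    unfolding graph_subspace_def
  proof (intro conjI allI impI)
    show "(0, 0) \<in> a" unfolding a_def using Ss(4) Cs(4) by force
  next
    fix \<xi> \<eta> \<xi>' \<eta>' assume "(\<xi>, \<eta>) \<in> a" "(\<xi>', \<eta>') \<in> a"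
    then obtain u v where "\<xi> = S u" "\<eta> = C u" "\<xi>' = S v" "\<eta>' = C v" unfolding a_def by blast
    then have "\<xi> + \<xi>' = S (u + v)" "\<eta> + \<eta>' = C (u + v)" by (simp_all add: Ss Cs)
    then show "(\<xi> + \<xi>', \<eta> + \<eta>') \<in> a" unfolding a_def by blast
  next
    fix c \<xi> \<eta> assume "(\<xi>, \<eta>) \<in> a"
    then obtain u where "\<xi> = S u" "\<eta> = C u" unfolding a_def by blast
    then have "c *\<^sub>C \<xi> = S (c *\<^sub>C u)" "c *\<^sub>C \<eta> = C (c *\<^sub>C u)" by (simp_all add: Ss Cs)
    then show "(c *\<^sub>C \<xi>, c *\<^sub>C \<eta>) \<in> a" unfolding a_def by blast
  qed
  have sa: "uop_adj a = a"
  proof (intro set_eqI iffI; clarify)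
    fix \<zeta> \<theta> assume "(\<zeta>, \<theta>) \<in> uop_adj a"
    then have "inner (C \<eta>) \<zeta> = inner (S \<eta>) \<theta>" for \<eta>
      using uop_adj_iff[OF ga, of \<zeta> \<theta>] unfolding a_def by blast
    then have "inner \<eta> (C \<zeta>) = inner \<eta> (S \<theta>)" for \<eta> by (simp add: Csa Ssa)
    then have eq: "C \<zeta> = S \<theta>" by (rule iffD1[OF vector_eq_ldot, OF allI])
    \<comment> \<open>\<open>S\<^sup>2 + C\<^sup>2 = 1\<close> suggests the witness: together with
      \<open>C \<zeta> = S \<theta>\<close> it gives \<open>S \<eta> = \<zeta>\<close> and
      \<open>C \<eta> = \<theta>\<close>.\<close>
    define \<eta> where "\<eta> = S \<zeta> + C \<theta>"
    have "S \<eta> = S (S \<zeta>) + C (C \<zeta>)" by (simp add: \<eta>_def Ss SC eq)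
    moreover have "C \<eta> = S (S \<theta>) + C (C \<theta>)" by (simp add: \<eta>_def Cs SC[symmetric] eq)
    ultimately show "(\<zeta>, \<theta>) \<in> a" using one unfolding a_def by auto
  next
    fix \<zeta> \<theta> assume "(\<zeta>, \<theta>) \<in> a"
    then obtain u where u: "\<zeta> = S u" "\<theta> = C u" unfolding a_def by blast
    show "(\<zeta>, \<theta>) \<in> uop_adj a"
      unfolding uop_adj_iff[OF ga]
    proof (intro allI impI)
      fix \<xi> \<xi>' assume "(\<xi>, \<xi>') \<in> a"
      then obtain v where "\<xi> = S v" "\<xi>' = C v" unfolding a_def by blast
      then show "inner \<xi>' \<zeta> = inner \<xi> \<theta>" by (simp add: u Csa Ssa SC)
    qed
  qed
  have "positive_selfadjoint a"
    unfolding positive_selfadjoint_def closed_densely_defined_def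
  proof (intro conjI sa)
    show "single_valued a"
    proof (rule single_valuedI)
      fix \<xi> \<eta> \<eta>' assume "(\<xi>, \<eta>) \<in> a" "(\<xi>, \<eta>') \<in> a"
      then obtain u v where uv: "\<xi> = S u" "\<eta> = C u" "\<xi> = S v" "\<eta>' = C v" unfolding a_def by blast
      then have "S (u - v) = 0" by (simp add: Ss)
      then have "u - v = 0" by (rule Sinj)
      then show "\<eta> = \<eta>'" using uv by simp
    qed
    show "closed a" using closed_uop_adj[OF ga] sa by simp
    have "closure (range S) = UNIV"
      by (rule densely_definedI[OF bounded_linear.linear[OF bounded_clinear_linear[OF bS]] Ssa Sinj])
    moreover have "Domain a = range S" unfolding a_def by auto
    ultimately show "closure (Domain a) = UNIV" by simp
    show "\<forall>(\<xi>, \<eta>)\<in>a. 0 \<le> Re (cinner \<eta> \<xi>)"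
    proof (clarify)
      fix \<xi> \<eta> assume "(\<xi>, \<eta>) \<in> a"
      then obtain u where "\<xi> = S u" "\<eta> = C u" unfolding a_def by blast
      then show "0 \<le> Re (cinner \<eta> \<xi>)" using SCpos[of u] by (simp add: Re_cinner Ssa)
    qed
  qed (use graph_subspaceD[OF ga] in blast)+
  moreover have "a O a = b"
  proof (intro set_eqI iffI; clarify)
    fix \<xi> \<eta> \<theta> assume "(\<xi>, \<eta>) \<in> a" "(\<eta>, \<theta>) \<in> a"
    then obtain u v where uv: "\<xi> = S u" "\<eta> = C u" "\<eta> = S v" "\<theta> = C v" unfolding a_def by blast
    \<comment> \<open>The same combination as in the proof of self-adjointness; now
      \<open>S v = C u\<close> yields \<open>R \<zeta> = \<xi>\<close>.\<close>
    define \<zeta> where "\<zeta> = S u + C v"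
    have "R \<zeta> = S (S (S u)) + C (S (S v))" by (simp add: \<zeta>_def SS[symmetric] Ss SC)
    also have "\<dots> = S (S (S u)) + C (C (S u))" using uv by (simp only: SC[symmetric])
    also have "\<dots> = \<xi>" using one[of "S u"] uv(1) by (simp only:)
    finally have 1: "R \<zeta> = \<xi>" .
    have "\<zeta> - R \<zeta> = \<theta>" unfolding 1 by (simp add: uv \<zeta>_def)
    then show "(\<xi>, \<theta>) \<in> b" unfolding b using 1 by auto
  next
    fix \<xi> \<theta> assume "(\<xi>, \<theta>) \<in> b"
    then obtain \<zeta> where z: "\<xi> = R \<zeta>" "\<theta> = \<zeta> - R \<zeta>" unfolding b by blast
    have "(S (S \<zeta>), C (S \<zeta>)) \<in> a" "(S (C \<zeta>), C (C \<zeta>)) \<in> a" unfolding a_def by blast+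
    then show "(\<xi>, \<theta>) \<in> a O a" unfolding z SS CC SC by blast
  qed
  ultimately show ?thesis by blast
qed

section \<open>The spectral theorem for positive self-adjoint operators\<close>

locale pvm =
  fixes E :: "real set \<Rightarrow> 'h::complex_hilbert_space op"
  assumes pvm: "projection_valued_measure E"
begin

lemma proj: "B \<in> sets borel \<Longrightarrow> projection (E B)"
  and E_UNIV: "E UNIV x = x"
  and E_sums: "range A \<subseteq> sets borel \<Longrightarrow> disjoint_family A \<Longrightarrow> (\<lambda>n. E (A n) x) sums E (\<Union>n. A n) x"
  for A :: "nat \<Rightarrow> real set"
  using pvm unfolding projection_valued_measure_def by auto

lemma E_simps:
  assumes "B \<in> sets borel"
  shows "E B (x + y) = E B x + E B y" "E B (x - y) = E B x - E B y" "E B 0 = 0"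
    "E B (r *\<^sub>R x) = r *\<^sub>R E B x" "E B (E B x) = E B x"
    "inner (E B x) y = inner x (E B y)"
  using bounded_clinear_simps[OF projectionD(1)[OF proj[OF assms]]] projectionD(2,3)[OF proj[OF assms]]
  by blast+

lemma E_empty: "E {} x = 0"
proof -
  have "(\<lambda>n::nat. E {} x) sums E (\<Union>n::nat. {}) x" by (rule E_sums) (auto simp: disjoint_family_on_def)
  then have "(\<lambda>n::nat. E {} x) \<longlonglongrightarrow> 0" using summable_LIMSEQ_zero sums_summable by blast
  then show ?thesis by (simp add: LIMSEQ_const_iff)
qed

lemma E_Un:
  assumes "A \<in> sets borel" "B \<in> sets borel" "A \<inter> B = {}"
  shows "E (A \<union> B) x = E A x + E B x"
proof -
  have "(\<lambda>n. E (binaryset A B n) x) sums E (\<Union>n. binaryset A B n) x"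
    using assms by (intro E_sums) (auto simp: range_binaryset_eq disjoint_family_on_def binaryset_def)
  moreover have "(\<lambda>n. E (binaryset A B n) x) sums (E A x + E B x)"
    by (rule binaryset_sums) (rule E_empty)
  ultimately show ?thesis unfolding UN_binaryset_eq by (rule sums_unique2)
qed

lemma E_compl: "B \<in> sets borel \<Longrightarrow> E (- B) x = x - E B x"
  using E_Un[of B "- B" x] by (simp add: E_UNIV) (metis add_diff_cancel_left')

text \<open>Multiplicativity has to come from additivity: at \<open>y = E B x\<close> the projection
  for \<open>A \<union> B\<close> has quadratic form
  \<open>(norm (E A y))\<^sup>2 + (norm y)\<^sup>2\<close>, yet it is a contraction.\<close>

lemma E_disjoint:
  assumes "A \<in> sets borel" "B \<in> sets borel" "A \<inter> B = {}"
  shows "E A (E B x) = 0"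
proof -
  let ?y = "E B x"
  have "(norm ?y)\<^sup>2 \<ge> inner (E (A \<union> B) ?y) ?y"
    using projection_norm_sq[OF proj, of "A \<union> B" ?y] power_mono[OF projection_norm_le[OF proj, of "A \<union> B" ?y], of 2]
      assms by simp
  also have "inner (E (A \<union> B) ?y) ?y = (norm (E A ?y))\<^sup>2 + (norm ?y)\<^sup>2"
    using projection_norm_sq[OF proj[OF assms(1)], of ?y] assms
    by (simp add: E_Un inner_add E_simps(5) power2_norm_eq_inner)
  finally show ?thesis by simp
qed

lemma E_Int:
  assumes "A \<in> sets borel" "B \<in> sets borel"
  shows "E A (E B x) = E (A \<inter> B) x"
proof -
  have split: "E C y = E (C \<inter> D) y + E (C - D) y" if "C \<in> sets borel" "D \<in> sets borel" for C D y
  proof -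
    have "E ((C \<inter> D) \<union> (C - D)) y = E (C \<inter> D) y + E (C - D) y"
      by (rule E_Un) (use that in auto)
    then show ?thesis by (simp add: Int_Diff_Un)
  qed
  note A = split[OF assms]
  have "E B x = E (A \<inter> B) x + E (B - A) x" using split[OF assms(2,1), of x] by (simp add: Int_commute)
  moreover have "E (A - B) (E B x) = 0" using assms by (intro E_disjoint) auto
  moreover have "E (A \<inter> B) (E (B - A) x) = 0" using assms by (intro E_disjoint) auto
  ultimately show ?thesis using A[of "E B x"] assms by (simp add: E_simps)
qed

lemma sets_sm [simp, measurable_cong]: "sets (scalar_measure E \<xi>) = sets borel"
  and space_sm [simp]: "space (scalar_measure E \<xi>) = UNIV"
  using sets.sigma_sets_eq[of "borel :: real measure"]
  by (simp_all add: scalar_measure_def sets_measure_of space_measure_of)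

text \<open>\<open>measure_of\<close> yields the intended values only for a countably additive set
  function, so the strong additivity of \<open>E\<close> is passed on to the quadratic
  forms.\<close>

lemma emeasure_sm:
  assumes "B \<in> sets borel"
  shows "emeasure (scalar_measure E \<xi>) B = ennreal (inner (E B \<xi>) \<xi>)"
proof -
  have "emeasure (scalar_measure E \<xi>) B = ennreal (Re (cinner (E B \<xi>) \<xi>))"
  proof (rule emeasure_measure_of[OF scalar_measure_def])
    show "positive (sets (scalar_measure E \<xi>)) (\<lambda>B. ennreal (Re (cinner (E B \<xi>) \<xi>)))"
      by (simp add: positive_def E_empty)
    show "countably_additive (sets (scalar_measure E \<xi>)) (\<lambda>B. ennreal (Re (cinner (E B \<xi>) \<xi>)))"
    proof (rule countably_additiveI)
      fix A :: "nat \<Rightarrow> real set"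
      assume A: "range A \<subseteq> sets (scalar_measure E \<xi>)" "disjoint_family A"
      then have b: "A i \<in> sets borel" "(\<Union>i. A i) \<in> sets borel" for i by auto
      have "(\<lambda>n. inner (E (A n) \<xi>) \<xi>) sums inner (E (\<Union>n. A n) \<xi>) \<xi>"
        using bounded_linear.sums[OF bounded_linear_inner_left E_sums[of A \<xi>]] A by simp
      then have "(\<lambda>n. ennreal (inner (E (A n) \<xi>) \<xi>)) sums ennreal (inner (E (\<Union>n. A n) \<xi>) \<xi>)"
        using b by (subst sums_ennreal) (simp_all flip: projection_norm_sq[OF proj])
      then show "(\<Sum>i. ennreal (Re (cinner (E (A i) \<xi>) \<xi>))) = ennreal (Re (cinner (E (\<Union> (range A)) \<xi>) \<xi>))"
        by (simp add: Re_cinner sums_iff)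
    qed
  qed (use assms sets.space_closed[of "borel :: real measure"] in auto)
  then show ?thesis by (simp add: Re_cinner)
qed

lemma finite_measure_sm: "finite_measure (scalar_measure E \<xi>)"
  by (rule finite_measureI) (simp add: emeasure_sm)

lemma emeasure_sm_eq_0: "B \<in> sets borel \<Longrightarrow> emeasure (scalar_measure E \<xi>) B = 0 \<longleftrightarrow> E B \<xi> = 0"
  by (simp add: emeasure_sm flip: projection_norm_sq[OF proj])

lemma measure_sm_UNIV: "measure (scalar_measure E \<xi>) UNIV = inner \<xi> \<xi>"
  by (simp add: measure_def emeasure_sm E_UNIV)

lemma AE_sm:
  assumes "A \<in> sets borel" "E A \<xi> = \<xi>"
  shows "AE t in scalar_measure E \<xi>. t \<in> A"
proof (rule AE_I)
  show "emeasure (scalar_measure E \<xi>) (- A) = 0"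
    using assms by (subst emeasure_sm_eq_0) (auto simp: E_compl)
qed (use assms in auto)

lemma sm_restrict:
  assumes A: "A \<in> sets borel"
  shows "scalar_measure E (E A \<xi>) = density (scalar_measure E \<xi>) (\<lambda>t. ennreal (indicator A t))"
proof (rule measure_eqI)
  fix B assume "B \<in> sets (scalar_measure E (E A \<xi>))"
  then have B: "B \<in> sets borel" by simp
  have "inner (E B (E A \<xi>)) (E A \<xi>) = inner (E (A \<inter> B) \<xi>) \<xi>"
  proof -
    have "inner (E B (E A \<xi>)) (E A \<xi>) = inner (E A (E B (E A \<xi>))) \<xi>" by (simp add: E_simps(6)[OF A])
    also have "E A (E B (E A \<xi>)) = E (A \<inter> B) \<xi>" using A B by (simp add: E_Int Int_ac)
    finally show ?thesis .
  qed
  moreover have "(\<integral>\<^sup>+ t. ennreal (indicator A t) * indicator B t \<partial>scalar_measure E \<xi>)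
      = emeasure (scalar_measure E \<xi>) (A \<inter> B)"
  proof -
    have "(\<integral>\<^sup>+ t. ennreal (indicator A t) * indicator B t \<partial>scalar_measure E \<xi>)
        = (\<integral>\<^sup>+ t. indicator (A \<inter> B) t \<partial>scalar_measure E \<xi>)"
      by (intro nn_integral_cong) (auto simp: indicator_def)
    then show ?thesis using A B by simp
  qed
  ultimately show "emeasure (scalar_measure E (E A \<xi>)) B
      = emeasure (density (scalar_measure E \<xi>) (\<lambda>t. ennreal (indicator A t))) B"
    using A B by (simp add: emeasure_sm emeasure_density)
qed simp

lemma E_UN_eq_0:
  assumes "range A \<subseteq> sets borel" "\<And>n. E (A n) \<xi> = 0"
  shows "E (\<Union>n::nat. A n) \<xi> = 0"
proof -
  have "A n \<in> null_sets (scalar_measure E \<xi>)" for n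
    using assms by (auto simp: null_sets_def emeasure_sm_eq_0)
  then have "(\<Union>n. A n) \<in> null_sets (scalar_measure E \<xi>)" by blast
  then show ?thesis using assms(1) by (auto simp: null_sets_def emeasure_sm_eq_0)
qed

lemma E_subset_eq_0:
  assumes "A \<subseteq> B" "A \<in> sets borel" "B \<in> sets borel" "E B \<xi> = 0"
  shows "E A \<xi> = 0"
proof -
  have "E A \<xi> = E A (E B \<xi>)" using E_Int[of A B \<xi>] assms(1-3) by (simp only: inf_absorb1)
  then show ?thesis using assms by (simp add: E_simps)
qed

end

lemma cinner_selfadjoint_real:
  fixes A :: "'h::complex_hilbert_space op"
  assumes "bounded_clinear A" "\<And>x y. inner (A x) y = inner x (A y)"
  shows "cinner (A x) x = of_real (inner (A x) x)"
proof -
  have "cinner (A x) x = cinner x (A x)"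
    by (rule clinear_adjoint) (use assms in \<open>auto simp: bounded_clinear_simps\<close>)
  then have "cinner (A x) x = cnj (cinner (A x) x)" by (subst cinner_commute[symmetric])
  then have "Im (cinner (A x) x) = 0" by (simp add: complex_eq_iff)
  then show ?thesis by (simp add: complex_eq_iff Re_cinner)
qed

text \<open>With \<open>R\<close> the resolvent, \<open>a = 1 / R - 1\<close>, so the spectral
  measure of \<open>a\<close> is the image of that of \<open>R\<close> under \<open>h\<close>. The
  delicate point is the domain: membership in the range of \<open>R\<close> has to be recovered from
  a finite second moment.\<close>

theorem spectral_measure_exists:
  fixes a :: "'h::complex_hilbert_space uop"
  assumes a: "positive_selfadjoint a"
  shows "\<exists>E. has_spectral_measure a E"
proof -
  obtain R where R: "resolvent_of a R" using possa_resolvent[OF a] by blast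
  interpret R: positive_contraction R using R by (simp add: resolvent_of_def)
  have bR: "bounded_clinear R" and inj: "\<And>x. R x = 0 \<Longrightarrow> x = 0" and b: "a = {(R \<zeta>, \<zeta> - R \<zeta>) | \<zeta>. True}"
    using R unfolding resolvent_of_def by blast+
  note Rs = bounded_clinear_simps[OF bR]
  \<comment> \<open>Division by zero gives \<open>h 0 = -1\<close>, a harmless value, since
    \<open>zero\<close> below shows that the measures do not charge the point 0.\<close>
  define h :: "real \<Rightarrow> real" where "h r = 1 / r - 1" for r
  have hm [measurable]: "h \<in> borel_measurable borel" unfolding h_def by measurable
  have hB: "h -` B \<in> sets borel" if "B \<in> sets borel" for B
    using measurable_sets[OF hm that] by simp
  define E where "E B = R.sp (h -` B)" for B
  have sp: "R.is_sp (h -` B) (E B)" if "B \<in> sets borel" for B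
    unfolding E_def by (rule R.is_sp_sp[OF hB[OF that]])
  have inner_E: "inner (E B x) x = measure (R.spm x) (h -` B)" if "B \<in> sets borel" for B x
    using sp[OF that] unfolding R.is_sp_def by blast
  interpret pvm E
  proof
    show "projection_valued_measure E"
      unfolding projection_valued_measure_def
    proof (intro conjI ballI allI impI)
      fix B :: "real set" assume B: "B \<in> sets borel"
      have "c *\<^sub>C E B x = E B (c *\<^sub>C x)" for c x
        using sp[OF B] bounded_linear_scaleC[of c] unfolding R.is_sp_def by (metis Rs(6))
      then show "projection (E B)"
        using sp[OF B] unfolding projection_iff bounded_clinear_def R.is_sp_def by simp
    next
      have "R.is_sp UNIV (\<lambda>x. x)" by (simp add: R.is_sp_def R.measure_spm_UNIV)
      then show "E UNIV = id" unfolding E_def by (auto simp: R.sp_eqI id_def)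
    next
      fix A :: "nat \<Rightarrow> real set" and \<xi>
      assume A: "range A \<subseteq> sets borel \<and> disjoint_family A"
      then have "disjoint_family (\<lambda>n. h -` A n)" unfolding disjoint_family_on_def by blast
      then have "(\<lambda>n. R.sp (h -` A n) \<xi>) sums R.sp (\<Union>n. h -` A n) \<xi>"
        by (rule R.sp_sums) (use A hB in auto)
      then show "(\<lambda>n. E (A n) \<xi>) sums E (\<Union> (range A)) \<xi>" by (simp add: E_def vimage_UN)
    qed
  qed
  have sm: "scalar_measure E \<xi> = distr (R.spm \<xi>) borel h" for \<xi>
  proof (rule measure_eqI)
    fix B assume "B \<in> sets (scalar_measure E \<xi>)"
    then have B: "B \<in> sets borel" by simp
    then show "emeasure (scalar_measure E \<xi>) B = emeasure (distr (R.spm \<xi>) borel h) B"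
      by (simp add: emeasure_sm inner_E emeasure_distr finite_measure.emeasure_eq_measure[OF R.finite_measure_spm])
  qed simp
  \<comment> \<open>Domain vectors have the form \<open>R \<eta>\<close>, and applying
    \<open>R\<close> multiplies the scalar measure by \<open>r\<^sup>2\<close>; this turns the
    integrals of \<open>h\<close> and \<open>h\<^sup>2\<close> into integrals of
    polynomials.\<close>
  have spmR: "R.spm (R \<eta>) = density (R.spm \<eta>) (\<lambda>r. ennreal (r\<^sup>2))" for \<eta>
  proof (rule R.spm_eqI)
    interpret finite_measure "R.spm \<eta>" by (rule R.finite_measure_spm)
    have "(\<integral>\<^sup>+ r. ennreal (r\<^sup>2) \<partial>R.spm \<eta>) \<le> (\<integral>\<^sup>+ r. 1 \<partial>R.spm \<eta>)"
      by (rule nn_integral_mono_AE) (use R.AE_spm_unit[of \<eta>] in \<open>eventually_elim, auto simp: power_le_one\<close>)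
    also have "\<dots> < \<infinity>" by (simp add: emeasure_eq_measure less_top[symmetric])
    finally have "finite_measure (density (R.spm \<eta>) (\<lambda>r. ennreal (r\<^sup>2)))"
      by (intro finite_measureI) (simp add: emeasure_density)
    then show "unit_measure (density (R.spm \<eta>) (\<lambda>r. ennreal (r\<^sup>2)))"
      using R.AE_spm_unit[of \<eta>] by (auto simp: unit_measure_def AE_density)
    show "(\<integral>t. poly p t \<partial>density (R.spm \<eta>) (\<lambda>r. ennreal (r\<^sup>2))) = inner (pop R p (R \<eta>)) (R \<eta>)" for p
    proof -
      have "(\<integral>t. poly p t \<partial>density (R.spm \<eta>) (\<lambda>r. ennreal (r\<^sup>2))) = (\<integral>t. poly ([:0, 1:] * (p * [:0, 1:])) t \<partial>R.spm \<eta>)"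
      proof -
        have "poly ([:0, 1:] * (p * [:0, 1:])) = (\<lambda>t. t\<^sup>2 * poly p t)"
          by (simp add: fun_eq_iff power2_eq_square)
        then show ?thesis by (simp only:) (subst integral_density, auto)
      qed
      also have "\<dots> = inner (R (pop R p (R \<eta>))) \<eta>"
        unfolding R.integral_poly_spm pop_mult[OF R.linear_T] R.pop_X ..
      finally show ?thesis by (simp add: R.selfadjoint)
    qed
  qed
  \<comment> \<open>\<open>R\<close> annihilates the part of a vector that belongs to the spectral
    point 0, and \<open>R\<close> is injective.\<close>
  have zero: "AE r in R.spm \<xi>. 0 < r" for \<xi>
  proof -
    let ?f = "\<lambda>r. 1 - indicator {0<..} r :: real"
    have f: "bfun ?f" by (rule bfun_diff[OF bfun_const bfun_greaterThan])
    have "R (R.fc ?f \<xi>) = R.fc (\<lambda>r. r * ?f r) \<xi>"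
      using R.fc_mult[OF bfun_id f, of \<xi>] by (simp add: R.fc_id)
    also have "\<dots> = R.fc (\<lambda>_. 0) \<xi>"
      by (rule R.fc_cong[OF bfun_mult[OF bfun_id f]]) (auto simp: indicator_def)
    finally have "R (R.fc ?f \<xi>) = 0" by (simp add: R.fc_const)
    then have "R.fc ?f \<xi> = 0" by (rule inj)
    then have "(\<integral>r. ?f r \<partial>R.spm \<xi>) = 0" using R.fc_inner[OF f, of \<xi>] by simp
    then have "AE r in R.spm \<xi>. ?f r = 0"
      by (subst (asm) integral_nonneg_eq_0_iff_AE[OF R.bfun_integrable[OF f]]) (auto simp: indicator_def)
    then show ?thesis by eventually_elim (auto simp: indicator_def split: if_splits)
  qed
  have dom1: "(\<integral>\<^sup>+ t. ennreal (t\<^sup>2) \<partial>scalar_measure E (R \<eta>)) < \<infinity>" for \<eta>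
  proof -
    interpret finite_measure "R.spm \<eta>" by (rule R.finite_measure_spm)
    have "(\<integral>\<^sup>+ t. ennreal (t\<^sup>2) \<partial>scalar_measure E (R \<eta>)) = (\<integral>\<^sup>+ r. ennreal (r\<^sup>2) * ennreal ((h r)\<^sup>2) \<partial>R.spm \<eta>)"
      unfolding sm spmR by (subst nn_integral_distr) (auto simp: nn_integral_density)
    also have "\<dots> \<le> (\<integral>\<^sup>+ r. 1 \<partial>R.spm \<eta>)"
    proof (rule nn_integral_mono_AE)
      show "AE r in R.spm \<eta>. ennreal (r\<^sup>2) * ennreal ((h r)\<^sup>2) \<le> 1"
        using R.AE_spm_unit[of \<eta>] zero[of \<eta>]
      proof eventually_elim
        fix r :: real assume r: "r \<in> {0..1}" "0 < r"
        then have "r * h r = 1 - r" by (simp add: h_def field_simps)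
        then have "r\<^sup>2 * (h r)\<^sup>2 = (1 - r)\<^sup>2" by (metis power_mult_distrib)
        also have "\<dots> \<le> 1" using r by (auto intro: power_le_one)
        finally show "ennreal (r\<^sup>2) * ennreal ((h r)\<^sup>2) \<le> 1" by (simp flip: ennreal_mult)
      qed
    qed
    also have "\<dots> < \<infinity>" by (simp add: emeasure_eq_measure less_top[symmetric])
    finally show ?thesis .
  qed
  \<comment> \<open>A preimage of \<open>\<xi>\<close> should be \<open>g(R) \<xi>\<close> with the
    unbounded function \<open>g r = 1 / r\<close>. The finite second moment makes \<open>g\<close>
    square integrable, so its truncations \<open>f n\<close> yield a Cauchy sequence
    \<open>\<eta>\<close>, whose limit is mapped to \<open>\<xi>\<close> by
    \<open>R\<close>.\<close>
  have dom2: "\<xi> \<in> range R" if fin: "(\<integral>\<^sup>+ t. ennreal (t\<^sup>2) \<partial>scalar_measure E \<xi>) < \<infinity>" for \<xi>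
  proof -
    interpret finite_measure "R.spm \<xi>" by (rule R.finite_measure_spm)
    have "(\<integral>\<^sup>+ r. ennreal ((h r)\<^sup>2) \<partial>R.spm \<xi>) < \<infinity>"
      using fin unfolding sm by (subst (asm) nn_integral_distr) auto
    then have hint: "integrable (R.spm \<xi>) (\<lambda>r. (h r)\<^sup>2)" by (intro integrableI_bounded) auto
    define g :: "real \<Rightarrow> real" where "g r = 1 / r" for r
    have gm [measurable]: "g \<in> borel_measurable borel" unfolding g_def by measurable
    have gint: "integrable (R.spm \<xi>) (\<lambda>r. (g r)\<^sup>2)"
    proof (rule Bochner_Integration.integrable_bound)
      show "integrable (R.spm \<xi>) (\<lambda>r. 2 * (h r)\<^sup>2 + 2)" using hint by simp
      have "(g r)\<^sup>2 \<le> 2 * (h r)\<^sup>2 + 2" for r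
      proof -
        \<comment> \<open>As \<open>h = g - 1\<close>, the two sides of the desired bound differ by
          exactly this square.\<close>
        have "0 \<le> (g r - 2)\<^sup>2" by simp
        then show ?thesis by (simp add: h_def g_def[symmetric] power2_eq_square algebra_simps)
      qed
      then show "AE r in R.spm \<xi>. norm ((g r)\<^sup>2) \<le> norm (2 * (h r)\<^sup>2 + 2)"
        by (intro AE_I2) (auto intro: order_trans)
    qed simp
    \<comment> \<open>The maximum keeps the second factor continuous on [0,1], so that
      \<open>f n\<close> is admissible for the calculus; where the indicator is 1 it changes
      nothing.\<close>
    define f where "f n r = indicator {inverse (real (Suc n))<..} r * (1 / max r (inverse (real (Suc n))))" for n r
    have f: "bfun (f n)" for n
      unfolding f_def
    proof (intro bfun_mult bfun_greaterThan bfun_continuous)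
      show "continuous_on {0..1} (\<lambda>t. 1 / max t (inverse (real (Suc n))))"
        by (intro continuous_intros) (auto simp: max_def)
    qed measurable
    have f_eq: "f n r = (if inverse (real (Suc n)) < r then g r else 0)" for n r
      by (auto simp: f_def g_def max_def indicator_def)
    have ev: "\<exists>N. \<forall>n\<ge>N. f n r = g r" if r: "0 < r" for r
    proof -
      obtain N where N: "inverse (real (Suc N)) < r" using reals_Archimedean[OF r] by blast
      have "f n r = g r" if "n \<ge> N" for n
      proof -
        have "inverse (real (Suc n)) \<le> inverse (real (Suc N))" using that by (simp add: field_simps)
        then have "inverse (real (Suc n)) < r" using N by (rule le_less_trans)
        then show ?thesis by (simp only: f_eq if_True)
      qed
      then show ?thesis by blast
    qed
    have "(\<lambda>n. \<integral>r. (f n r - g r)\<^sup>2 \<partial>R.spm \<xi>) \<longlonglongrightarrow> (\<integral>r. 0 \<partial>R.spm \<xi>)"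
    proof (rule integral_dominated_convergence[where w = "\<lambda>r. (g r)\<^sup>2"])
      show "AE r in R.spm \<xi>. (\<lambda>n. (f n r - g r)\<^sup>2) \<longlonglongrightarrow> 0"
        using zero[of \<xi>]
      proof eventually_elim
        fix r :: real assume "0 < r"
        then obtain N where "\<forall>n\<ge>N. f n r = g r" using ev by blast
        then have "\<forall>\<^sub>F n in sequentially. (f n r - g r)\<^sup>2 = 0" by (auto simp: eventually_sequentially)
        then show "(\<lambda>n. (f n r - g r)\<^sup>2) \<longlonglongrightarrow> 0" by (rule tendsto_eventually)
      qed
      show "(\<lambda>r. (f n r - g r)\<^sup>2) \<in> borel_measurable (R.spm \<xi>)" for n
        using bfun_measurable[OF f[of n]] by measurable
    qed (use gint in \<open>auto simp: f_eq\<close>)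
    then have lim: "(\<lambda>n. \<integral>r. (f n r - g r)\<^sup>2 \<partial>R.spm \<xi>) \<longlonglongrightarrow> 0" by simp
    have dint: "integrable (R.spm \<xi>) (\<lambda>r. (f n r - g r)\<^sup>2)" for n
    proof (rule Bochner_Integration.integrable_bound[OF gint])
      show "(\<lambda>r. (f n r - g r)\<^sup>2) \<in> borel_measurable (R.spm \<xi>)"
        using bfun_measurable[OF f[of n]] by measurable
    qed (auto simp: f_eq)
    define \<eta> where "\<eta> n = R.fc (f n) \<xi>" for n
    have est: "(norm (\<eta> m - \<eta> n))\<^sup>2 \<le> 2 * (\<integral>r. (f m r - g r)\<^sup>2 \<partial>R.spm \<xi>) + 2 * (\<integral>r. (f n r - g r)\<^sup>2 \<partial>R.spm \<xi>)" for m n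
    proof -
      have "(norm (\<eta> m - \<eta> n))\<^sup>2 = (\<integral>r. (f m r - f n r)\<^sup>2 \<partial>R.spm \<xi>)"
        unfolding \<eta>_def R.fc_diff[OF f f, symmetric] by (rule R.norm_fc_sq[OF bfun_diff[OF f f]])
      also have "\<dots> \<le> (\<integral>r. 2 * (f m r - g r)\<^sup>2 + 2 * (f n r - g r)\<^sup>2 \<partial>R.spm \<xi>)"
      proof (rule integral_mono)
        show "(f m r - f n r)\<^sup>2 \<le> 2 * (f m r - g r)\<^sup>2 + 2 * (f n r - g r)\<^sup>2" for r
        proof -
          have "0 \<le> ((f m r - g r) + (f n r - g r))\<^sup>2" by simp
          then show ?thesis by (simp add: power2_eq_square algebra_simps)
        qed
      qed (use dint R.bfun_integrable[OF bfun_power2[OF bfun_diff[OF f f]]] in auto)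
      also have "\<dots> = 2 * (\<integral>r. (f m r - g r)\<^sup>2 \<partial>R.spm \<xi>) + 2 * (\<integral>r. (f n r - g r)\<^sup>2 \<partial>R.spm \<xi>)"
        using dint by simp
      finally show ?thesis .
    qed
    have "Cauchy \<eta>"
    proof (rule CauchyI)
      fix \<epsilon> :: real assume "\<epsilon> > 0"
      then have "\<forall>\<^sub>F n in sequentially. (\<integral>r. (f n r - g r)\<^sup>2 \<partial>R.spm \<xi>) < \<epsilon>\<^sup>2 / 4"
        using lim by (intro order_tendstoD) auto
      then obtain N where N: "\<And>n. n \<ge> N \<Longrightarrow> (\<integral>r. (f n r - g r)\<^sup>2 \<partial>R.spm \<xi>) < \<epsilon>\<^sup>2 / 4"
        by (auto simp: eventually_sequentially)
      have "norm (\<eta> m - \<eta> n) < \<epsilon>" if "m \<ge> N" "n \<ge> N" for m n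
      proof -
        have "(norm (\<eta> m - \<eta> n))\<^sup>2 < \<epsilon>\<^sup>2" using est[of m n] N[OF that(1)] N[OF that(2)] by linarith
        then show ?thesis by (rule power2_less_imp_less) (use \<open>\<epsilon> > 0\<close> in auto)
      qed
      then show "\<exists>M. \<forall>m\<ge>M. \<forall>n\<ge>M. norm (\<eta> m - \<eta> n) < \<epsilon>" by blast
    qed
    then obtain \<theta> where \<theta>: "\<eta> \<longlonglongrightarrow> \<theta>" using Cauchy_convergent convergentD by blast
    have "(\<lambda>n. \<integral>r. (1 - r * f n r)\<^sup>2 \<partial>R.spm \<xi>) \<longlonglongrightarrow> (\<integral>r. 0 \<partial>R.spm \<xi>)"
    proof (rule integral_dominated_convergence[where w = "\<lambda>r. 1"])
      show "AE r in R.spm \<xi>. (\<lambda>n. (1 - r * f n r)\<^sup>2) \<longlonglongrightarrow> 0"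
        using zero[of \<xi>]
      proof eventually_elim
        fix r :: real assume r: "0 < r"
        then obtain N where "\<forall>n\<ge>N. f n r = g r" using ev by blast
        then have "\<forall>n\<ge>N. (1 - r * f n r)\<^sup>2 = 0" using r by (simp add: g_def)
        then have "\<forall>\<^sub>F n in sequentially. (1 - r * f n r)\<^sup>2 = 0" unfolding eventually_sequentially by blast
        then show "(\<lambda>n. (1 - r * f n r)\<^sup>2) \<longlonglongrightarrow> 0" by (rule tendsto_eventually)
      qed
      show "AE r in R.spm \<xi>. norm ((1 - r * f n r)\<^sup>2) \<le> 1" for n
        using zero[of \<xi>] by eventually_elim (auto simp: f_eq g_def)
      show "(\<lambda>r. (1 - r * f n r)\<^sup>2) \<in> borel_measurable (R.spm \<xi>)" for n
        using bfun_measurable[OF f[of n]] by measurable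
    qed auto
    moreover have "(norm (\<xi> - R (\<eta> n)))\<^sup>2 = (\<integral>r. (1 - r * f n r)\<^sup>2 \<partial>R.spm \<xi>)" for n
    proof -
      have "\<xi> - R (\<eta> n) = R.fc (\<lambda>r. 1 - r * f n r) \<xi>"
        unfolding R.fc_diff[OF bfun_const bfun_mult[OF bfun_id f]] R.fc_mult[OF bfun_id f]
        by (simp add: R.fc_const R.fc_id \<eta>_def)
      then show ?thesis using R.norm_fc_sq[OF bfun_diff[OF bfun_const bfun_mult[OF bfun_id f]]] by simp
    qed
    ultimately have "(\<lambda>n. (norm (\<xi> - R (\<eta> n)))\<^sup>2) \<longlonglongrightarrow> 0" by simp
    moreover have "(\<lambda>n. (norm (\<xi> - R (\<eta> n)))\<^sup>2) \<longlonglongrightarrow> (norm (\<xi> - R \<theta>))\<^sup>2"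
      by (intro tendsto_intros R.tendsto \<theta>)
    ultimately have "(norm (\<xi> - R \<theta>))\<^sup>2 = 0" using LIMSEQ_unique by blast
    then have "\<xi> = R \<theta>" by simp
    then show ?thesis by blast
  qed
  have form: "cinner (\<eta> - R \<eta>) (R \<eta>) = of_real (\<integral>t. t \<partial>scalar_measure E (R \<eta>))" for \<eta>
  proof -
    have "(\<integral>t. t \<partial>scalar_measure E (R \<eta>)) = (\<integral>r. r\<^sup>2 * h r \<partial>R.spm \<eta>)"
      unfolding sm spmR by (subst integral_distr) (auto simp: integral_density)
    also have "\<dots> = (\<integral>r. poly ([:0, 1:] * [:1, -1:]) r \<partial>R.spm \<eta>)"
      by (rule Bochner_Integration.integral_cong) (auto simp: h_def power2_eq_square field_simps)
    also have "\<dots> = inner (R (\<eta> - R \<eta>)) \<eta>"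
      unfolding R.integral_poly_spm pop_mult[OF R.linear_T] R.pop_X R.pop_1_minus_X ..
    also have "\<dots> = inner (\<eta> - R \<eta>) (R \<eta>)" by (rule R.selfadjoint)
    finally have 1: "(\<integral>t. t \<partial>scalar_measure E (R \<eta>)) = inner (\<eta> - R \<eta>) (R \<eta>)" .
    have "cinner (R \<eta>) (\<eta> - R \<eta>) = cinner (R \<eta>) \<eta> - cinner (R \<eta>) (R \<eta>)"
      using cinner_add_right[of "R \<eta>" "\<eta> - R \<eta>" "R \<eta>"] by simp
    also have "\<dots> = of_real (inner (R \<eta>) \<eta> - inner (R \<eta>) (R \<eta>))"
      using cinner_selfadjoint_real[OF bR R.selfadjoint] by (simp add: cinner_self)
    finally have "cinner (\<eta> - R \<eta>) (R \<eta>) = cnj (of_real (inner (R \<eta>) \<eta> - inner (R \<eta>) (R \<eta>)))"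
      by (subst cinner_commute) simp
    then show ?thesis unfolding 1 by (simp add: inner_diff inner_commute)
  qed
  have "has_spectral_measure a E"
    unfolding has_spectral_measure_def
  proof (intro conjI pvm)
    have "Domain a = range R" unfolding b by auto
    then show "Domain a = {\<xi>. (\<integral>\<^sup>+ t. ennreal (t\<^sup>2) \<partial>scalar_measure E \<xi>) < \<infinity>}"
      using dom1 dom2 by auto
    show "\<forall>(\<xi>, \<eta>)\<in>a. cinner \<eta> \<xi> = of_real (\<integral>t. t \<partial>scalar_measure E \<xi>)"
      unfolding b using form by auto
  qed
  then show ?thesis by blast
qed

section \<open>Operators with an arbitrary spectral measure: growth estimates and uniqueness\<close>

locale spectral_op =
  fixes a :: "'h::complex_hilbert_space uop" and E :: "real set \<Rightarrow> 'h op"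
  assumes possa: "positive_selfadjoint a" and spectral: "has_spectral_measure a E"
begin

sublocale pvm E using spectral by unfold_locales (simp add: has_spectral_measure_def)

lemma domain_iff: "\<xi> \<in> Domain a \<longleftrightarrow> (\<integral>\<^sup>+ t. ennreal (t\<^sup>2) \<partial>scalar_measure E \<xi>) < \<infinity>"
  using spectral by (simp add: has_spectral_measure_def)

lemma form: "(\<xi>, \<eta>) \<in> a \<Longrightarrow> inner \<eta> \<xi> = (\<integral>t. t \<partial>scalar_measure E \<xi>)"
proof -
  assume "(\<xi>, \<eta>) \<in> a"
  then have "cinner \<eta> \<xi> = of_real (\<integral>t. t \<partial>scalar_measure E \<xi>)"
    using spectral by (auto simp: has_spectral_measure_def)
  then show ?thesis by (metis Re_cinner Re_complex_of_real)
qed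

lemmas aD = graph_subspaceD[OF possa_graph_subspace[OF possa]]

lemma integrable_sm:
  assumes "\<xi> \<in> Domain a" shows "integrable (scalar_measure E \<xi>) (\<lambda>t. t)"
proof (rule integrableI_bounded)
  interpret finite_measure "scalar_measure E \<xi>" by (rule finite_measure_sm)
  have "\<bar>t\<bar> \<le> 1 + t\<^sup>2" for t :: real
  proof -
    have "0 \<le> (\<bar>t\<bar> - 1)\<^sup>2" by simp
    then show ?thesis by (simp add: power2_eq_square algebra_simps)
  qed
  then have "(\<integral>\<^sup>+ t. norm t \<partial>scalar_measure E \<xi>) \<le> (\<integral>\<^sup>+ t. 1 + ennreal (t\<^sup>2) \<partial>scalar_measure E \<xi>)"
    by (intro nn_integral_mono) (metis ennreal_1 ennreal_leI ennreal_plus real_norm_def zero_le_one zero_le_power2)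
  also have "\<dots> < \<infinity>"
    using assms unfolding domain_iff
    by (subst nn_integral_add) (auto simp: emeasure_eq_measure less_top[symmetric])
  finally show "(\<integral>\<^sup>+ t. norm t \<partial>scalar_measure E \<xi>) < \<infinity>" .
qed simp

lemma domain_E:
  assumes A: "A \<in> sets borel" and "\<xi> \<in> Domain a" shows "E A \<xi> \<in> Domain a"
proof -
  have "(\<integral>\<^sup>+ t. ennreal (t\<^sup>2) \<partial>scalar_measure E (E A \<xi>))
      = (\<integral>\<^sup>+ t. ennreal (indicator A t) * ennreal (t\<^sup>2) \<partial>scalar_measure E \<xi>)"
    unfolding sm_restrict[OF A] using A by (subst nn_integral_density) auto
  also have "\<dots> \<le> (\<integral>\<^sup>+ t. ennreal (t\<^sup>2) \<partial>scalar_measure E \<xi>)"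
    by (intro nn_integral_mono) (auto simp: indicator_def)
  finally show ?thesis using assms(2) unfolding domain_iff by (rule le_less_trans)
qed

text \<open>Only the quadratic form of \<open>a\<close> is tied to \<open>E\<close>, so mixed terms
  are extracted from the form at \<open>u + v\<close>. It splits along \<open>A\<close> and its
  complement, so the two mixed terms add up to 0, and by symmetry of \<open>a\<close> they are
  equal.\<close>

lemma form_orthogonal:
  assumes A: "A \<in> sets borel" and u: "(u, \<eta>1) \<in> a" "E A u = u" and v: "(v, \<eta>2) \<in> a" "E A v = 0"
  shows "inner \<eta>1 v = 0"
proof -
  have uv: "(u + v, \<eta>1 + \<eta>2) \<in> a" by (rule aD(2)[OF u(1) v(1)])
  have Eu: "E A (u + v) = u" and Ev: "E (- A) (u + v) = v"
    using A u v by (simp_all add: E_compl E_simps)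
  let ?m = "scalar_measure E (u + v)"
  have int: "integrable ?m (\<lambda>t. t)" using uv by (intro integrable_sm) blast
  have int': "integrable ?m (\<lambda>t. indicator B t * t)" if "B \<in> sets borel" for B
    using integrable_real_mult_indicator[OF _ int, of B] that by (simp add: mult.commute)
  have on: "(\<integral>t. t \<partial>scalar_measure E (E B (u + v))) = (\<integral>t. indicator B t * t \<partial>?m)" if "B \<in> sets borel" for B
    unfolding sm_restrict[OF that] using that by (subst integral_density) auto
  have "inner (\<eta>1 + \<eta>2) (u + v) = (\<integral>t. t \<partial>?m)" by (rule form[OF uv])
  also have "\<dots> = (\<integral>t. indicator A t * t + indicator (- A) t * t \<partial>?m)"
    by (rule Bochner_Integration.integral_cong) (auto simp: indicator_def)
  also have "\<dots> = (\<integral>t. indicator A t * t \<partial>?m) + (\<integral>t. indicator (- A) t * t \<partial>?m)"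
    using A by (intro Bochner_Integration.integral_add int') auto
  also have "\<dots> = inner \<eta>1 u + inner \<eta>2 v"
    using A on[of A] on[of "- A"] form[OF u(1)] form[OF v(1)] by (simp add: Eu Ev)
  finally have "inner \<eta>1 v + inner \<eta>2 u = 0" by (simp add: inner_add)
  moreover have "inner \<eta>2 u = inner \<eta>1 v" using possa_sym[OF possa u(1) v(1)] by (simp add: inner_commute)
  ultimately show ?thesis by simp
qed

text \<open>By \<open>form_orthogonal\<close>, \<open>\<eta>\<close> is orthogonal to
  \<open>d - E A d\<close> for every \<open>d\<close> in the domain, and the domain is
  dense.\<close>

lemma E_range_invariant:
  assumes A: "A \<in> sets borel" and u: "(u, \<eta>) \<in> a" "E A u = u"
  shows "E A \<eta> = \<eta>"
proof -
  have *: "inner \<eta> d = inner (E A \<eta>) d" if d: "d \<in> Domain a" for d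
  proof -
    obtain e where e: "(d, e) \<in> a" using d by blast
    obtain e' where e': "(E A d, e') \<in> a" using domain_E[OF A d] by blast
    have "inner \<eta> (d - E A d) = 0"
      by (rule form_orthogonal[OF A u aD(5)[OF e e']]) (simp add: E_simps[OF A])
    then show ?thesis by (simp add: inner_diff E_simps[OF A])
  qed
  show ?thesis
    using inner_eq_on_dense[OF possa_dense[OF possa], of "E A \<eta>" \<eta>] * by metis
qed

lemma E_commute:
  assumes A: "A \<in> sets borel" and u: "(\<xi>, \<eta>) \<in> a"
  shows "(E A \<xi>, E A \<eta>) \<in> a"
proof -
  obtain \<eta>1 where \<eta>1: "(E A \<xi>, \<eta>1) \<in> a" using domain_E[OF A] u by blast
  have 1: "E A \<eta>1 = \<eta>1" by (rule E_range_invariant[OF A \<eta>1]) (simp add: E_simps[OF A])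
  have "E (- A) (\<eta> - \<eta>1) = \<eta> - \<eta>1"
    by (rule E_range_invariant[OF _ aD(5)[OF u \<eta>1]]) (use A in \<open>auto simp: E_compl E_simps\<close>)
  then have "E A (\<eta> - \<eta>1) = 0" using A by (simp add: E_compl)
  then have "E A \<eta> = \<eta>1" using 1 by (simp add: E_simps[OF A])
  then show ?thesis using \<eta>1 by simp
qed

lemma lower_bound:
  assumes A: "A \<in> sets borel" "A \<subseteq> {s..}" and u: "(\<xi>, \<eta>) \<in> a" "E A \<xi> = \<xi>"
  shows "s * norm \<xi> \<le> norm \<eta>"
proof (cases "\<xi> = 0")
  case False
  interpret finite_measure "scalar_measure E \<xi>" by (rule finite_measure_sm)
  have "s * (norm \<xi>)\<^sup>2 = (\<integral>t. s \<partial>scalar_measure E \<xi>)"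
    by (simp add: measure_sm_UNIV power2_norm_eq_inner)
  also have "\<dots> \<le> (\<integral>t. t \<partial>scalar_measure E \<xi>)"
  proof (rule integral_mono_AE)
    show "AE t in scalar_measure E \<xi>. s \<le> t"
      using AE_sm[OF A(1) u(2)] by eventually_elim (use A(2) in auto)
    show "integrable (scalar_measure E \<xi>) (\<lambda>t. t)" using u(1) by (intro integrable_sm) blast
  qed simp
  also have "\<dots> = inner \<eta> \<xi>" by (rule form[OF u(1), symmetric])
  also have "\<dots> \<le> norm \<eta> * norm \<xi>" by (rule norm_cauchy_schwarz)
  finally have "(s * norm \<xi>) * norm \<xi> \<le> norm \<eta> * norm \<xi>" by (simp add: power2_eq_square mult.assoc)
  then show ?thesis using False by simp
qed simp

lemma bounded_domain:
  assumes A: "A \<in> sets borel" "A \<subseteq> {-N..N}" "E A \<xi> = \<xi>"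
  shows "\<xi> \<in> Domain a"
proof -
  interpret finite_measure "scalar_measure E \<xi>" by (rule finite_measure_sm)
  have "(\<integral>\<^sup>+ t. ennreal (t\<^sup>2) \<partial>scalar_measure E \<xi>) \<le> (\<integral>\<^sup>+ t. ennreal (N\<^sup>2) \<partial>scalar_measure E \<xi>)"
  proof (rule nn_integral_mono_AE)
    show "AE t in scalar_measure E \<xi>. ennreal (t\<^sup>2) \<le> ennreal (N\<^sup>2)"
      using AE_sm[OF A(1,3)]
    proof eventually_elim
      fix t assume "t \<in> A"
      then have "\<bar>t\<bar> \<le> \<bar>N\<bar>" using A(2) by (auto simp: abs_le_iff)
      then show "ennreal (t\<^sup>2) \<le> ennreal (N\<^sup>2)" by (intro ennreal_leI) (simp add: abs_le_square_iff)
    qed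
  qed
  also have "\<dots> < \<infinity>" by (simp add: emeasure_eq_measure ennreal_mult_eq_top_iff less_top[symmetric])
  finally show ?thesis by (simp add: domain_iff)
qed

lemma upper_bound:
  assumes l: "0 < l" and u: "(\<xi>, \<eta>) \<in> a" "E {0..l} \<xi> = \<xi>"
  shows "norm \<eta> \<le> l * norm \<xi>"
proof -
  have quad: "inner \<eta>' \<xi>' \<le> l * inner \<xi>' \<xi>'" if v: "(\<xi>', \<eta>') \<in> a" "E {0..l} \<xi>' = \<xi>'" for \<xi>' \<eta>'
  proof -
    interpret finite_measure "scalar_measure E \<xi>'" by (rule finite_measure_sm)
    have "inner \<eta>' \<xi>' = (\<integral>t. t \<partial>scalar_measure E \<xi>')" by (rule form[OF v(1)])
    also have "\<dots> \<le> (\<integral>t. l \<partial>scalar_measure E \<xi>')"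
    proof (rule integral_mono_AE)
      show "AE t in scalar_measure E \<xi>'. t \<le> l"
      proof -
        have "AE t in scalar_measure E \<xi>'. t \<in> {0..l}" by (rule AE_sm[OF _ v(2)]) simp
        then show ?thesis by eventually_elim auto
      qed
      show "integrable (scalar_measure E \<xi>') (\<lambda>t. t)" using v(1) by (intro integrable_sm) blast
    qed simp
    finally show ?thesis by (simp add: measure_sm_UNIV mult.commute)
  qed
  have E\<eta>: "E {0..l} \<eta> = \<eta>" by (rule E_range_invariant[OF _ u]) simp
  then have "\<eta> \<in> Domain a" by (intro bounded_domain[of "{0..l}" l]) auto
  then obtain \<theta> where \<theta>: "(\<eta>, \<theta>) \<in> a" by blast
  \<comment> \<open>Positivity of \<open>a\<close> is applied to \<open>(l - a) \<xi>\<close>; the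
    cubic term is bounded by the form estimate at \<open>\<eta> = a \<xi>\<close>, which leaves
    \<open>inner \<eta> \<eta> \<le> l * inner \<eta> \<xi>\<close>.\<close>
  have "(l *\<^sub>R \<xi> - \<eta>, l *\<^sub>R \<eta> - \<theta>) \<in> a" by (intro aD(4,5) u \<theta>)
  from possa_pos[OF possa this] have "0 \<le> inner (l *\<^sub>R \<eta> - \<theta>) (l *\<^sub>R \<xi> - \<eta>)" .
  moreover have "inner \<theta> \<xi> = inner \<eta> \<eta>" using possa_sym[OF possa \<theta> u(1)] by (simp add: inner_commute)
  moreover have "inner \<theta> \<eta> \<le> l * inner \<eta> \<eta>" by (rule quad[OF \<theta> E\<eta>])
  ultimately have "0 \<le> l * (l * inner \<eta> \<xi>) - l * inner \<eta> \<eta>"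
    by (simp add: inner_diff algebra_simps)
  then have "inner \<eta> \<eta> \<le> l * inner \<eta> \<xi>" using l by (simp flip: right_diff_distrib add: zero_le_mult_iff)
  also have "\<dots> \<le> l * (l * inner \<xi> \<xi>)" using l quad[OF u] by simp
  finally have "(norm \<eta>)\<^sup>2 \<le> (l * norm \<xi>)\<^sup>2"
    by (simp add: power2_norm_eq_inner power_mult_distrib power2_eq_square[of l] mult.assoc)
  then show ?thesis by (rule power2_le_imp_le) (use l in auto)
qed

text \<open>The range of \<open>E {- N..<0}\<close> lies in the domain because the interval is
  bounded; there the form is an integral over negative \<open>t\<close> and yet nonnegative.\<close>

lemma E_negative: "E {..<0} \<xi> = 0"
proof -
  have "E {- real N..<0} \<xi> = 0" for N
  proof -
    let ?A = "{- real N..<0}" and ?\<zeta> = "E {- real N..<0} \<xi>"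
    have A: "?A \<in> sets borel" by simp
    have fixA: "E ?A ?\<zeta> = ?\<zeta>" by (simp add: E_simps)
    have dom: "?\<zeta> \<in> Domain a" by (rule bounded_domain[OF A _ fixA, of "real N"]) auto
    then obtain \<eta> where \<eta>: "(?\<zeta>, \<eta>) \<in> a" by blast
    have neg: "AE t in scalar_measure E ?\<zeta>. t < 0" using AE_sm[OF A fixA] by eventually_elim auto
    have int: "integrable (scalar_measure E ?\<zeta>) (\<lambda>t. t)" by (rule integrable_sm[OF dom])
    have "(\<integral>t. - t \<partial>scalar_measure E ?\<zeta>) \<ge> 0"
      by (rule integral_nonneg_AE) (use neg in \<open>eventually_elim, auto\<close>)
    moreover have "0 \<le> (\<integral>t. t \<partial>scalar_measure E ?\<zeta>)" using possa_pos[OF possa \<eta>] form[OF \<eta>] by simp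
    ultimately have "(\<integral>t. - t \<partial>scalar_measure E ?\<zeta>) = 0" by simp
    then have "AE t in scalar_measure E ?\<zeta>. - t = 0"
      by (subst (asm) integral_nonneg_eq_0_iff_AE) (use neg int in \<open>auto elim: eventually_mono\<close>)
    with neg have "AE t in scalar_measure E ?\<zeta>. False" by eventually_elim auto
    then have "emeasure (scalar_measure E ?\<zeta>) UNIV = 0" using AE_iff_measurable[of UNIV "scalar_measure E ?\<zeta>" "\<lambda>_. False"] by simp
    then show ?thesis by (simp add: emeasure_sm_eq_0 E_UNIV)
  qed
  then have "E (\<Union>N. {- real N..<0}) \<xi> = 0" by (intro E_UN_eq_0) auto
  moreover have "(\<Union>N. {- real N..<0}) = {..<0::real}"
  proof -
    have "\<exists>N. - real N \<le> t" for t using real_arch_simple[of "- t"] by (metis minus_le_iff)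
    then show ?thesis by auto
  qed
  ultimately show ?thesis by simp
qed

text \<open>The growth estimates below need a strict inequality \<open>l < m\<close>; countable
  additivity along the half-lines starting at \<open>l + 1 / (k + 1)\<close> recovers the level
  \<open>l\<close> itself.\<close>

lemma E_greaterThan_iff_limit:
  assumes "\<And>m. l < m \<Longrightarrow> E {m<..} \<xi> = 0" shows "E {l<..} \<xi> = 0"
proof -
  have "E (\<Union>k. {l + inverse (real (Suc k))<..}) \<xi> = 0"
    by (rule E_UN_eq_0) (use assms in auto)
  moreover have "(\<Union>k. {l + inverse (real (Suc k))<..}) = {l<..}"
  proof (intro set_eqI iffI)
    fix t assume "t \<in> {l<..}"
    then obtain k where "inverse (real (Suc k)) < t - l" using reals_Archimedean[of "t - l"] by auto
    then have "l + inverse (real (Suc k)) < t" by linarith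
    then show "t \<in> (\<Union>k. {l + inverse (real (Suc k))<..})" by blast
  next
    fix t assume "t \<in> (\<Union>k. {l + inverse (real (Suc k))<..})"
    then obtain k where "l + inverse (real (Suc k)) < t" by blast
    moreover have "0 < inverse (real (Suc k))" by simp
    ultimately have "l < t" by linarith
    then show "t \<in> {l<..}" by simp
  qed
  ultimately show ?thesis by simp
qed

text \<open>Only even powers of \<open>a\<close> enter, so that the spectral projections are determined by \<open>a\<^sup>2\<close>.\<close>

theorem E_greaterThan_eq_0_iff:
  assumes l: "0 < l"
  shows "E {l<..} \<xi> = 0 \<longleftrightarrow> (\<forall>n. \<exists>\<eta>. (\<xi>, \<eta>) \<in> (a O a) ^^ n \<and> norm \<eta> \<le> (l\<^sup>2) ^ n * norm \<xi>)"
proof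
  assume 0: "E {l<..} \<xi> = 0"
  have split: "E {..l} \<xi> = E {..<0} \<xi> + E {0..l} \<xi>"
  proof -
    have "E ({..<0} \<union> {0..l}) \<xi> = E {..<0} \<xi> + E {0..l} \<xi>" by (rule E_Un) auto
    then show ?thesis using l by (simp add: ivl_disj_un)
  qed
  have "E {..l} \<xi> = \<xi>" using 0 E_compl[of "{l<..}" \<xi>] by (simp add: Compl_greaterThan)
  then have fixl: "E {0..l} \<xi> = \<xi>" using split E_negative by simp
  \<comment> \<open>On the range of \<open>E {0..l}\<close> the operator is bounded by
    \<open>l\<close> and preserves the range, so it can be iterated.\<close>
  have step: "\<exists>\<eta>'. (\<eta>, \<eta>') \<in> a \<and> E {0..l} \<eta>' = \<eta>' \<and> norm \<eta>' \<le> l * norm \<eta>" if "E {0..l} \<eta> = \<eta>" for \<eta>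
  proof -
    have "\<eta> \<in> Domain a" by (rule bounded_domain[OF _ _ that, of l]) auto
    then obtain \<eta>' where \<eta>': "(\<eta>, \<eta>') \<in> a" by blast
    moreover have "E {0..l} \<eta>' = \<eta>'" by (rule E_range_invariant[OF _ \<eta>' that]) simp
    ultimately show ?thesis using upper_bound[OF l \<eta>' that] by blast
  qed
  show "\<forall>n. \<exists>\<eta>. (\<xi>, \<eta>) \<in> (a O a) ^^ n \<and> norm \<eta> \<le> (l\<^sup>2) ^ n * norm \<xi>"
  proof
    fix n
    have "\<exists>\<eta>. (\<xi>, \<eta>) \<in> (a O a) ^^ n \<and> E {0..l} \<eta> = \<eta> \<and> norm \<eta> \<le> (l\<^sup>2) ^ n * norm \<xi>"
    proof (induction n)
      case 0
      then show ?case using fixl by simp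
    next
      case (Suc n)
      then obtain \<eta> where \<eta>: "(\<xi>, \<eta>) \<in> (a O a) ^^ n" "E {0..l} \<eta> = \<eta>" "norm \<eta> \<le> (l\<^sup>2) ^ n * norm \<xi>" by blast
      obtain \<eta>1 where \<eta>1: "(\<eta>, \<eta>1) \<in> a" "E {0..l} \<eta>1 = \<eta>1" "norm \<eta>1 \<le> l * norm \<eta>" using step[OF \<eta>(2)] by blast
      obtain \<eta>2 where \<eta>2: "(\<eta>1, \<eta>2) \<in> a" "E {0..l} \<eta>2 = \<eta>2" "norm \<eta>2 \<le> l * norm \<eta>1" using step[OF \<eta>1(2)] by blast
      have "(\<xi>, \<eta>2) \<in> (a O a) ^^ Suc n" using \<eta>(1) \<eta>1(1) \<eta>2(1) by auto
      moreover have "norm \<eta>2 \<le> (l\<^sup>2) ^ Suc n * norm \<xi>"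
      proof -
        have "norm \<eta>2 \<le> l * (l * norm \<eta>)" using \<eta>2(3) \<eta>1(3) l by (meson mult_left_mono less_imp_le order_trans)
        also have "\<dots> \<le> l * (l * ((l\<^sup>2) ^ n * norm \<xi>))" using \<eta>(3) l by simp
        finally show ?thesis by (simp add: power2_eq_square mult_ac)
      qed
      ultimately show ?case using \<eta>2(2) by blast
    qed
    then show "\<exists>\<eta>. (\<xi>, \<eta>) \<in> (a O a) ^^ n \<and> norm \<eta> \<le> (l\<^sup>2) ^ n * norm \<xi>" by blast
  qed
next
  assume *: "\<forall>n. \<exists>\<eta>. (\<xi>, \<eta>) \<in> (a O a) ^^ n \<and> norm \<eta> \<le> (l\<^sup>2) ^ n * norm \<xi>"
  show "E {l<..} \<xi> = 0"
  proof (rule E_greaterThan_iff_limit)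
    fix m assume m: "l < m"
    let ?A = "{m<..}"
    have A: "?A \<in> sets borel" by simp
    \<comment> \<open>Above \<open>m\<close> each application of \<open>a\<close> stretches by at
      least \<open>m\<close>, and cutting with \<open>E ?A\<close> commutes with \<open>a\<close>;
      with an assumed growth rate \<open>l < m\<close> only the zero vector survives.\<close>
    have pow: "(E ?A \<xi>, E ?A \<eta>) \<in> (a O a) ^^ n \<and> (m\<^sup>2) ^ n * norm (E ?A \<xi>) \<le> norm (E ?A \<eta>)"
      if "(\<xi>, \<eta>) \<in> (a O a) ^^ n" for n \<eta>
      using that
    proof (induction n arbitrary: \<eta>)
      case (Suc n)
      then obtain \<eta>0 \<eta>1 where \<eta>: "(\<xi>, \<eta>0) \<in> (a O a) ^^ n" "(\<eta>0, \<eta>1) \<in> a" "(\<eta>1, \<eta>) \<in> a" by auto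
      note c1 = E_commute[OF A \<eta>(2)] and c2 = E_commute[OF A \<eta>(3)]
      have "m * norm (E ?A \<eta>0) \<le> norm (E ?A \<eta>1)" "m * norm (E ?A \<eta>1) \<le> norm (E ?A \<eta>)"
        by (rule lower_bound[OF A _ c1] lower_bound[OF A _ c2]; auto simp: E_simps)+
      then have "m * (m * norm (E ?A \<eta>0)) \<le> norm (E ?A \<eta>)"
        using l m by (meson less_imp_le less_trans mult_left_mono order_trans)
      moreover have "m * (m * ((m\<^sup>2) ^ n * norm (E ?A \<xi>))) \<le> m * (m * norm (E ?A \<eta>0))"
        using Suc.IH[OF \<eta>(1)] l m by simp
      moreover have "(E ?A \<xi>, E ?A \<eta>) \<in> (a O a) ^^ Suc n" using Suc.IH[OF \<eta>(1)] c1 c2 by auto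
      ultimately show ?case by (simp add: power2_eq_square mult_ac)
    qed simp
    have "norm (E ?A \<xi>) \<le> (l\<^sup>2 / m\<^sup>2) ^ n * norm \<xi>" for n
    proof -
      obtain \<eta> where \<eta>: "(\<xi>, \<eta>) \<in> (a O a) ^^ n" "norm \<eta> \<le> (l\<^sup>2) ^ n * norm \<xi>" using * by blast
      have "(m\<^sup>2) ^ n * norm (E ?A \<xi>) \<le> norm \<eta>"
        using pow[OF \<eta>(1)] projection_norm_le[OF proj[OF A], of \<eta>] by linarith
      then have "(m\<^sup>2) ^ n * norm (E ?A \<xi>) \<le> (l\<^sup>2) ^ n * norm \<xi>" using \<eta>(2) by linarith
      then show ?thesis using l m by (simp add: power_divide field_simps)
    qed
    moreover have "(\<lambda>n. (l\<^sup>2 / m\<^sup>2) ^ n * norm \<xi>) \<longlonglongrightarrow> 0 * norm \<xi>"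
    proof (intro tendsto_mult LIMSEQ_realpow_zero tendsto_const)
      have "l\<^sup>2 < m\<^sup>2" using l m by (intro power_strict_mono) auto
      then show "l\<^sup>2 / m\<^sup>2 < 1" using l m by (simp add: divide_less_eq)
    qed simp
    ultimately have "norm (E ?A \<xi>) \<le> 0 * norm \<xi>"
      by (intro LIMSEQ_le_const[of _ "0 * norm \<xi>"]) auto
    then show "E ?A \<xi> = 0" by simp
  qed
qed

end

text \<open>The kernel criterion mentions only \<open>a O a\<close>. It needs a positive level;
  level 0 is reached by approximation from above.\<close>

lemma spectral_measure_greaterThan_unique:
  assumes "spectral_op a E" "spectral_op a' E'" "a O a = a' O a'" "0 \<le> l"
  shows "E {l<..} = E' {l<..}"
proof -
  interpret E: spectral_op a E by fact
  interpret E': spectral_op a' E' by fact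
  have pos: "E {m<..} \<xi> = 0 \<longleftrightarrow> E' {m<..} \<xi> = 0" if "0 < m" for m \<xi>
    using E.E_greaterThan_eq_0_iff[OF that] E'.E_greaterThan_eq_0_iff[OF that] assms(3) by simp
  show ?thesis
  proof (rule projection_eq_of_kernel)
    show "projection (E {l<..})" "projection (E' {l<..})" by (simp_all add: E.proj E'.proj)
    show "E {l<..} \<xi> = 0 \<longleftrightarrow> E' {l<..} \<xi> = 0" for \<xi>
    proof
      assume 0: "E {l<..} \<xi> = 0"
      show "E' {l<..} \<xi> = 0"
      proof (rule E'.E_greaterThan_iff_limit)
        fix m assume "l < m"
        then show "E' {m<..} \<xi> = 0" using E.E_subset_eq_0[OF _ _ _ 0, of "{m<..}"] pos[of m \<xi>] assms(4) by auto
      qed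
    next
      assume 0: "E' {l<..} \<xi> = 0"
      show "E {l<..} \<xi> = 0"
      proof (rule E.E_greaterThan_iff_limit)
        fix m assume "l < m"
        then show "E {m<..} \<xi> = 0" using E'.E_subset_eq_0[OF _ _ _ 0, of "{m<..}"] pos[of m \<xi>] assms(4) by auto
      qed
    qed
  qed
qed

text \<open>Equal squares give equal projections on half-lines, hence equal scalar measures, hence
  the same domain and the same quadratic form.\<close>

theorem positive_square_root_unique:
  fixes a a' :: "'h::complex_hilbert_space uop"
  assumes a: "positive_selfadjoint a" and a': "positive_selfadjoint a'" and sq: "a O a = a' O a'"
  shows "a = a'"
proof -
  obtain E E' where E: "has_spectral_measure a E" and E': "has_spectral_measure a' E'"
    using spectral_measure_exists a a' by metis
  interpret E: spectral_op a E by unfold_locales (fact a E)+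
  interpret E': spectral_op a' E' by unfold_locales (fact a' E')+
  have eq: "E {l<..} \<xi> = E' {l<..} \<xi>" for l \<xi>
  proof (cases "0 \<le> l")
    case True
    then show ?thesis
      using spectral_measure_greaterThan_unique[OF E.spectral_op_axioms E'.spectral_op_axioms sq] by simp
  next
    case False
    \<comment> \<open>For negative \<open>l\<close> both projections are the identity, as neither
      measure charges negative numbers.\<close>
    have "E {..l} \<xi> = 0" by (rule E.E_subset_eq_0[OF _ _ _ E.E_negative]) (use False in auto)
    moreover have "E' {..l} \<xi> = 0" by (rule E'.E_subset_eq_0[OF _ _ _ E'.E_negative]) (use False in auto)
    ultimately show ?thesis
      using E.E_compl[of "{..l}" \<xi>] E'.E_compl[of "{..l}" \<xi>] by (simp add: Compl_atMost)
  qed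
  have sm: "scalar_measure E \<xi> = scalar_measure E' \<xi>" for \<xi>
    by (rule measure_eqI_lessThan) (simp_all add: E.emeasure_sm E'.emeasure_sm eq)
  have dom: "Domain a = Domain a'"
    by (rule set_eqI) (simp only: E.domain_iff E'.domain_iff sm)
  have "\<eta> = \<eta>'" if \<eta>: "(\<xi>, \<eta>) \<in> a" and \<eta>': "(\<xi>, \<eta>') \<in> a'" for \<xi> \<eta> \<eta>'
  proof (rule inner_eq_on_dense[OF possa_dense[OF a]])
    fix u assume "u \<in> Domain a"
    \<comment> \<open>Polarisation: the forms agree at \<open>\<xi>\<close>, \<open>u\<close> and
      \<open>\<xi> + u\<close>, hence so do the mixed terms, which are tested against the dense
      domain.\<close>
    then obtain v v' where v: "(u, v) \<in> a" "(u, v') \<in> a'" using dom by blast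
    have "inner (\<eta> + v) (\<xi> + u) = inner (\<eta>' + v') (\<xi> + u)"
      using E.form[OF E.aD(2)[OF \<eta> v(1)]] E'.form[OF E'.aD(2)[OF \<eta>' v(2)]] sm by simp
    moreover have "inner \<eta> \<xi> = inner \<eta>' \<xi>" using E.form[OF \<eta>] E'.form[OF \<eta>'] sm by simp
    moreover have "inner v u = inner v' u" using E.form[OF v(1)] E'.form[OF v(2)] sm by simp
    moreover have "inner v \<xi> = inner \<eta> u" "inner v' \<xi> = inner \<eta>' u"
      using possa_sym[OF a \<eta> v(1)] possa_sym[OF a' \<eta>' v(2)] by (simp_all add: inner_commute)
    ultimately show "inner \<eta> u = inner \<eta>' u" by (simp add: inner_add)
  qed
  then show ?thesis using dom by (metis Domain.simps Domain.DomainI subrelI subset_antisym)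
qed

lemma uop_abs_eqI:
  assumes "positive_selfadjoint a" "a O a = x O uop_adj x"
  shows "uop_abs x = a"
  unfolding uop_abs_def
proof (rule the_equality)
  fix b assume "positive_selfadjoint b \<and> b O b = x O uop_adj x"
  then show "b = a" using positive_square_root_unique[of b a] assms by simp
qed (use assms in simp)

lemma uop_abs:
  fixes x :: "'h::complex_hilbert_space uop"
  assumes "closed_densely_defined x"
  shows "positive_selfadjoint (uop_abs x)" "uop_abs x O uop_abs x = x O uop_adj x"
proof -
  obtain a where a: "positive_selfadjoint a" "a O a = x O uop_adj x"
    using square_root_exists resolvent_adj_comp[OF assms] by metis
  then show "positive_selfadjoint (uop_abs x)" "uop_abs x O uop_abs x = x O uop_adj x"
    by (simp_all add: uop_abs_eqI)
qed

text \<open>All spectral measures of \<open>a\<close> agree on this half-line, so the description is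
  meaningful. The kernel criterion is the working form of the spectral projection from here on: it
  refers to the graph of the square only.\<close>

lemma spectral_projection_greaterThan:
  fixes a :: "'h::complex_hilbert_space uop"
  assumes a: "positive_selfadjoint a" and l: "0 < l"
  shows "projection (spectral_projection a {l<..})"
    and "spectral_projection a {l<..} \<xi> = 0 \<longleftrightarrow>
      (\<forall>n. \<exists>\<eta>. (\<xi>, \<eta>) \<in> (a O a) ^^ n \<and> norm \<eta> \<le> (l\<^sup>2) ^ n * norm \<xi>)"
proof -
  obtain E where E: "has_spectral_measure a E" using spectral_measure_exists[OF a] by blast
  interpret E: spectral_op a E by unfold_locales (fact a E)+
  have "spectral_projection a {l<..} = E {l<..}"
    unfolding spectral_projection_def
  proof (rule the_equality)
    fix p assume "\<exists>E. has_spectral_measure a E \<and> p = E {l<..}"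
    then obtain E' where E': "has_spectral_measure a E'" "p = E' {l<..}" by blast
    then have "spectral_op a E'" using a by unfold_locales
    then show "p = E {l<..}"
      using spectral_measure_greaterThan_unique[OF E.spectral_op_axioms] l E'(2) by force
  qed (use E in blast)
  then show "projection (spectral_projection a {l<..})"
    and "spectral_projection a {l<..} \<xi> = 0 \<longleftrightarrow>
      (\<forall>n. \<exists>\<eta>. (\<xi>, \<eta>) \<in> (a O a) ^^ n \<and> norm \<eta> \<le> (l\<^sup>2) ^ n * norm \<xi>)"
    using E.proj E.E_greaterThan_eq_0_iff[OF l] by simp_all
qed

section \<open>Spectral projections of affiliated operators\<close>

lemma projections_D:
  assumes "p \<in> projections M"
  shows "p \<in> M" "projection p" "p (p x) = p x" "inner (p x) y = inner x (p y)"
  using assms projectionD by (auto simp: projections_def)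

lemma proj_le_iff: "proj_le p q \<longleftrightarrow> (\<forall>x. q (p x) = p x)"
  by (auto simp: proj_le_def fun_eq_iff)

text \<open>Take adjoints in \<open>q p = r\<close>.\<close>

lemma projection_comp_adjoint:
  assumes "projection p" "projection q" "projection r" "\<And>x. q (p x) = r x"
  shows "p (q x) = r x"
proof (rule iffD1[OF vector_eq_ldot, OF allI])
  fix y
  have "inner y (p (q x)) = inner (q (p y)) x"
    using projectionD(3)[OF assms(1)] projectionD(3)[OF assms(2)] by metis
  then show "inner y (p (q x)) = inner y (r x)" using assms(4) projectionD(3)[OF assms(3)] by metis
qed

lemma projection_zero: "projection zero_op"
  by (simp add: projection_iff bounded_clinear_zero) (simp add: zero_op_def)

lemma projection_orth_sym:
  assumes "projection p" "projection q" "p \<circ> q = zero_op"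
  shows "q \<circ> p = zero_op"
  using projection_comp_adjoint[OF assms(2,1) projection_zero] assms(3)
  by (metis comp_apply ext)

lemma proj_le_comp: "projection p \<Longrightarrow> projection q \<Longrightarrow> proj_le p q \<Longrightarrow> p (q x) = p x"
  by (rule projection_comp_adjoint) (auto simp: proj_le_iff)

text \<open>A kernel that is invariant under \<open>u\<close> and its adjoint is a reducing
  subspace.\<close>

lemma projection_commute:
  assumes p: "projection p" and u: "bounded_clinear u"
    and 1: "\<And>x. p x = 0 \<Longrightarrow> p (u x) = 0" and 2: "\<And>x. p x = 0 \<Longrightarrow> p (cadj u x) = 0"
  shows "p (u x) = u (p x)"
proof -
  note ps = bounded_clinear_simps[OF projectionD(1)[OF p]] and us = bounded_clinear_simps[OF u]
    and u's = bounded_clinear_simps[OF bounded_clinear_cadj[OF u]]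
  have z: "p (y - p y) = 0" for y by (simp add: ps projectionD(2)[OF p])
  have a: "p (u y) = p (u (p y))" for y using 1[OF z[of y]] by (simp add: ps us)
  have b: "p (cadj u y) = p (cadj u (p y))" for y using 2[OF z[of y]] by (simp add: ps u's)
  have "u (p x) = p (u (p x))"
  proof (rule iffD1[OF vector_eq_ldot, OF allI])
    fix y
    have "inner y (u (p x)) = inner (p (cadj u y)) x"
      by (simp add: inner_cadj_left[OF u] projectionD(3)[OF p])
    also have "\<dots> = inner y (p (u (p x)))"
      unfolding b[of y] by (simp add: inner_cadj_left[OF u] projectionD(3)[OF p])
    finally show "inner y (u (p x)) = inner y (p (u (p x)))" .
  qed
  then show ?thesis using a by simp
qed

lemma unitaryD:
  assumes "unitary u"
  shows "bounded_clinear u" "cadj u (u x) = x" "u (cadj u x) = x" "norm (u x) = norm x"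
proof -
  show b: "bounded_clinear u" and 1: "cadj u (u x) = x" and "u (cadj u x) = x"
    using assms by (auto simp: unitary_def fun_eq_iff)
  have "(norm (u x))\<^sup>2 = (norm x)\<^sup>2" by (simp add: power2_norm_eq_inner inner_cadj[OF b] 1)
  then show "norm (u x) = norm x" by (rule power2_eq_imp_eq) auto
qed

lemma unitary_cadj: "unitary u \<Longrightarrow> unitary (cadj u)"
  by (auto simp: unitary_def bounded_clinear_cadj cadj_cadj)

context von_neumann
begin

text \<open>\<open>u\<close> is moved to the other side of the inner product as its adjoint, again a
  unitary of the commutant.\<close>

lemma affiliated_uop_adj:
  assumes x: "graph_subspace x" "affiliated x M" and u: "u \<in> commutant M" "unitary u"
    and in_adj: "(\<eta>, \<zeta>) \<in> uop_adj x"
  shows "(u \<eta>, u \<zeta>) \<in> uop_adj x"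
  unfolding uop_adj_iff[OF x(1)]
proof (intro allI impI)
  fix \<xi> \<xi>' assume "(\<xi>, \<xi>') \<in> x"
  then have "(cadj u \<xi>, cadj u \<xi>') \<in> x"
    using x(2) commutant_cadj[OF u(1)] unitary_cadj[OF u(2)] by (auto simp: affiliated_def)
  then have "inner (cadj u \<xi>') \<eta> = inner (cadj u \<xi>) \<zeta>"
    using in_adj uop_adj_iff[OF x(1)] by blast
  then show "inner \<xi>' (u \<eta>) = inner \<xi> (u \<zeta>)"
    by (simp add: inner_cadj_left[OF unitaryD(1)[OF u(2)]])
qed

text \<open>A unitary of the commutant preserves norms and maps the graph of
  \<open>x O uop_adj x\<close> and its powers into themselves, so it preserves the growth condition
  that describes the kernel of the spectral projection.\<close>

theorem spectral_projection_in_M: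
  assumes x: "closed_densely_defined x" "affiliated x M" and l: "0 < l"
  shows "spectral_projection (uop_abs x) {l<..} \<in> projections M"
proof -
  let ?P = "x O uop_adj x" and ?p = "spectral_projection (uop_abs x) {l<..}"
  note gx = closed_densely_defined_graph_subspace[OF x(1)]
  note sp = spectral_projection_greaterThan[OF uop_abs(1)[OF x(1)] l, unfolded uop_abs(2)[OF x(1)]]
  have pow: "(u \<xi>, u \<eta>) \<in> ?P ^^ n" if u: "u \<in> commutant M" "unitary u" and p: "(\<xi>, \<eta>) \<in> ?P ^^ n" for u \<xi> \<eta> n
    using p
  proof (induction n arbitrary: \<eta>)
    case (Suc n)
    then obtain \<eta>0 \<eta>1 where \<eta>: "(\<xi>, \<eta>0) \<in> ?P ^^ n" "(\<eta>0, \<eta>1) \<in> x" "(\<eta>1, \<eta>) \<in> uop_adj x" by auto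
    have "(u \<eta>0, u \<eta>1) \<in> x" using x(2) u \<eta>(2) by (auto simp: affiliated_def)
    moreover have "(u \<eta>1, u \<eta>) \<in> uop_adj x" by (rule affiliated_uop_adj[OF gx x(2) u \<eta>(3)])
    ultimately show ?case using Suc.IH[OF \<eta>(1)] by auto
  qed simp
  have ker: "?p (u \<xi>) = 0" if u: "u \<in> commutant M" "unitary u" and k: "?p \<xi> = 0" for u \<xi>
    unfolding sp(2)
  proof
    fix n
    obtain \<eta> where "(\<xi>, \<eta>) \<in> ?P ^^ n" "norm \<eta> \<le> (l\<^sup>2) ^ n * norm \<xi>" using k sp(2) by blast
    then show "\<exists>\<eta>. (u \<xi>, \<eta>) \<in> ?P ^^ n \<and> norm \<eta> \<le> (l\<^sup>2) ^ n * norm (u \<xi>)"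
      using pow[OF u] unitaryD(4)[OF u(2)] by metis
  qed
  have "?p \<in> M"
  proof (rule M_I_unitary[OF projectionD(1)[OF sp(1)]])
    fix u \<xi> assume u: "u \<in> commutant M" "unitary u"
    show "?p (u \<xi>) = u (?p \<xi>)"
      by (rule projection_commute[OF sp(1) unitaryD(1)[OF u(2)]])
        (use ker u commutant_cadj unitary_cadj in blast)+
  qed
  then show ?thesis using sp(1) by (simp add: projections_def)
qed

end

lemma uop_abs_projection:
  assumes r: "projection r"
  shows "positive_selfadjoint (op_graph r)" "op_graph r O op_graph r = op_graph r"
    "uop_abs (op_graph r) = op_graph r"
proof -
  note rs = bounded_clinear_simps[OF projectionD(1)[OF r]]
  have mem: "(\<xi>, \<eta>) \<in> op_graph r \<longleftrightarrow> \<eta> = r \<xi>" for \<xi> \<eta> by (auto simp: op_graph_def)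
  have g: "graph_subspace (op_graph r)" by (simp add: graph_subspace_def mem rs)
  have adj: "uop_adj (op_graph r) = op_graph r"
  proof (intro set_eqI iffI; clarify)
    fix \<eta> \<zeta> assume "(\<eta>, \<zeta>) \<in> uop_adj (op_graph r)"
    then have "inner \<xi> \<zeta> = inner \<xi> (r \<eta>)" for \<xi>
      unfolding uop_adj_iff[OF g] mem using projectionD(3)[OF r] by metis
    then show "(\<eta>, \<zeta>) \<in> op_graph r" unfolding mem by (rule iffD1[OF vector_eq_ldot, OF allI])
  qed (simp add: uop_adj_iff[OF g] mem projectionD(3)[OF r])
  show comp: "op_graph r O op_graph r = op_graph r"
    by (auto simp: mem relcomp_unfold projectionD(2)[OF r])
  have "inner (r \<xi>) \<xi> \<ge> 0" for \<xi> by (simp flip: projection_norm_sq[OF r])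
  moreover have "Domain (op_graph r) = UNIV" by (auto simp: op_graph_def)
  moreover have "closed (op_graph r)" using closed_uop_adj[OF g] adj by simp
  ultimately show pos: "positive_selfadjoint (op_graph r)"
    using g adj unfolding positive_selfadjoint_def closed_densely_defined_def graph_subspace_def
    by (auto simp: mem Re_cinner intro!: single_valuedI)
  show "uop_abs (op_graph r) = op_graph r"
    by (rule uop_abs_eqI[OF pos]) (simp add: adj)
qed

text \<open>All positive powers of a projection agree, so the growth condition compares the fixed
  number \<open>norm (r \<xi>)\<close> with the powers of \<open>l\<^sup>2\<close> times
  \<open>norm \<xi>\<close>: for \<open>l < 1\<close> it forces \<open>r \<xi> = 0\<close>,
  otherwise it always holds.\<close>

lemma spectral_projection_projection:
  assumes r: "projection r" and l: "0 < l"
  shows "spectral_projection (uop_abs (op_graph r)) {l<..} = (if l < 1 then r else zero_op)"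
proof (rule projection_eq_of_kernel)
  note sp = spectral_projection_greaterThan[OF uop_abs_projection(1)[OF r] l, unfolded uop_abs_projection(2)[OF r]]
  show "projection (spectral_projection (uop_abs (op_graph r)) {l<..})"
    using sp(1) by (simp add: uop_abs_projection(3)[OF r])
  show "projection (if l < 1 then r else zero_op)" by (simp add: r projection_zero)
  fix \<xi>
  have pow: "(\<xi>, \<eta>) \<in> op_graph r ^^ Suc n \<longleftrightarrow> \<eta> = r \<xi>" for n \<eta>
    by (induction n arbitrary: \<eta>) (auto simp: op_graph_def relcomp_unfold projectionD(2)[OF r])
  have iff: "(\<exists>\<eta>. (\<xi>, \<eta>) \<in> op_graph r ^^ Suc n \<and> norm \<eta> \<le> (l\<^sup>2) ^ Suc n * norm \<xi>)
      \<longleftrightarrow> norm (r \<xi>) \<le> (l\<^sup>2) ^ Suc n * norm \<xi>" for n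
    unfolding pow by simp
  have "spectral_projection (op_graph r) {l<..} \<xi> = 0 \<longleftrightarrow> (\<forall>n. norm (r \<xi>) \<le> (l\<^sup>2) ^ Suc n * norm \<xi>)"
    unfolding sp(2)
  proof
    assume *: "\<forall>n. norm (r \<xi>) \<le> (l\<^sup>2) ^ Suc n * norm \<xi>"
    show "\<forall>n. \<exists>\<eta>. (\<xi>, \<eta>) \<in> op_graph r ^^ n \<and> norm \<eta> \<le> (l\<^sup>2) ^ n * norm \<xi>"
    proof
      fix n show "\<exists>\<eta>. (\<xi>, \<eta>) \<in> op_graph r ^^ n \<and> norm \<eta> \<le> (l\<^sup>2) ^ n * norm \<xi>"
        by (cases n) (use * iff in auto)
    qed
  qed (use iff in blast)
  also have "\<dots> \<longleftrightarrow> (if l < 1 then r else zero_op) \<xi> = 0"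
  proof (cases "l < 1")
    case True
    have "r \<xi> = 0" if "\<forall>n. norm (r \<xi>) \<le> (l\<^sup>2) ^ Suc n * norm \<xi>"
    proof -
      have "(\<lambda>n. (l\<^sup>2) ^ Suc n * norm \<xi>) \<longlonglongrightarrow> 0 * norm \<xi>"
        using True l
        by (intro tendsto_mult tendsto_const LIMSEQ_Suc[OF LIMSEQ_realpow_zero])
          (auto simp: power_less_one_iff)
      then have "norm (r \<xi>) \<le> 0 * norm \<xi>" using that by (intro LIMSEQ_le_const[of _ "0 * norm \<xi>"]) auto
      then show ?thesis by simp
    qed
    then show ?thesis using True l by auto
  next
    case False
    have "norm (r \<xi>) \<le> (l\<^sup>2) ^ Suc n * norm \<xi>" for n
    proof -
      have "1 \<le> (l\<^sup>2) ^ Suc n" using False by (intro one_le_power) auto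
      then have "1 * norm \<xi> \<le> (l\<^sup>2) ^ Suc n * norm \<xi>" by (intro mult_right_mono) auto
      then show ?thesis using projection_norm_le[OF r, of \<xi>] by linarith
    qed
    then show ?thesis using False by (simp add: zero_op_def)
  qed
  finally show "spectral_projection (uop_abs (op_graph r)) {l<..} \<xi> = 0 \<longleftrightarrow> (if l < 1 then r else zero_op) \<xi> = 0"
    by (simp add: uop_abs_projection(3)[OF r])
qed

section \<open>The projection lattice\<close>

context von_neumann
begin

lemma projections_I: "p \<in> M \<Longrightarrow> projection p \<Longrightarrow> p \<in> projections M"
  by (simp add: projections_def)

lemma projections_zero: "zero_op \<in> projections M"
  by (simp add: projections_I M_zero projection_zero)

lemma projections_id: "id \<in> projections M"
  by (rule projections_I[OF M_id]) (simp add: projection_iff bounded_clinear_id)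

lemma projections_add:
  assumes p: "p \<in> projections M" and q: "q \<in> projections M" and pq: "p \<circ> q = zero_op"
  shows "(\<lambda>x. p x + q x) \<in> projections M" "is_proj_sup M {p, q} (\<lambda>x. p x + q x)"
proof -
  note pD = projections_D[OF p] and qD = projections_D[OF q]
  note ps = bounded_clinear_simps[OF projectionD(1)[OF pD(2)]] and qs = bounded_clinear_simps[OF projectionD(1)[OF qD(2)]]
  have o: "p (q x) = 0" "q (p x) = 0" for x
    using pq projection_orth_sym[OF pD(2) qD(2) pq] by (auto simp: fun_eq_iff zero_op_def)
  have "projection (\<lambda>x. p x + q x)"
    unfolding projection_iff
    by (simp add: bounded_clinear_add projectionD(1)[OF pD(2)] projectionD(1)[OF qD(2)] ps qs o pD qD inner_add)
  then show r: "(\<lambda>x. p x + q x) \<in> projections M" by (intro projections_I M_add pD qD)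
  show "is_proj_sup M {p, q} (\<lambda>x. p x + q x)"
    unfolding is_proj_sup_def
  proof (intro conjI ballI impI r)
    fix t assume t: "t \<in> projections M" "\<forall>p\<in>{p, q}. proj_le p t"
    then show "proj_le (\<lambda>x. p x + q x) t"
      using bounded_clinear_simps[OF projectionD(1)[OF projections_D(2)[OF t(1)]]] by (simp add: proj_le_iff)
  qed (auto simp: proj_le_iff o pD qD)
qed

lemma projections_diff:
  assumes p: "p \<in> projections M" and q: "q \<in> projections M" and pq: "proj_le q p"
  shows "(\<lambda>x. p x - q x) \<in> projections M"
proof -
  note pD = projections_D[OF p] and qD = projections_D[OF q]
  note ps = bounded_clinear_simps[OF projectionD(1)[OF pD(2)]] and qs = bounded_clinear_simps[OF projectionD(1)[OF qD(2)]]
  have o: "p (q x) = q x" "q (p x) = q x" for x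
    using pq proj_le_comp[OF qD(2) pD(2) pq] by (auto simp: proj_le_iff)
  have "projection (\<lambda>x. p x - q x)"
    unfolding projection_iff
    by (simp add: bounded_clinear_diff projectionD(1)[OF pD(2)] projectionD(1)[OF qD(2)] ps qs o pD qD inner_diff)
  then show ?thesis by (intro projections_I M_diff pD qD)
qed

lemma projections_commuting_comp:
  assumes p: "p \<in> projections M" and q: "q \<in> projections M" and c: "\<And>x. p (q x) = q (p x)"
  shows "p \<circ> q \<in> projections M"
proof -
  note pD = projections_D[OF p] and qD = projections_D[OF q]
  have "inner (p (q x)) y = inner x (p (q y))" for x y
    using c by (simp add: pD(4) qD(4))
  moreover have "p (q (p (q x))) = p (q x)" for x using c by (simp add: pD(3) qD(3))
  ultimately have "projection (p \<circ> q)"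
    unfolding projection_iff
    using bounded_clinear_comp[OF projectionD(1)[OF pD(2)] projectionD(1)[OF qD(2)]] by simp
  then show ?thesis by (intro projections_I M_comp pD qD)
qed

text \<open>\<open>N\<close> is the common kernel of \<open>S\<close>, and its orthogonal complement
  \<open>K\<close> is the closed span of the ranges. The commutant leaves \<open>K\<close>
  invariant, so the projection onto \<open>K\<close> commutes with it and lies in
  \<open>M\<close>.\<close>

lemma proj_sup_exists:
  assumes S: "S \<subseteq> projections M"
  shows "\<exists>r. is_proj_sup M S r"
proof -
  define N where "N = {y. \<forall>p\<in>S. p y = 0}"
  define K where "K = {x. \<forall>y\<in>N. inner x y = 0}"
  have pb: "bounded_clinear p" if "p \<in> S" for p using S that projections_D projectionD(1) by blast
  have K: "subspace K" "closed K"
  proof -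
    show "subspace K" by (auto simp: K_def subspace_def inner_add)
    have "K = (\<Inter>y\<in>N. {x. inner x y = 0})" by (auto simp: K_def)
    then show "closed K" by (auto intro!: closed_INT closed_Collect_eq continuous_intros)
  qed
  have KT: "T x \<in> K" if T: "T \<in> commutant M" and x: "x \<in> K" for T x
  proof -
    note bT = commutant_bounded_clinear[OF T]
    have "inner (T x) y = 0" if "y \<in> N" for y
    proof -
      have "cadj T y \<in> N"
        using that S M_commute[OF _ commutant_cadj[OF T]] projections_D(1) bounded_clinear_simps(4)[OF bounded_clinear_cadj[OF bT]]
        unfolding N_def by (smt (verit, best) mem_Collect_eq subsetD)
      then show ?thesis using x by (simp add: inner_cadj[OF bT] K_def)
    qed
    then show ?thesis by (simp add: K_def)
  qed
  have Kc: "c *\<^sub>C x \<in> K" if "x \<in> K" for c x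
  proof -
    have "cnj c *\<^sub>C y \<in> N" if "y \<in> N" for y
      unfolding N_def
    proof (intro CollectI ballI)
      fix p assume p: "p \<in> S"
      have "p (cnj c *\<^sub>C y) = cnj c *\<^sub>C p y" by (rule bounded_clinear_simps(6)[OF pb[OF p]])
      moreover have "p y = 0" using that p unfolding N_def by blast
      ultimately show "p (cnj c *\<^sub>C y) = 0" by simp
    qed
    then show ?thesis using that by (auto simp: K_def inner_scaleC_left)
  qed
  note proj = projection_oproj[OF K Kc]
  have "oproj K \<in> M"
  proof (rule M_I[OF projectionD(1)[OF proj]])
    fix T x assume T: "T \<in> commutant M"
    note bT = commutant_bounded_clinear[OF T]
    show "oproj K (T x) = T (oproj K x)"
      by (rule oproj_commute[OF K bounded_clinear_linear[OF bT] inner_cadj[OF bT]])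
        (use KT T commutant_cadj in auto)
  qed
  then have r: "oproj K \<in> projections M" using proj by (rule projections_I)
  have "is_proj_sup M S (oproj K)"
    unfolding is_proj_sup_def
  proof (intro conjI ballI impI r)
    fix p assume p: "p \<in> S"
    have "p x \<in> K" for x
      unfolding K_def N_def using p S projections_D(4) by fastforce
    then show "proj_le p (oproj K)" by (simp add: proj_le_iff oproj_ident[OF K])
  next
    fix q assume q: "q \<in> projections M" "\<forall>p\<in>S. proj_le p q"
    note qD = projections_D[OF q(1)]
    note qs = bounded_clinear_simps[OF projectionD(1)[OF qD(2)]]
    have "q x = x" if x: "x \<in> K" for x
    proof -
      have "p (x - q x) = 0" if p: "p \<in> S" for p
      proof -
        have "projection p" using p S projections_D(2) by blast
        then have "p (q x) = p x" by (rule proj_le_comp[OF _ qD(2)]) (use q(2) p in blast)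
        then show ?thesis by (simp add: bounded_clinear_simps(2)[OF pb[OF p]])
      qed
      then have "x - q x \<in> N" by (simp add: N_def)
      then have "inner x (x - q x) = 0" using x by (simp add: K_def)
      moreover have "inner (q x) (x - q x) = 0" using qD(3,4) by (simp add: qs)
      ultimately have "inner (x - q x) (x - q x) = 0" by (simp add: inner_diff_left)
      then show ?thesis by simp
    qed
    then show "proj_le (oproj K) q" by (simp add: proj_le_iff oproj_in[OF K])
  qed
  then show ?thesis by blast
qed

text \<open>Orthogonality to \<open>f\<close> amounts to being below \<open>1 - f\<close>, a
  condition that suprema inherit.\<close>

lemma proj_sup_orthogonal:
  assumes r: "is_proj_sup M S r" and f: "f \<in> projections M" and o: "\<And>p. p \<in> S \<Longrightarrow> f \<circ> p = zero_op"
  shows "f \<circ> r = zero_op"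
proof -
  have "proj_le f id" by (simp add: proj_le_def)
  from projections_diff[OF projections_id f this] have c: "(\<lambda>x. id x - f x) \<in> projections M" .
  have "proj_le p (\<lambda>x. id x - f x)" if "p \<in> S" for p
    using o[OF that] by (auto simp: proj_le_iff fun_eq_iff zero_op_def)
  then have "proj_le r (\<lambda>x. id x - f x)" using r c by (auto simp: is_proj_sup_def)
  then show ?thesis by (auto simp: proj_le_iff fun_eq_iff zero_op_def)
qed

end

section \<open>Partial isometries below non-abelian projections\<close>

text \<open>Exactly \<open>m\<close>, the ceiling of \<open>n t\<close>, of the grid points
  \<open>k / n\<close> with \<open>k < n\<close> lie strictly below \<open>t\<close>, so the sum is
  \<open>m / n\<close>.\<close>

lemma step_function_approx:
  assumes t: "t \<in> {0..1::real}" and n: "0 < n"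
  shows "\<bar>t - (\<Sum>k<n. 1 / real n * indicator {real k / real n<..} t)\<bar> \<le> 1 / real n"
proof -
  define m where "m = nat \<lceil>real n * t\<rceil>"
  have nt: "0 \<le> real n * t" "real n * t \<le> real n" using t n by (auto simp: mult_le_cancel_left1)
  have m: "real m = of_int \<lceil>real n * t\<rceil>" using nt by (simp add: m_def)
  have mn: "m \<le> n" using nt(2) by (simp add: m_def ceiling_le_iff nat_le_iff)
  have iff: "real k / real n < t \<longleftrightarrow> k < m" for k
  proof -
    have "real k / real n < t \<longleftrightarrow> real k < real n * t" using n by (simp add: field_simps)
    also have "\<dots> \<longleftrightarrow> int k < \<lceil>real n * t\<rceil>" by (simp add: less_ceiling_iff)
    finally show ?thesis by (simp add: m_def zless_nat_eq_int_zless)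
  qed
  have "(\<Sum>k<n. 1 / real n * indicator {real k / real n<..} t) = (\<Sum>k<n. if k < m then 1 / real n else 0)"
    by (intro sum.cong) (auto simp: indicator_def iff)
  also have "\<dots> = (\<Sum>k\<in>{..<n} \<inter> {k. k < m}. 1 / real n)" by (subst sum.inter_restrict) auto
  also have "{..<n} \<inter> {k. k < m} = {..<m}" using mn by auto
  finally have "(\<Sum>k<n. 1 / real n * indicator {real k / real n<..} t) = real m / real n" by simp
  moreover have "real n * t \<le> real m" "real m \<le> real n * t + 1" unfolding m by linarith+
  then have "t \<le> real m / real n" "real m / real n \<le> t + 1 / real n"
    using n by (simp_all add: field_simps)
  ultimately show ?thesis by (simp add: abs_le_iff)
qed

context positive_contraction
begin

lemma fc_sum:
  assumes "\<And>k. k \<in> I \<Longrightarrow> bfun (f k)" "finite I"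
  shows "bfun (\<lambda>t. \<Sum>k\<in>I. f k t) \<and> fc (\<lambda>t. \<Sum>k\<in>I. f k t) x = (\<Sum>k\<in>I. fc (f k) x)"
  using assms(2,1)
proof (induction I rule: finite_induct)
  case empty
  then show ?case using bfun_const[of 0] fc_const[of 0 x] by simp
next
  case (insert k I)
  then show ?case using bfun_add[of "f k" "\<lambda>t. \<Sum>k\<in>I. f k t"] fc_add[of "f k" "\<lambda>t. \<Sum>k\<in>I. f k t"] by simp
qed

text \<open>On [0,1] the identity function is a uniform limit of staircases built from half-lines,
  so \<open>T\<close> is a norm limit of combinations of these spectral projections.\<close>

lemma commute_if_commute_spectral:
  assumes Y: "bounded_linear Y" and c: "\<And>l x. Y (fc (indicator {l<..}) x) = fc (indicator {l<..}) (Y x)"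
  shows "Y (T x) = T (Y x)"
proof -
  interpret Y: bounded_linear Y by fact
  define s where "s n t = (\<Sum>k<Suc n. 1 / real (Suc n) * indicator {real k / real (Suc n)<..} t)" for n and t :: real
  have b: "bfun (\<lambda>t. 1 / real (Suc n) * indicator {real k / real (Suc n)<..} t)" for n k
    by (intro bfun_mult bfun_const bfun_greaterThan)
  have bs: "bfun (s n)" and fcs: "fc (s n) x = (\<Sum>k<Suc n. (1 / real (Suc n)) *\<^sub>R fc (indicator {real k / real (Suc n)<..}) x)" for n x
    using fc_sum[of "{..<Suc n}" "\<lambda>k t. 1 / real (Suc n) * indicator {real k / real (Suc n)<..} t", OF b, of x]
    unfolding s_def by (simp_all only: finite_lessThan fc_mult[OF bfun_const bfun_greaterThan] fc_const simp_thms)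
  have comm: "Y (fc (s n) x) = fc (s n) (Y x)" for n x
    unfolding fcs by (simp add: Y.sum Y.scaleR c del: sum.lessThan_Suc of_nat_Suc)
  have lim: "(\<lambda>n. fc (s n) x) \<longlonglongrightarrow> T x" for x
  proof -
    have est: "norm (T x - fc (s n) x) \<le> inverse (real (Suc n)) * norm x" for n
    proof -
      have "(norm (T x - fc (s n) x))\<^sup>2 = (\<integral>t. (t - s n t)\<^sup>2 \<partial>spm x)"
        using norm_fc_sq[OF bfun_diff[OF bfun_id bs[of n]], of x] by (simp add: fc_diff[OF bfun_id bs] fc_id)
      also have "\<dots> \<le> (\<integral>t. (inverse (real (Suc n)))\<^sup>2 \<partial>spm x)"
      proof (rule integral_mono_AE)
        show "integrable (spm x) (\<lambda>t. (t - s n t)\<^sup>2)"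
          by (rule bfun_integrable[OF bfun_power2[OF bfun_diff[OF bfun_id bs]]])
        show "AE t in spm x. (t - s n t)\<^sup>2 \<le> (inverse (real (Suc n)))\<^sup>2"
          using AE_spm_unit
        proof eventually_elim
          fix t :: real assume "t \<in> {0..1}"
          then have "\<bar>t - s n t\<bar> \<le> inverse (real (Suc n))"
            using step_function_approx[of t "Suc n"] unfolding s_def by (simp add: inverse_eq_divide)
          then have "\<bar>t - s n t\<bar>\<^sup>2 \<le> (inverse (real (Suc n)))\<^sup>2" by (intro power_mono) auto
          then show "(t - s n t)\<^sup>2 \<le> (inverse (real (Suc n)))\<^sup>2" by simp
        qed
      qed (simp add: finite_measure.integrable_const[OF finite_measure_spm])
      also have "\<dots> = (inverse (real (Suc n)) * norm x)\<^sup>2"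
        by (simp add: measure_spm_UNIV power_mult_distrib power2_norm_eq_inner)
      finally show ?thesis by (rule power2_le_imp_le) simp
    qed
    have "(\<lambda>n. inverse (real (Suc n)) * norm x) \<longlonglongrightarrow> 0 * norm x"
      by (intro tendsto_mult tendsto_const LIMSEQ_inverse_real_of_nat)
    then have "(\<lambda>n. inverse (real (Suc n)) * norm x) \<longlonglongrightarrow> 0" by simp
    then have "(\<lambda>n. T x - fc (s n) x) \<longlonglongrightarrow> 0"
      by (rule Lim_null_comparison[OF always_eventually[OF allI[OF est]]])
    from tendsto_diff[OF tendsto_const[of "T x"] this] show ?thesis by simp
  qed
  show ?thesis
    using Y.tendsto[OF lim[of x]] lim[of "Y x"] unfolding comm by (rule LIMSEQ_unique)
qed

end

context von_neumann
begin

lemma M_fc: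
  assumes T: "positive_contraction T" "T \<in> M" and f: "bfun f"
  shows "positive_contraction.fc T f \<in> M"
proof -
  interpret positive_contraction T by fact
  note Ts = bounded_clinear_simps[OF M_bounded_clinear[OF T(2)]]
  show ?thesis
  proof (rule M_I)
    show "bounded_clinear (fc f)"
      unfolding bounded_clinear_def
      using bounded_linear_fc[OF f] fc_commute[OF f bounded_linear_scaleC] Ts(6) by metis
    show "fc f (S x) = S (fc f x)" if "S \<in> commutant M" for S x
      using fc_commute[OF f bounded_clinear_linear[OF commutant_bounded_clinear[OF that]], of x]
        M_commute[OF T(2) that] by simp
  qed
qed

lemma M_scaleR: "S \<in> M \<Longrightarrow> (\<lambda>x. r *\<^sub>R S x) \<in> M"
  using M_scale[of S "of_real r"] by (simp add: scaleC_of_real)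

text \<open>If all corners \<open>e Y (s - e)\<close> vanish, every projection below
  \<open>s\<close> commutes with the compressions \<open>s Y s\<close>. This applies to spectral
  projections of self-adjoint compressions, so all compressions commute and \<open>s\<close> is
  abelian.\<close>

lemma off_diagonal_exists:
  assumes s: "s \<in> projections M" and nab: "\<not> abelian_proj M s"
  shows "\<exists>e\<in>projections M. \<exists>Y\<in>M. proj_le e s \<and> (\<exists>x. e (Y (s x - e x)) \<noteq> 0)"
proof (rule ccontr)
  assume "\<not> ?thesis"
  then have hyp: "e (Y (s x - e x)) = 0" if "e \<in> projections M" "Y \<in> M" "proj_le e s" for e Y x
    using that by blast
  note sD = projections_D[OF s]
  note ss = bounded_clinear_simps[OF projectionD(1)[OF sD(2)]]
  have c1: "e (s (Y (s x))) = s (Y (s (e x)))" if e: "e \<in> projections M" "proj_le e s" and Y: "Y \<in> M" for e Y x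
  proof -
    note eD = projections_D[OF e(1)]
    note es = bounded_clinear_simps[OF projectionD(1)[OF eD(2)]]
    note bY = M_bounded_clinear[OF Y]
    note Ys = bounded_clinear_simps[OF bY]
    have es_e: "e (s y) = e y" for y by (rule proj_le_comp[OF eD(2) sD(2) e(2)])
    have s_e: "s (e y) = e y" for y using e(2) by (simp add: proj_le_iff)
    have "e (Y (s x)) = e (Y (e x))" using hyp[OF e(1) Y e(2), of x] by (simp add: es Ys)
    \<comment> \<open>The opposite corner vanishes as well: it is the adjoint of the corner of
      \<open>cadj Y\<close>.\<close>
    moreover have "s (Y (e x)) = e (Y (e x))"
    proof (rule iffD1[OF vector_eq_ldot, OF allI])
      fix y
      have "e (cadj Y (s y - e y)) = 0" by (rule hyp[OF e(1) M_cadj[OF Y] e(2)])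
      then have "inner (e (cadj Y (s y - e y))) x = 0" by simp
      then have "inner (s y - e y) (Y (e x)) = 0" by (simp add: eD(4) inner_cadj_left[OF bY])
      then show "inner y (s (Y (e x))) = inner y (e (Y (e x)))" by (simp add: inner_diff sD(4) eD(4))
    qed
    ultimately show ?thesis by (simp add: es_e s_e)
  qed
  have c2: "s (Y (s (s (W (s x))))) = s (W (s (s (Y (s x)))))"
    if Y: "Y \<in> M" and W: "W \<in> M" and sa: "\<And>x y. inner (W x) y = inner x (W y)" for Y W x
  proof -
    let ?A = "\<lambda>x. s (W (s x))" and ?Y = "\<lambda>x. s (Y (s x))"
    have AM: "?A \<in> M" and YM: "?Y \<in> M" using M_comp sD(1) W Y by (auto simp: comp_def)
    note bA = M_bounded_clinear[OF AM] and bY = M_bounded_clinear[OF YM]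
    note As = bounded_clinear_simps[OF bA] and Ys = bounded_clinear_simps[OF bY]
    obtain K where K: "0 < K" "\<And>x. norm (?A x) \<le> norm x * K"
      using bounded_linear.pos_bounded[OF bounded_clinear_linear[OF bA]] by blast
    have Asa: "inner (?A x) y = inner x (?A y)" for x y by (simp add: sD(4) sa)
    have Ab: "\<bar>inner (?A x) x\<bar> \<le> K * inner x x" for x
    proof -
      have "\<bar>inner (?A x) x\<bar> \<le> norm (?A x) * norm x" by (rule Cauchy_Schwarz_ineq2)
      also have "\<dots> \<le> (norm x * K) * norm x" by (intro mult_right_mono K) simp
      finally show ?thesis by (simp add: power2_norm_eq_inner[symmetric] power2_eq_square mult_ac)
    qed
    \<comment> \<open>As \<open>?A\<close> lies between \<open>- K\<close> and \<open>K\<close>, the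
      operator \<open>r (?A + K)\<close> lies between 0 and 1.\<close>
    define r where "r = 1 / (2 * K)"
    have r: "0 < r" "r * K = 1 / 2" using K(1) by (simp_all add: r_def)
    let ?B = "\<lambda>x. r *\<^sub>R (?A x + K *\<^sub>R x)"
    have BM: "?B \<in> M" using M_scaleR[OF M_add[OF AM M_scaleR[OF M_id, of K]], of r] by simp
    interpret B: positive_contraction ?B
    proof (rule positive_contraction.intro)
      show "bounded_linear ?B" by (rule bounded_clinear_linear[OF M_bounded_clinear[OF BM]])
      show "inner (?B x) y = inner x (?B y)" for x y by (simp add: inner_add Asa[simplified])
      fix x
      have "inner (?B x) x = r * (inner (?A x) x + K * inner x x)" by (simp add: inner_add)
      moreover have "0 \<le> inner (?A x) x + K * inner x x" "inner (?A x) x + K * inner x x \<le> 2 * K * inner x x"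
        using Ab[of x] by (simp_all add: abs_le_iff)
      moreover have "r * (2 * K * inner x x) = inner x x" using K(1) by (simp add: r_def)
      ultimately show "0 \<le> inner (?B x) x" "inner (?B x) x \<le> inner x x"
        using r(1) mult_left_mono[of "inner (?A x) x + K * inner x x" "2 * K * inner x x" r]
        by (simp_all only: mult_nonneg_nonneg less_imp_le)
    qed
    have "?Y (?B x) = ?B (?Y x)"
    proof (rule B.commute_if_commute_spectral[OF bounded_clinear_linear[OF bY]])
      fix l x
      let ?P = "B.fc (indicator {l<..})"
      have b: "bfun (indicator {l<..})" by (rule bfun_greaterThan)
      have PM: "?P \<in> M" by (rule M_fc[OF B.positive_contraction_axioms BM b])
      have Pp: "?P \<in> projections M"
        using B.is_sp_greaterThan[of l] PM M_bounded_clinear[OF PM]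
        by (intro projections_I) (auto simp: projection_iff B.is_sp_def)
      have Ps: "s (?P y) = ?P (s y)" for y
        by (rule B.fc_commute[OF b]) (auto simp: bounded_clinear_linear projectionD(1)[OF sD(2)] ss sD(3))
      \<comment> \<open>\<open>?P\<close> need not lie below \<open>s\<close>, but it commutes with
        \<open>s\<close>, so its product with \<open>s\<close> is a projection below
        \<open>s\<close> that acts on compressions as \<open>?P\<close> does.\<close>
      have e: "?P \<circ> s \<in> projections M" "proj_le (?P \<circ> s) s"
        using projections_commuting_comp[OF Pp s] Ps by (auto simp: proj_le_iff sD(3))
      show "?Y (?P x) = ?P (?Y x)"
        using c1[OF e Y, of x] by (simp add: sD(3) Ps)
    qed
    then have "r *\<^sub>R (?Y (?A x) + K *\<^sub>R ?Y x) = r *\<^sub>R (?A (?Y x) + K *\<^sub>R ?Y x)"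
      unfolding Ys(5) Ys(1) .
    then show ?thesis using r(1) by simp
  qed
  have "s (Y (s (s (S (s x))))) = s (S (s (s (Y (s x)))))" if S: "S \<in> M" and Y: "Y \<in> M" for S Y x
  proof -
    note bS = M_bounded_clinear[OF S] and bS' = M_bounded_clinear[OF M_cadj[OF S]]
    note Ys = bounded_clinear_simps[OF M_bounded_clinear[OF Y]]
    \<comment> \<open>The general case follows from the self-adjoint elements
      \<open>S + cadj S\<close> and \<open>\<i> (S - cadj S)\<close>.\<close>
    have "s (Y (s (s (S (s x) + cadj S (s x))))) = s (S (s (s (Y (s x)))) + cadj S (s (s (Y (s x)))))"
      by (rule c2[OF Y M_add[OF S M_cadj[OF S]]])
        (simp add: inner_add inner_cadj[OF bS] inner_cadj_left[OF bS])
    then have 1: "s (Y (s (s (S (s x))))) + s (Y (s (s (cadj S (s x))))) = s (S (s (s (Y (s x))))) + s (cadj S (s (s (Y (s x)))))"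
      by (simp add: ss Ys)
    have "s (Y (s (s (\<i> *\<^sub>C (S (s x) - cadj S (s x)))))) = s (\<i> *\<^sub>C (S (s (s (Y (s x)))) - cadj S (s (s (Y (s x))))))"
      by (rule c2[OF Y M_scale[OF M_diff[OF S M_cadj[OF S]]]])
        (simp add: inner_diff inner_cadj[OF bS] inner_cadj_left[OF bS] inner_scaleC_left scaleC_minus_left
          bounded_clinear_simps[OF bS] bounded_clinear_simps[OF bS'] scaleC_diff_right)
    then have "(- \<i>) *\<^sub>C \<i> *\<^sub>C (s (Y (s (s (S (s x))))) - s (Y (s (s (cadj S (s x))))))
        = (- \<i>) *\<^sub>C \<i> *\<^sub>C (s (S (s (s (Y (s x))))) - s (cadj S (s (s (Y (s x))))))"
      by (simp add: ss Ys)
    then have 2: "s (Y (s (s (S (s x))))) - s (Y (s (s (cadj S (s x))))) = s (S (s (s (Y (s x))))) - s (cadj S (s (s (Y (s x)))))"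
      unfolding scaleC_scaleC by simp
    show ?thesis by (rule eq_if_sum_diff_eq[OF 1 2])
  qed
  then have "abelian_proj M s" using s by (auto simp: abelian_proj_def fun_eq_iff)
  then show False using nab by blast
qed

text \<open>With \<open>g(t) = t\<^sup>-\<^sup>1\<^sup>/\<^sup>2\<close> on \<open>(\<epsilon>, 1]\<close> and \<open>0\<close> elsewhere, \<open>X g(X\<^sup>* X)\<close> is a partial isometry.\<close>

lemma partial_isometry_of_nilpotent_contraction:
  assumes X: "X \<in> M" and le: "\<And>x. norm (X x) \<le> norm x" and nz: "X x0 \<noteq> 0" and nil: "\<And>x. X (X x) = 0"
  shows "\<exists>e\<in>projections M. \<exists>f\<in>projections M. mvn_equiv M e f \<and> e \<noteq> zero_op \<and> e \<circ> f = zero_op \<and>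
    (\<forall>s. projection s \<longrightarrow> (\<forall>x. s (X x) = X x) \<longrightarrow> (\<forall>x. X (s x) = X x) \<longrightarrow> proj_le e s \<and> proj_le f s)"
proof -
  note bX = M_bounded_clinear[OF X]
  note Xs = bounded_clinear_simps[OF bX] and X's = bounded_clinear_simps[OF bounded_clinear_cadj[OF bX]]
  let ?T = "\<lambda>x. cadj X (X x)"
  have TM: "?T \<in> M" using M_comp[OF M_cadj[OF X] X] by (simp add: comp_def)
  have Tq: "inner (?T x) x = (norm (X x))\<^sup>2" for x
    by (simp add: inner_cadj_left[OF bX] power2_norm_eq_inner)
  interpret T: positive_contraction ?T
  proof (rule positive_contraction.intro)
    show "bounded_linear ?T" by (rule bounded_clinear_linear[OF M_bounded_clinear[OF TM]])
    show "inner (?T x) y = inner x (?T y)" for x y by (simp add: inner_cadj_left[OF bX] inner_cadj[OF bX])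
    show "0 \<le> inner (?T x) x" for x by (simp add: Tq)
    show "inner (?T x) x \<le> inner x x" for x
      using power_mono[OF le[of x], of 2] by (simp add: Tq power2_norm_eq_inner)
  qed
  have x0: "x0 \<noteq> 0" using nz Xs(4) by auto
  \<comment> \<open>Half the mean of \<open>t\<close> under the normalised scalar measure of
    \<open>x0\<close>. If the cut at \<open>\<epsilon>\<close> removed everything, this mean could
    not exceed \<open>\<epsilon>\<close>; hence \<open>P\<close> is nonzero.\<close>
  define \<epsilon> where "\<epsilon> = (norm (X x0))\<^sup>2 / (2 * inner x0 x0)"
  have ep: "0 < \<epsilon>" using nz x0 by (simp add: \<epsilon>_def)
  define g where "g t = indicator {\<epsilon><..} t * (1 / sqrt (max t \<epsilon>))" for t :: real
  let ?i = "indicator {\<epsilon><..} :: real \<Rightarrow> real"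
  have bi: "bfun ?i" by (rule bfun_greaterThan)
  have bg: "bfun g"
    unfolding g_def
  proof (intro bfun_mult bfun_greaterThan bfun_continuous)
    show "continuous_on {0..1} (\<lambda>t. 1 / sqrt (max t \<epsilon>))"
      using ep by (intro continuous_intros) (auto simp: max_def)
  qed measurable
  define G where "G = T.fc g"
  define P where "P = T.fc ?i"
  have GM: "G \<in> M" unfolding G_def by (rule M_fc[OF T.positive_contraction_axioms TM bg])
  have PM: "P \<in> M" unfolding P_def by (rule M_fc[OF T.positive_contraction_axioms TM bi])
  have Gsa: "inner (G x) y = inner x (G y)" for x y unfolding G_def by (rule T.fc_selfadjoint[OF bg])
  note bG = M_bounded_clinear[OF GM]
  have adjG: "cadj G = G" by (rule cadj_eqI_inner[OF bG Gsa])
  have Pp: "P \<in> projections M"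
    using T.is_sp_greaterThan[of \<epsilon>] PM M_bounded_clinear[OF PM] unfolding P_def
    by (intro projections_I) (auto simp: projection_iff T.is_sp_def)
  have gg: "g t * (t * g t) = ?i t" if "t \<in> {0..1}" for t
    using ep that by (auto simp: g_def indicator_def max_def real_sqrt_mult_self field_simps)
  have GTG: "G (?T (G x)) = P x" for x
  proof -
    have "G (?T (G x)) = T.fc (\<lambda>t. g t * (t * g t)) x"
      by (simp add: G_def T.fc_mult bg bfun_id bfun_mult T.fc_id)
    also have "\<dots> = P x"
      unfolding P_def by (rule T.fc_cong) (auto intro!: bfun_mult bg bfun_id bfun_measurable[OF bi] simp: gg)
    finally show ?thesis .
  qed
  have TGG: "?T (G (G x)) = P x" and GGT: "G (G (?T x)) = P x" for x
  proof -
    have "?T (G (G x)) = T.fc (\<lambda>t. t * (g t * g t)) x" "G (G (?T x)) = T.fc (\<lambda>t. g t * (g t * t)) x"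
      by (simp_all add: G_def T.fc_mult bg bfun_id bfun_mult T.fc_id)
    moreover have "T.fc (\<lambda>t. t * (g t * g t)) x = P x" "T.fc (\<lambda>t. g t * (g t * t)) x = P x"
      unfolding P_def
      by (rule T.fc_cong; auto intro!: bfun_mult bg bfun_id bfun_measurable[OF bi] simp: gg[symmetric] mult_ac)+
    ultimately show "?T (G (G x)) = P x" "G (G (?T x)) = P x" by simp_all
  qed
  have GP: "G (P x) = G x" for x
  proof -
    have "G (P x) = T.fc (\<lambda>t. g t * ?i t) x" by (simp add: G_def P_def T.fc_mult bg bi)
    also have "(\<lambda>t. g t * ?i t) = g" by (auto simp: g_def fun_eq_iff indicator_def)
    finally show ?thesis by (simp add: G_def)
  qed
  have Pnz: "P \<noteq> zero_op"
  proof
    assume "P = zero_op"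
    then have "(\<integral>t. ?i t \<partial>T.spm x0) = 0"
      using T.fc_inner[OF bi, of x0] by (simp add: P_def zero_op_def)
    then have "AE t in T.spm x0. ?i t = 0"
      by (subst (asm) integral_nonneg_eq_0_iff_AE[OF T.bfun_integrable[OF bi]]) auto
    then have le_ep: "AE t in T.spm x0. t \<le> \<epsilon>" by eventually_elim (auto simp: indicator_def split: if_splits)
    have "(norm (X x0))\<^sup>2 = (\<integral>t. t \<partial>T.spm x0)" using T.fc_inner[OF bfun_id, of x0] by (simp add: T.fc_id Tq)
    also have "\<dots> \<le> (\<integral>t. \<epsilon> \<partial>T.spm x0)"
      by (rule integral_mono_AE[OF T.bfun_integrable[OF bfun_id] T.bfun_integrable[OF bfun_const] le_ep])
    also have "\<dots> = (norm (X x0))\<^sup>2 / 2" using x0 by (simp add: T.measure_spm_UNIV \<epsilon>_def)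
    finally show False using nz by simp
  qed
  define v where "v = X \<circ> G"
  have vM: "v \<in> M" unfolding v_def by (rule M_comp[OF X GM])
  have v': "cadj v = G \<circ> cadj X" unfolding v_def by (simp add: cadj_comp[OF bX bG] adjG)
  have vv: "cadj v \<circ> v = P" unfolding v' by (auto simp: v_def fun_eq_iff GTG)
  define f where "f = v \<circ> cadj v"
  note bv = M_bounded_clinear[OF vM]
  have fM: "f \<in> M" unfolding f_def by (rule M_comp[OF vM M_cadj[OF vM]])
  have fx: "f x = X (G (G (cadj X x)))" for x
    unfolding f_def v' comp_apply by (simp add: v_def)
  have "f (f x) = f x" for x
  proof -
    have "f (f x) = X (G (G (?T (G (G (cadj X x))))))" by (simp add: fx)
    also have "\<dots> = f x" by (simp add: TGG GP fx)
    finally show ?thesis .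
  qed
  moreover have "inner (f x) y = inner x (f y)" for x y
    by (simp add: f_def inner_cadj[OF bv] inner_cadj_left[OF bv])
  ultimately have fp: "f \<in> projections M"
    by (intro projections_I fM) (simp add: projection_iff M_bounded_clinear[OF fM])
  \<comment> \<open>The range of \<open>f\<close> lies in that of \<open>X\<close>, which
    \<open>X\<close> kills by nilpotency, and \<open>P\<close> factors through \<open>X\<close> as
    \<open>G\<^sup>2 (cadj X) X\<close>.\<close>
  have "P (f x) = 0" for x
  proof -
    have "P (f x) = G (G (cadj X (X (f x))))" by (simp add: GGT)
    also have "X (f x) = 0" by (simp add: fx nil)
    finally show ?thesis by (simp add: X's bounded_clinear_simps[OF bG])
  qed
  then have "P \<circ> f = zero_op" by (auto simp: fun_eq_iff zero_op_def)
  moreover have "mvn_equiv M P f" unfolding mvn_equiv_def using vM vv f_def by blast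
  moreover have "proj_le P s \<and> proj_le f s"
    if s: "projection s" and sX: "\<And>x. s (X x) = X x" and Xs: "\<And>x. X (s x) = X x" for s
  proof -
    have "s (cadj X x) = cadj X x" for x
    proof (rule iffD1[OF vector_eq_ldot, OF allI])
      fix y
      show "inner y (s (cadj X x)) = inner y (cadj X x)"
        using projectionD(3)[OF s, of y "cadj X x"] by (simp add: Xs flip: inner_cadj[OF bX])
    qed
    then show ?thesis by (auto simp: proj_le_iff fx sX simp flip: TGG)
  qed
  ultimately show ?thesis using Pp fp Pnz by blast
qed

text \<open>Rescaling to a contraction changes neither nilpotency nor the projections
  \<open>s\<close> that carry \<open>X\<close> on both sides.\<close>

lemma partial_isometry_of_nilpotent:
  assumes X: "X \<in> M" and nz: "X x0 \<noteq> 0" and nil: "\<And>x. X (X x) = 0"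
  shows "\<exists>e\<in>projections M. \<exists>f\<in>projections M. mvn_equiv M e f \<and> e \<noteq> zero_op \<and> e \<circ> f = zero_op \<and>
    (\<forall>s. projection s \<longrightarrow> (\<forall>x. s (X x) = X x) \<longrightarrow> (\<forall>x. X (s x) = X x) \<longrightarrow> proj_le e s \<and> proj_le f s)"
proof -
  note Xs = bounded_clinear_simps[OF M_bounded_clinear[OF X]]
  obtain K where K: "0 < K" "\<And>x. norm (X x) \<le> norm x * K"
    using bounded_linear.pos_bounded[OF bounded_clinear_linear[OF M_bounded_clinear[OF X]]] by blast
  let ?X = "\<lambda>x. (1 / K) *\<^sub>R X x"
  have "norm (?X x) \<le> norm x" for x using K(1) K(2)[of x] by (simp add: field_simps)
  moreover have "?X x0 \<noteq> 0" using nz K(1) by simp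
  moreover have "?X (?X x) = 0" for x by (simp add: Xs nil)
  ultimately obtain e f where ef: "e \<in> projections M" "f \<in> projections M" "mvn_equiv M e f" "e \<noteq> zero_op" "e \<circ> f = zero_op"
    and s: "\<forall>s. projection s \<longrightarrow> (\<forall>x. s (?X x) = ?X x) \<longrightarrow> (\<forall>x. ?X (s x) = ?X x) \<longrightarrow> proj_le e s \<and> proj_le f s"
    using partial_isometry_of_nilpotent_contraction[OF M_scaleR[OF X], of "1 / K" x0] by blast
  have "proj_le e s \<and> proj_le f s" if "projection s" "\<And>x. s (X x) = X x" "\<And>x. X (s x) = X x" for s
    by (rule s[rule_format]) (use that in \<open>simp_all add: bounded_clinear_simps[OF projectionD(1)]\<close>)
  then show ?thesis using ef by blast
qed

text \<open>The corner \<open>e Y (s - e)\<close> squares to zero because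
  \<open>(s - e) e = 0\<close>, so a partial isometry cut from it links two orthogonal projections
  below \<open>s\<close>.\<close>

lemma nonabelian_split:
  assumes s: "s \<in> projections M" and nab: "\<not> abelian_proj M s"
  shows "\<exists>e\<in>projections M. \<exists>f\<in>projections M. mvn_equiv M e f \<and> e \<noteq> zero_op \<and> e \<circ> f = zero_op \<and>
    proj_le e s \<and> proj_le f s"
proof -
  obtain e Y x where e: "e \<in> projections M" "proj_le e s" and Y: "Y \<in> M" and nz: "e (Y (s x - e x)) \<noteq> 0"
    using off_diagonal_exists[OF s nab] by blast
  note sD = projections_D[OF s] and eD = projections_D[OF e(1)]
  note ss = bounded_clinear_simps[OF projectionD(1)[OF sD(2)]] and es = bounded_clinear_simps[OF projectionD(1)[OF eD(2)]]
    and Ys = bounded_clinear_simps[OF M_bounded_clinear[OF Y]]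
  have s_e: "s (e y) = e y" "e (s y) = e y" for y
    using e(2) proj_le_comp[OF eD(2) sD(2) e(2)] by (auto simp: proj_le_iff)
  let ?X = "\<lambda>x. e (Y (s x - e x))"
  have "e \<circ> (Y \<circ> (\<lambda>x. s x - e x)) \<in> M" by (intro M_comp M_diff sD(1) eD(1) Y)
  then have XM: "?X \<in> M" by (simp add: comp_def)
  have "?X (?X y) = 0" for y by (simp add: s_e eD(3) Ys es ss)
  from partial_isometry_of_nilpotent[OF XM nz this]
  obtain e' f' where "e' \<in> projections M" "f' \<in> projections M" "mvn_equiv M e' f'" "e' \<noteq> zero_op" "e' \<circ> f' = zero_op"
    and "\<And>s. projection s \<Longrightarrow> (\<And>x. s (?X x) = ?X x) \<Longrightarrow> (\<And>x. ?X (s x) = ?X x) \<Longrightarrow> proj_le e' s \<and> proj_le f' s"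
    by metis
  moreover have "proj_le e' s \<and> proj_le f' s"
    by (rule calculation(6)) (simp_all add: sD s_e)
  ultimately show ?thesis by blast
qed

end

section \<open>Halving of dimensions\<close>

lemma
  assumes "dimension_function M \<phi> \<mu> D"
  shows dim_measurable: "p \<in> projections M \<Longrightarrow> D p \<in> borel_measurable \<mu>"
    and dim_nonzero: "p \<in> projections M \<Longrightarrow> AE \<omega> in \<mu>. D p \<omega> = 0 \<Longrightarrow> p = zero_op"
    and dim_finite_iff: "p \<in> projections M \<Longrightarrow> (AE \<omega> in \<mu>. D p \<omega> < \<infinity>) \<longleftrightarrow> finite_proj M p"
    and dim_add: "p \<in> projections M \<Longrightarrow> q \<in> projections M \<Longrightarrow> p \<circ> q = zero_op \<Longrightarrow> is_proj_sup M {p, q} r \<Longrightarrow>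
      AE \<omega> in \<mu>. D r \<omega> = D p \<omega> + D q \<omega>"
    and dim_equiv: "p \<in> projections M \<Longrightarrow> q \<in> projections M \<Longrightarrow> mvn_equiv M p q \<Longrightarrow> AE \<omega> in \<mu>. D p \<omega> = D q \<omega>"
    and dim_center: "z \<in> projections (center M) \<Longrightarrow> p \<in> projections M \<Longrightarrow>
      AE \<omega> in \<mu>. D (z \<circ> p) \<omega> = ennreal (Re (\<phi> z \<omega>)) * D p \<omega>"
    and dim_sup_upper: "S \<subseteq> projections M \<Longrightarrow> directed_projs S \<Longrightarrow> is_proj_sup M S p \<Longrightarrow> q \<in> S \<Longrightarrow>
      AE \<omega> in \<mu>. D q \<omega> \<le> D p \<omega>"
    and dim_sup_least: "S \<subseteq> projections M \<Longrightarrow> directed_projs S \<Longrightarrow> is_proj_sup M S p \<Longrightarrow> g \<in> borel_measurable \<mu> \<Longrightarrow>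
      (\<And>q. q \<in> S \<Longrightarrow> AE \<omega> in \<mu>. D q \<omega> \<le> g \<omega>) \<Longrightarrow> AE \<omega> in \<mu>. D p \<omega> \<le> g \<omega>"
  using assms unfolding dimension_function_def by meson+

context von_neumann
begin

lemma finite_proj_zero: "finite_proj M zero_op"
  unfolding finite_proj_def
proof (intro conjI ballI impI projections_zero)
  fix q assume "proj_le q (zero_op :: 'h op) \<and> mvn_equiv M zero_op q"
  then show "q = zero_op" by (auto simp: proj_le_iff zero_op_def fun_eq_iff)
qed

text \<open>Additivity for \<open>0 + 0\<close> only gives \<open>D = D + D\<close>, which
  \<infinity> satisfies too; finiteness of the zero projection excludes that value.\<close>

lemma dim_zero:
  assumes df: "dimension_function M \<phi> \<mu> D"
  shows "AE \<omega> in \<mu>. D zero_op \<omega> = 0"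
proof -
  have o: "zero_op \<circ> zero_op = (zero_op :: 'h op)" by (auto simp: zero_op_def)
  have "is_proj_sup M {zero_op, zero_op} zero_op"
    using projections_add(2)[OF projections_zero projections_zero o] by (simp add: zero_op_def)
  from dim_add[OF df projections_zero projections_zero o this]
  have "AE \<omega> in \<mu>. D zero_op \<omega> = D zero_op \<omega> + D zero_op \<omega>" .
  moreover have "AE \<omega> in \<mu>. D zero_op \<omega> < \<infinity>"
    using dim_finite_iff[OF df projections_zero] finite_proj_zero by simp
  ultimately show ?thesis
  proof eventually_elim
    fix \<omega> assume "D zero_op \<omega> = D zero_op \<omega> + D zero_op \<omega>" "D zero_op \<omega> < \<infinity>"
    then show "D zero_op \<omega> = 0" by (cases "D zero_op \<omega>") (auto simp flip: ennreal_plus)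
  qed
qed

lemma orthogonal_sum:
  fixes c :: "'i \<Rightarrow> 'h op"
  assumes "finite G" "\<And>q. q \<in> G \<Longrightarrow> c q \<in> projections M"
    and "\<And>q q'. q \<in> G \<Longrightarrow> q' \<in> G \<Longrightarrow> q \<noteq> q' \<Longrightarrow> c q \<circ> c q' = zero_op"
  shows "(\<lambda>x. \<Sum>q\<in>G. c q x) \<in> projections M \<and>
    (\<forall>\<phi> \<mu> (D :: 'h op \<Rightarrow> 'w \<Rightarrow> ennreal). dimension_function M \<phi> \<mu> D \<longrightarrow>
      (AE \<omega> in \<mu>. D (\<lambda>x. \<Sum>q\<in>G. c q x) \<omega> = (\<Sum>q\<in>G. D (c q) \<omega>)))"
  using assms
proof (induction G rule: finite_induct)
  case empty
  have "(\<lambda>x. \<Sum>q\<in>{}. c q x) = zero_op" by (simp add: zero_op_def)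
  then show ?case using projections_zero dim_zero by auto
next
  case (insert q G)
  let ?s = "\<lambda>x. \<Sum>q\<in>G. c q x"
  have s: "?s \<in> projections M" using insert by blast
  have q: "c q \<in> projections M" using insert by blast
  have z: "c q (c q' x) = 0" if "q' \<in> G" for q' x
    using insert.prems(2)[of q q'] that insert.hyps by (auto simp: fun_eq_iff zero_op_def)
  have "c q (?s x) = (\<Sum>q'\<in>G. c q (c q' x))" for x
    by (rule linear_sum[OF bounded_linear.linear[OF bounded_clinear_linear[OF projectionD(1)[OF projections_D(2)[OF q]]]]])
  then have o: "c q \<circ> ?s = zero_op" by (auto simp: fun_eq_iff zero_op_def z)
  have eq: "(\<lambda>x. \<Sum>q\<in>insert q G. c q x) = (\<lambda>x. c q x + ?s x)" using insert.hyps by simp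
  show ?case
    unfolding eq
  proof (intro conjI allI impI projections_add(1)[OF q s o])
    fix \<phi> \<mu> and D :: "'h op \<Rightarrow> 'w \<Rightarrow> ennreal" assume df: "dimension_function M \<phi> \<mu> D"
    have "AE \<omega> in \<mu>. D ?s \<omega> = (\<Sum>q\<in>G. D (c q) \<omega>)" using insert df by blast
    with dim_add[OF df q s o projections_add(2)[OF q s o]]
    show "AE \<omega> in \<mu>. D (\<lambda>x. c q x + ?s x) \<omega> = (\<Sum>q\<in>insert q G. D (c q) \<omega>)"
      by eventually_elim (use insert.hyps in simp)
  qed
qed

text \<open>The index set may be uncountable. The finite partial sums form a directed set, to which
  the normality clause of dimension functions applies; the last two properties make
  \<open>D Q\<close> the least upper bound of the finite sums of dimensions.\<close>

lemma orthogonal_family_sup: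
  fixes c :: "'i \<Rightarrow> 'h op"
  assumes c: "\<And>q. q \<in> F \<Longrightarrow> c q \<in> projections M"
    and o: "\<And>q q'. q \<in> F \<Longrightarrow> q' \<in> F \<Longrightarrow> q \<noteq> q' \<Longrightarrow> c q \<circ> c q' = zero_op"
  obtains Q where "Q \<in> projections M" "\<And>q. q \<in> F \<Longrightarrow> proj_le (c q) Q"
    "\<And>f. f \<in> projections M \<Longrightarrow> (\<And>q. q \<in> F \<Longrightarrow> f \<circ> c q = zero_op) \<Longrightarrow> f \<circ> Q = zero_op"
    "\<And>r. r \<in> projections M \<Longrightarrow> (\<And>q. q \<in> F \<Longrightarrow> proj_le (c q) r) \<Longrightarrow> proj_le Q r"
    "\<And>\<phi> \<mu> (D :: 'h op \<Rightarrow> 'w \<Rightarrow> ennreal) G. dimension_function M \<phi> \<mu> D \<Longrightarrow> finite G \<Longrightarrow> G \<subseteq> F \<Longrightarrow>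
      AE \<omega> in \<mu>. (\<Sum>q\<in>G. D (c q) \<omega>) \<le> D Q \<omega>"
    "\<And>\<phi> \<mu> (D :: 'h op \<Rightarrow> 'w \<Rightarrow> ennreal) g. dimension_function M \<phi> \<mu> D \<Longrightarrow> g \<in> borel_measurable \<mu> \<Longrightarrow>
      (\<And>G. finite G \<Longrightarrow> G \<subseteq> F \<Longrightarrow> AE \<omega> in \<mu>. (\<Sum>q\<in>G. D (c q) \<omega>) \<le> g \<omega>) \<Longrightarrow> AE \<omega> in \<mu>. D Q \<omega> \<le> g \<omega>"
proof -
  define sm where "sm G = (\<lambda>x. \<Sum>q\<in>G. c q x)" for G
  define S where "S = {sm G | G. finite G \<and> G \<subseteq> F}"
  have smP: "sm G \<in> projections M" if "finite G" "G \<subseteq> F" for G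
    using orthogonal_sum[of G c] that c o unfolding sm_def by blast
  have smD: "AE \<omega> in \<mu>. D (sm G) \<omega> = (\<Sum>q\<in>G. D (c q) \<omega>)"
    if "dimension_function M \<phi> \<mu> D" "finite G" "G \<subseteq> F" for \<phi> \<mu> G and D :: "'h op \<Rightarrow> 'w \<Rightarrow> ennreal"
    using orthogonal_sum[of G c] that c o unfolding sm_def by blast
  have le: "sm G (c q x) = c q x" if "finite G" "G \<subseteq> F" "q \<in> G" for G q x
  proof -
    have "c q' (c q x) = (if q' = q then c q x else 0)" if "q' \<in> G" for q'
      using o[of q' q] projections_D(3)[OF c[of q]] that \<open>G \<subseteq> F\<close> \<open>q \<in> G\<close> by (auto simp: fun_eq_iff zero_op_def)
    then have "sm G (c q x) = (\<Sum>q'\<in>G. if q' = q then c q x else 0)" unfolding sm_def by (intro sum.cong) auto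
    then show ?thesis using that by simp
  qed
  have mono: "proj_le (sm G) (sm H)" if "finite H" "H \<subseteq> F" "G \<subseteq> H" for G H
  proof -
    have lin: "linear (sm H)"
      using smP[OF that(1,2)] projections_D(2) projectionD(1) bounded_clinear_linear bounded_linear.linear by blast
    have "sm H (sm G x) = (\<Sum>q\<in>G. sm H (c q x))" for x
      unfolding sm_def[of G] by (rule linear_sum[OF lin])
    also have "(\<Sum>q\<in>G. sm H (c q x)) = sm G x" for x
      unfolding sm_def[of G] using le[OF that(1,2)] that(3) by (intro sum.cong) auto
    finally show ?thesis by (simp add: proj_le_iff)
  qed
  have SP: "S \<subseteq> projections M" using smP unfolding S_def by blast
  have dir: "directed_projs S"
    unfolding directed_projs_def
  proof (intro conjI ballI)
    show "S \<noteq> {}" unfolding S_def by blast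
    fix p q assume "p \<in> S" "q \<in> S"
    then obtain G H where "p = sm G" "finite G" "G \<subseteq> F" "q = sm H" "finite H" "H \<subseteq> F" unfolding S_def by blast
    then show "\<exists>r\<in>S. proj_le p r \<and> proj_le q r"
      using mono[of "G \<union> H" G] mono[of "G \<union> H" H] unfolding S_def by blast
  qed
  obtain Q where Q: "is_proj_sup M S Q" using proj_sup_exists[OF SP] by blast
  have QP: "Q \<in> projections M" using Q by (simp add: is_proj_sup_def)
  have one: "sm {q} = c q" for q by (simp add: sm_def)
  show ?thesis
  proof (rule that[OF QP])
    fix q assume "q \<in> F"
    then have "sm {q} \<in> S" unfolding S_def by blast
    then show "proj_le (c q) Q" using Q by (simp add: is_proj_sup_def one)
  next
    fix f assume f: "f \<in> projections M" "\<And>q. q \<in> F \<Longrightarrow> f \<circ> c q = zero_op"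
    show "f \<circ> Q = zero_op"
    proof (rule proj_sup_orthogonal[OF Q f(1)])
      fix p assume "p \<in> S"
      then obtain G where G: "p = sm G" "G \<subseteq> F" unfolding S_def by blast
      have "f (sm G x) = (\<Sum>q\<in>G. f (c q x))" for x
        unfolding sm_def
        by (rule linear_sum[OF bounded_linear.linear[OF bounded_clinear_linear[OF projectionD(1)[OF projections_D(2)[OF f(1)]]]]])
      moreover have "f (c q x) = 0" if "q \<in> G" for q x
        using f(2)[of q] G(2) that by (auto simp: fun_eq_iff zero_op_def)
      ultimately show "f \<circ> p = zero_op" by (auto simp: G(1) fun_eq_iff zero_op_def)
    qed
  next
    fix r assume r: "r \<in> projections M" "\<And>q. q \<in> F \<Longrightarrow> proj_le (c q) r"
    have "proj_le p r" if p: "p \<in> S" for p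
    proof -
      obtain G where G: "p = sm G" "G \<subseteq> F" using p unfolding S_def by blast
      have "r (sm G x) = (\<Sum>q\<in>G. r (c q x))" for x
        unfolding sm_def
        by (rule linear_sum[OF bounded_linear.linear[OF bounded_clinear_linear[OF projectionD(1)[OF projections_D(2)[OF r(1)]]]]])
      also have "(\<Sum>q\<in>G. r (c q x)) = sm G x" for x
        unfolding sm_def using r(2) G(2) by (intro sum.cong) (auto simp: proj_le_iff)
      finally show ?thesis by (simp add: proj_le_iff G(1))
    qed
    then show "proj_le Q r" using Q r(1) by (simp add: is_proj_sup_def)
  next
    fix \<phi> \<mu> and D :: "'h op \<Rightarrow> 'w \<Rightarrow> ennreal" and G
    assume df: "dimension_function M \<phi> \<mu> D" and G: "finite G" "G \<subseteq> F"
    then have "sm G \<in> S" unfolding S_def by blast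
    from dim_sup_upper[OF df SP dir Q this] smD[OF df G]
    show "AE \<omega> in \<mu>. (\<Sum>q\<in>G. D (c q) \<omega>) \<le> D Q \<omega>" by eventually_elim simp
  next
    fix \<phi> \<mu> and D :: "'h op \<Rightarrow> 'w \<Rightarrow> ennreal" and g
    assume df: "dimension_function M \<phi> \<mu> D" and g: "g \<in> borel_measurable \<mu>"
      and le: "\<And>G. finite G \<Longrightarrow> G \<subseteq> F \<Longrightarrow> AE \<omega> in \<mu>. (\<Sum>q\<in>G. D (c q) \<omega>) \<le> g \<omega>"
    show "AE \<omega> in \<mu>. D Q \<omega> \<le> g \<omega>"
    proof (rule dim_sup_least[OF df SP dir Q g])
      fix q assume "q \<in> S"
      then obtain G where G: "q = sm G" "finite G" "G \<subseteq> F" unfolding S_def by blast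
      from le[OF G(2,3)] smD[OF df G(2,3)] show "AE \<omega> in \<mu>. D q \<omega> \<le> g \<omega>"
        unfolding G(1) by eventually_elim simp
    qed
  qed
qed

text \<open>A maximal orthogonal family of pairs of equivalent projections below \<open>p\<close> exhausts \<open>p\<close>.  The suprema
  of the two halves have the same dimension by normality, so that no partial isometry between them has
  to be summed up.\<close>

theorem dimension_halving:
  assumes nab: "\<And>s. abelian_proj M s \<Longrightarrow> s = zero_op" and p: "p \<in> projections M"
  shows "\<exists>q\<in>projections M. \<forall>\<phi> \<mu> (D :: 'h op \<Rightarrow> 'w \<Rightarrow> ennreal). dimension_function M \<phi> \<mu> D \<longrightarrow>
    (AE \<omega> in \<mu>. D p \<omega> = 2 * D q \<omega>)"
proof -
  define good where "good q \<longleftrightarrow> fst q \<in> projections M \<and> snd q \<in> projections M \<and> mvn_equiv M (fst q) (snd q) \<and>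
    proj_le (fst q) p \<and> proj_le (snd q) p \<and> fst q \<circ> snd q = zero_op \<and> fst q \<noteq> zero_op" for q
  define ort where "ort q q' \<longleftrightarrow> fst q \<circ> fst q' = zero_op \<and> fst q \<circ> snd q' = zero_op \<and>
    snd q \<circ> fst q' = zero_op \<and> snd q \<circ> snd q' = zero_op" for q q' :: "'h op \<times> 'h op"
  define nice where "nice = {F. (\<forall>q\<in>F. good q) \<and> (\<forall>q\<in>F. \<forall>q'\<in>F. q \<noteq> q' \<longrightarrow> ort q q')}"
  have "\<exists>F\<in>nice. \<forall>X\<in>nice. F \<subseteq> X \<longrightarrow> X = F"
  proof (rule subset_Zorn')
    fix C assume C: "subset.chain nice C"
    then have sub: "C \<subseteq> nice" and lin: "\<And>X Y. X \<in> C \<Longrightarrow> Y \<in> C \<Longrightarrow> X \<subseteq> Y \<or> Y \<subseteq> X"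
      by (auto simp: subset_chain_def)
    have "ort q q'" if q: "q \<in> X" "X \<in> C" and q': "q' \<in> Y" "Y \<in> C" and ne: "q \<noteq> q'" for q q' X Y
    proof -
      obtain Z where "Z \<in> C" "q \<in> Z" "q' \<in> Z" using lin[OF q(2) q'(2)] q q' by blast
      then show ?thesis using sub ne unfolding nice_def by blast
    qed
    then show "\<Union>C \<in> nice" using sub unfolding nice_def by blast
  qed
  then obtain F where F: "F \<in> nice" and max: "\<And>X. X \<in> nice \<Longrightarrow> F \<subseteq> X \<Longrightarrow> X = F" by blast
  have good: "good q" if "q \<in> F" for q using F that unfolding nice_def by blast
  have ort: "ort q q'" if "q \<in> F" "q' \<in> F" "q \<noteq> q'" for q q' using F that unfolding nice_def by blast
  obtain Q where Q: "Q \<in> projections M" and Qle: "\<And>q. q \<in> F \<Longrightarrow> proj_le (fst q) Q"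
    and Qo: "\<And>f. f \<in> projections M \<Longrightarrow> (\<And>q. q \<in> F \<Longrightarrow> f \<circ> fst q = zero_op) \<Longrightarrow> f \<circ> Q = zero_op"
    and Qleast: "\<And>r. r \<in> projections M \<Longrightarrow> (\<And>q. q \<in> F \<Longrightarrow> proj_le (fst q) r) \<Longrightarrow> proj_le Q r"
    and QD1: "\<And>\<phi> \<mu> (D :: 'h op \<Rightarrow> 'w \<Rightarrow> ennreal) G. dimension_function M \<phi> \<mu> D \<Longrightarrow> finite G \<Longrightarrow> G \<subseteq> F \<Longrightarrow>
      AE \<omega> in \<mu>. (\<Sum>q\<in>G. D (fst q) \<omega>) \<le> D Q \<omega>"
    and QD2: "\<And>\<phi> \<mu> (D :: 'h op \<Rightarrow> 'w \<Rightarrow> ennreal) g. dimension_function M \<phi> \<mu> D \<Longrightarrow> g \<in> borel_measurable \<mu> \<Longrightarrow>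
      (\<And>G. finite G \<Longrightarrow> G \<subseteq> F \<Longrightarrow> AE \<omega> in \<mu>. (\<Sum>q\<in>G. D (fst q) \<omega>) \<le> g \<omega>) \<Longrightarrow> AE \<omega> in \<mu>. D Q \<omega> \<le> g \<omega>"
    by (rule orthogonal_family_sup[of F fst]) (use good ort in \<open>auto simp: good_def ort_def\<close>)
  obtain R where R: "R \<in> projections M" and Rle: "\<And>q. q \<in> F \<Longrightarrow> proj_le (snd q) R"
    and Ro: "\<And>f. f \<in> projections M \<Longrightarrow> (\<And>q. q \<in> F \<Longrightarrow> f \<circ> snd q = zero_op) \<Longrightarrow> f \<circ> R = zero_op"
    and Rleast: "\<And>r. r \<in> projections M \<Longrightarrow> (\<And>q. q \<in> F \<Longrightarrow> proj_le (snd q) r) \<Longrightarrow> proj_le R r"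
    and RD1: "\<And>\<phi> \<mu> (D :: 'h op \<Rightarrow> 'w \<Rightarrow> ennreal) G. dimension_function M \<phi> \<mu> D \<Longrightarrow> finite G \<Longrightarrow> G \<subseteq> F \<Longrightarrow>
      AE \<omega> in \<mu>. (\<Sum>q\<in>G. D (snd q) \<omega>) \<le> D R \<omega>"
    and RD2: "\<And>\<phi> \<mu> (D :: 'h op \<Rightarrow> 'w \<Rightarrow> ennreal) g. dimension_function M \<phi> \<mu> D \<Longrightarrow> g \<in> borel_measurable \<mu> \<Longrightarrow>
      (\<And>G. finite G \<Longrightarrow> G \<subseteq> F \<Longrightarrow> AE \<omega> in \<mu>. (\<Sum>q\<in>G. D (snd q) \<omega>) \<le> g \<omega>) \<Longrightarrow> AE \<omega> in \<mu>. D R \<omega> \<le> g \<omega>"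
    by (rule orthogonal_family_sup[of F snd]) (use good ort in \<open>auto simp: good_def ort_def\<close>)
  \<comment> \<open>Each first half is orthogonal to each second half, within a pair and across
    pairs, and both suprema inherit this.\<close>
  have QR: "Q \<circ> R = zero_op"
  proof (rule Ro[OF Q])
    fix q assume q: "q \<in> F"
    have gq: "fst q \<in> projections M" "snd q \<in> projections M" "fst q \<circ> snd q = zero_op"
      using good[OF q] by (auto simp: good_def)
    have "snd q \<circ> Q = zero_op"
    proof (rule Qo[OF gq(2)])
      fix q' assume q': "q' \<in> F"
      show "snd q \<circ> fst q' = zero_op"
        using projection_orth_sym[OF projections_D(2)[OF gq(1)] projections_D(2)[OF gq(2)] gq(3)] ort[OF q q']
        by (cases "q = q'") (auto simp: ort_def)
    qed
    then show "Q \<circ> snd q = zero_op"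
      using projection_orth_sym[OF projections_D(2)[OF gq(2)] projections_D(2)[OF Q]] by blast
  qed
  let ?t = "\<lambda>x. Q x + R x"
  note t = projections_add[OF Q R QR]
  have RQ: "R \<circ> Q = zero_op" by (rule projection_orth_sym[OF projections_D(2)[OF Q] projections_D(2)[OF R] QR])
  have Qp: "proj_le Q p" by (rule Qleast[OF p]) (use good in \<open>auto simp: good_def\<close>)
  have Rp: "proj_le R p" by (rule Rleast[OF p]) (use good in \<open>auto simp: good_def\<close>)
  have tp: "proj_le ?t p" using t(2) p Qp Rp by (auto simp: is_proj_sup_def)
  let ?s = "\<lambda>x. p x - ?t x"
  have s: "?s \<in> projections M" by (rule projections_diff[OF p t(1) tp])
  \<comment> \<open>A nonzero remainder of \<open>p\<close> would not be abelian, so it would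
    contain a further pair, against maximality.\<close>
  have "?s = zero_op"
  proof (rule ccontr)
    assume "?s \<noteq> zero_op"
    then have "\<not> abelian_proj M ?s" using nab by blast
    then obtain e f where ef: "e \<in> projections M" "f \<in> projections M" "mvn_equiv M e f" "e \<noteq> zero_op"
      "e \<circ> f = zero_op" "proj_le e ?s" "proj_le f ?s" using nonabelian_split[OF s] by blast
    have sp: "proj_le ?s p"
      using tp projections_D(3)[OF p] bounded_clinear_simps(2)[OF projectionD(1)[OF projections_D(2)[OF p]]]
      by (simp add: proj_le_iff)
    have sub: "proj_le g p \<and> g \<circ> Q = zero_op \<and> g \<circ> R = zero_op" if g: "g \<in> projections M" "proj_le g ?s" for g
    proof -
      have gs: "g (?s x) = g x" for x by (rule proj_le_comp[OF projections_D(2)[OF g(1)] projections_D(2)[OF s] g(2)])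
      have "?s (Q x) = 0" "?s (R x) = 0" for x
        using Qp Rp QR RQ projections_D(3)[OF Q] projections_D(3)[OF R]
        by (auto simp: proj_le_iff fun_eq_iff zero_op_def)
      then have "g (Q x) = 0" "g (R x) = 0" for x
        using gs[of "Q x"] gs[of "R x"] bounded_clinear_simps(4)[OF projectionD(1)[OF projections_D(2)[OF g(1)]]] by auto
      moreover have "proj_le g p" using sp g(2) by (simp add: proj_le_iff) metis
      ultimately show ?thesis by (auto simp: fun_eq_iff zero_op_def)
    qed
    have o: "g \<circ> fst q = zero_op \<and> g \<circ> snd q = zero_op \<and> fst q \<circ> g = zero_op \<and> snd q \<circ> g = zero_op"
      if g: "g \<in> projections M" "proj_le g ?s" and q: "q \<in> F" for g q
    proof -
      have gq: "fst q \<in> projections M" "snd q \<in> projections M" using good[OF q] by (auto simp: good_def)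
      have "g (fst q x) = 0" "g (snd q x) = 0" for x
        using sub[OF g] Qle[OF q] Rle[OF q] by (simp_all add: proj_le_iff fun_eq_iff zero_op_def) metis+
      then have "g \<circ> fst q = zero_op" "g \<circ> snd q = zero_op" by (auto simp: fun_eq_iff zero_op_def)
      then show ?thesis
        using projection_orth_sym[OF projections_D(2)[OF g(1)] projections_D(2)[OF gq(1)]]
          projection_orth_sym[OF projections_D(2)[OF g(1)] projections_D(2)[OF gq(2)]] by blast
    qed
    have "good (e, f)" using ef sub[OF ef(1,6)] sub[OF ef(2,7)] by (simp add: good_def)
    then have "insert (e, f) F \<in> nice"
      using F o[OF ef(1,6)] o[OF ef(2,7)] unfolding nice_def by (auto simp: ort_def)
    then have "(e, f) \<in> F" using max[of "insert (e, f) F"] by blast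
    then have "e \<circ> fst (e, f) = zero_op" using o[OF ef(1,6)] by blast
    then have "e = zero_op" using projections_D(3)[OF ef(1)] by (auto simp: fun_eq_iff zero_op_def)
    then show False using ef(4) by blast
  qed
  then have pt: "p = ?t" by (auto simp: fun_eq_iff zero_op_def)
  show ?thesis
  proof (intro bexI[OF _ Q] allI impI)
    fix \<phi> \<mu> and D :: "'h op \<Rightarrow> 'w \<Rightarrow> ennreal" assume df: "dimension_function M \<phi> \<mu> D"
    have eq: "AE \<omega> in \<mu>. (\<Sum>q\<in>G. D (fst q) \<omega>) = (\<Sum>q\<in>G. D (snd q) \<omega>)" if G: "finite G" "G \<subseteq> F" for G
    proof -
      have "AE \<omega> in \<mu>. \<forall>q\<in>G. D (fst q) \<omega> = D (snd q) \<omega>"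
        using G good dim_equiv[OF df] by (intro AE_finite_allI) (auto simp: good_def)
      then show ?thesis by eventually_elim (auto intro: sum.cong)
    qed
    have "AE \<omega> in \<mu>. D Q \<omega> \<le> D R \<omega>"
    proof (rule QD2[OF df dim_measurable[OF df R]])
      fix G assume G: "finite G" "G \<subseteq> F"
      from eq[OF G] RD1[OF df G] show "AE \<omega> in \<mu>. (\<Sum>q\<in>G. D (fst q) \<omega>) \<le> D R \<omega>" by eventually_elim simp
    qed
    moreover have "AE \<omega> in \<mu>. D R \<omega> \<le> D Q \<omega>"
    proof (rule RD2[OF df dim_measurable[OF df Q]])
      fix G assume G: "finite G" "G \<subseteq> F"
      from eq[OF G] QD1[OF df G] show "AE \<omega> in \<mu>. (\<Sum>q\<in>G. D (snd q) \<omega>) \<le> D Q \<omega>" by eventually_elim simp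
    qed
    moreover have "AE \<omega> in \<mu>. D p \<omega> = D Q \<omega> + D R \<omega>"
      unfolding pt by (rule dim_add[OF df Q R QR t(2)])
    ultimately show "AE \<omega> in \<mu>. D p \<omega> = 2 * D Q \<omega>"
      by eventually_elim (auto simp: mult_2)
  qed
qed

text \<open>\<open>q\<close> is chosen before the dimension function, so a single projection divides
  the dimensions of both pairs by the same factor.\<close>

corollary dimension_halving_iterated:
  assumes nab: "\<And>s. abelian_proj M s \<Longrightarrow> s = zero_op" and p: "p \<in> projections M"
  shows "\<exists>q\<in>projections M. \<forall>\<phi> \<mu> (D :: 'h op \<Rightarrow> 'w \<Rightarrow> ennreal). dimension_function M \<phi> \<mu> D \<longrightarrow>
    (AE \<omega> in \<mu>. D p \<omega> = 2 ^ n * D q \<omega>)"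
proof (induction n)
  case 0
  then show ?case using p by auto
next
  case (Suc n)
  then obtain q where q: "q \<in> projections M"
    and qD: "\<And>\<phi> \<mu> (D :: 'h op \<Rightarrow> 'w \<Rightarrow> ennreal). dimension_function M \<phi> \<mu> D \<Longrightarrow> AE \<omega> in \<mu>. D p \<omega> = 2 ^ n * D q \<omega>" by blast
  obtain r where r: "r \<in> projections M"
    and rD: "\<And>\<phi> \<mu> (D :: 'h op \<Rightarrow> 'w \<Rightarrow> ennreal). dimension_function M \<phi> \<mu> D \<Longrightarrow> AE \<omega> in \<mu>. D q \<omega> = 2 * D r \<omega>"
    using dimension_halving[OF nab q] by blast
  show ?case
  proof (intro bexI[OF _ r] allI impI)
    fix \<phi> \<mu> and D :: "'h op \<Rightarrow> 'w \<Rightarrow> ennreal" assume df: "dimension_function M \<phi> \<mu> D"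
    from qD[OF df] rD[OF df] show "AE \<omega> in \<mu>. D p \<omega> = 2 ^ Suc n * D r \<omega>"
      by eventually_elim (simp add: mult_ac)
  qed
qed

end

section \<open>Dimension pairs and the F-norm\<close>

locale dim_pair = von_neumann M for M :: "'h::complex_hilbert_space op set" +
  fixes \<phi> :: "'h op \<Rightarrow> 'w \<Rightarrow> complex" and \<mu> :: "'w measure" and D :: "'h op \<Rightarrow> 'w \<Rightarrow> ennreal"
  assumes pair: "dimension_pair M \<phi> \<mu> D"
begin

lemma df: "dimension_function M \<phi> \<mu> D"
  and iso: "star_isomorphism (center M) \<mu> \<phi>"
  using pair by (auto simp: dimension_pair_def)

sublocale prob_space \<mu> using pair by (simp add: dimension_pair_def)

lemma center_D:
  assumes "S \<in> center M"
  shows "S \<in> M" "S \<in> commutant M" "\<And>T x. T \<in> M \<Longrightarrow> S (T x) = T (S x)"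
  using assms commutantD by (auto simp: center_def)

lemma center_projections: "z \<in> projections (center M) \<Longrightarrow> z \<in> projections M"
  by (auto simp: projections_def center_def)

lemma center_comp:
  assumes S: "S \<in> center M" and T: "T \<in> center M" shows "S \<circ> T \<in> center M"
proof -
  have "S \<circ> T \<in> M" by (rule M_comp[OF center_D(1)[OF S] center_D(1)[OF T]])
  moreover from this have "S \<circ> T \<in> commutant M"
    by (intro commutantI M_bounded_clinear) (simp_all add: center_D(3)[OF S] center_D(3)[OF T])
  ultimately show ?thesis by (simp add: center_def)
qed

lemma center_cadj: "S \<in> center M \<Longrightarrow> cadj S \<in> center M"
  by (auto simp: center_def M_cadj commutant_cadj)

lemma center_id: "id \<in> center M"
  using M_id commutantI[OF bounded_clinear_id, of M] by (simp add: center_def)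

lemma center_zero: "zero_op \<in> center M"
proof -
  have "zero_op \<in> commutant M"
    by (rule commutantI[OF bounded_clinear_zero]) (simp add: zero_op_def bounded_clinear_simps(4)[OF M_bounded_clinear])
  then show ?thesis using M_zero by (simp add: center_def)
qed

lemma phi_comp: "S \<in> center M \<Longrightarrow> T \<in> center M \<Longrightarrow> AE \<omega> in \<mu>. \<phi> (S \<circ> T) \<omega> = \<phi> S \<omega> * \<phi> T \<omega>"
  and phi_cadj: "S \<in> center M \<Longrightarrow> AE \<omega> in \<mu>. \<phi> (cadj S) \<omega> = cnj (\<phi> S \<omega>)"
  and phi_scale: "S \<in> center M \<Longrightarrow> AE \<omega> in \<mu>. \<phi> (\<lambda>\<xi>. c *\<^sub>C S \<xi>) \<omega> = c * \<phi> S \<omega>"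
  and phi_inj: "S \<in> center M \<Longrightarrow> T \<in> center M \<Longrightarrow> (AE \<omega> in \<mu>. \<phi> S \<omega> = \<phi> T \<omega>) \<Longrightarrow> S = T"
  and phi_surj: "f \<in> Linf \<mu> \<Longrightarrow> \<exists>S\<in>center M. AE \<omega> in \<mu>. \<phi> S \<omega> = f \<omega>"
  and phi_meas: "S \<in> center M \<Longrightarrow> \<phi> S \<in> borel_measurable \<mu>"
  using iso unfolding star_isomorphism_def Linf_def by blast+

lemma phi_zero: "AE \<omega> in \<mu>. \<phi> zero_op \<omega> = 0"
  using phi_scale[OF center_zero, of 0] by (simp add: zero_op_def)

lemma central_zero:
  assumes "z = zero_op" "AE \<omega> in \<mu>. \<phi> z \<omega> = indicator A \<omega>"
  shows "AE \<omega> in \<mu>. \<omega> \<notin> A"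
  using assms(2)[unfolded assms(1)] phi_zero by eventually_elim (auto split: split_indicator_asm)

lemma phi_id: "AE \<omega> in \<mu>. \<phi> id \<omega> = 1"
proof -
  have "(\<lambda>_. 1) \<in> Linf \<mu>" by (auto simp: Linf_def)
  then obtain S where S: "S \<in> center M" "AE \<omega> in \<mu>. \<phi> S \<omega> = 1" using phi_surj by blast
  from phi_comp[OF S(1) center_id] S(2) show ?thesis by eventually_elim simp
qed

text \<open>\<open>\<phi>\<close> is onto, and injectivity pulls the identities of an indicator
  function back: its preimage is idempotent and self-adjoint.\<close>

lemma central_projection_exists:
  assumes A: "A \<in> sets \<mu>"
  shows "\<exists>z\<in>projections (center M). AE \<omega> in \<mu>. \<phi> z \<omega> = indicator A \<omega>"
proof -
  have "(indicator A :: 'w \<Rightarrow> complex) \<in> Linf \<mu>"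
    using A by (auto simp: Linf_def intro!: exI[of _ 1] AE_I2 split: split_indicator)
  then obtain S where S: "S \<in> center M" and ind: "AE \<omega> in \<mu>. \<phi> S \<omega> = indicator A \<omega>" using phi_surj by blast
  have "S \<circ> S = S"
  proof (rule phi_inj[OF center_comp[OF S S] S])
    from phi_comp[OF S S] ind show "AE \<omega> in \<mu>. \<phi> (S \<circ> S) \<omega> = \<phi> S \<omega>"
      by eventually_elim (auto split: split_indicator)
  qed
  moreover have "cadj S = S"
  proof (rule phi_inj[OF center_cadj[OF S] S])
    from phi_cadj[OF S] ind show "AE \<omega> in \<mu>. \<phi> (cadj S) \<omega> = \<phi> S \<omega>"
      by eventually_elim (auto split: split_indicator)
  qed
  ultimately have "projection S" using M_bounded_clinear[OF center_D(1)[OF S]] by (simp add: projection_def)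
  then show ?thesis using S ind by (auto simp: projections_def)
qed

lemma central_cut:
  assumes A: "A \<in> sets \<mu>" and z: "z \<in> projections (center M)" "AE \<omega> in \<mu>. \<phi> z \<omega> = indicator A \<omega>"
    and p: "p \<in> projections M"
  shows "z \<circ> p \<in> projections M" "AE \<omega> in \<mu>. D (z \<circ> p) \<omega> = indicator A \<omega> * D p \<omega>"
proof -
  have "z \<in> center M" using z(1) by (simp add: projections_def)
  then show "z \<circ> p \<in> projections M"
    by (intro projections_commuting_comp[OF center_projections[OF z(1)] p] center_D(3) projections_D(1)[OF p])
  from dim_center[OF df z(1) p] z(2) show "AE \<omega> in \<mu>. D (z \<circ> p) \<omega> = indicator A \<omega> * D p \<omega>"
    by eventually_elim (auto split: split_indicator)
qed

text \<open>Vanishing of \<open>D p\<close> on \<open>A\<close> becomes an identity between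
  operators, in which neither the measure nor the dimension occurs; it can therefore be carried from
  one pair to the other.\<close>

lemma central_cut_zero:
  assumes A: "A \<in> sets \<mu>" and z: "z \<in> projections (center M)" "AE \<omega> in \<mu>. \<phi> z \<omega> = indicator A \<omega>"
    and p: "p \<in> projections M"
  shows "z \<circ> p = zero_op \<longleftrightarrow> (AE \<omega> in \<mu>. \<omega> \<in> A \<longrightarrow> D p \<omega> = 0)"
proof
  assume "z \<circ> p = zero_op"
  with central_cut(2)[OF assms] dim_zero[OF df] show "AE \<omega> in \<mu>. \<omega> \<in> A \<longrightarrow> D p \<omega> = 0"
    by (simp, eventually_elim) auto
next
  assume "AE \<omega> in \<mu>. \<omega> \<in> A \<longrightarrow> D p \<omega> = 0"
  with central_cut(2)[OF assms] have "AE \<omega> in \<mu>. D (z \<circ> p) \<omega> = 0"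
    by eventually_elim (auto split: split_indicator)
  then show "z \<circ> p = zero_op" by (rule dim_nonzero[OF df central_cut(1)[OF assms]])
qed

text \<open>The central projection of the zero set of \<open>D id\<close> has dimension 0, hence is
  zero, and its set is null.\<close>

lemma dim_id_nonzero: "AE \<omega> in \<mu>. D id \<omega> \<noteq> 0"
proof -
  have m: "D id \<in> borel_measurable \<mu>" by (rule dim_measurable[OF df projections_id])
  define A where "A = {\<omega> \<in> space \<mu>. D id \<omega> = 0}"
  have A: "A \<in> sets \<mu>" unfolding A_def using m by measurable
  obtain z where z: "z \<in> projections (center M)" "AE \<omega> in \<mu>. \<phi> z \<omega> = indicator A \<omega>"
    using central_projection_exists[OF A] by blast
  have "z \<circ> id = zero_op" unfolding central_cut_zero[OF A z projections_id] by (auto simp: A_def)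
  then have "z = zero_op" by simp
  from central_zero[OF this z(2)] AE_space show ?thesis by eventually_elim (auto simp: A_def)
qed

text \<open>Cutting \<open>p\<close> down to the set where its dimension is finite gives a finite
  projection, which the assumption makes zero. With \<open>p = id\<close> this covers
  \<open>type_II_inf\<close>, with arbitrary \<open>p\<close> it covers
  \<open>type_III\<close>.\<close>

lemma purely_infinite:
  assumes p: "p \<in> projections M"
    and inf: "\<And>z. z \<in> projections (center M) \<Longrightarrow> finite_proj M (z \<circ> p) \<Longrightarrow> z \<circ> p = zero_op"
  shows "AE \<omega> in \<mu>. D p \<omega> < \<infinity> \<longrightarrow> D p \<omega> = 0"
proof -
  have m: "D p \<in> borel_measurable \<mu>" by (rule dim_measurable[OF df p])
  define B where "B = {\<omega> \<in> space \<mu>. D p \<omega> < \<infinity>}"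
  have B: "B \<in> sets \<mu>" unfolding B_def using m by measurable
  obtain z where z: "z \<in> projections (center M)" "AE \<omega> in \<mu>. \<phi> z \<omega> = indicator B \<omega>"
    using central_projection_exists[OF B] by blast
  have "AE \<omega> in \<mu>. D (z \<circ> p) \<omega> < \<infinity>"
    using central_cut(2)[OF B z p] by eventually_elim (auto simp: B_def split: split_indicator)
  then have "finite_proj M (z \<circ> p)" using dim_finite_iff[OF df central_cut(1)[OF B z p]] by simp
  then have "z \<circ> p = zero_op" by (rule inf[OF z(1)])
  then have "AE \<omega> in \<mu>. \<omega> \<in> B \<longrightarrow> D p \<omega> = 0" using central_cut_zero[OF B z p] by simp
  then show ?thesis using AE_space by eventually_elim (auto simp: B_def)
qed

text \<open>A projection is its own absolute value; only levels below 1 see \<open>r\<close>, which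
  is why all thresholds in the comparison arguments are kept at most 1.\<close>

lemma F_norm_projection:
  assumes r: "r \<in> projections M"
  shows "F_norm \<mu> D (op_graph r) =
    (INF l\<in>{0<..}. max l (measure \<mu> {\<omega> \<in> space \<mu>. D (if l < 1 then r else zero_op) \<omega> > ennreal l}))"
  unfolding F_norm_def
  by (intro INF_cong refl) (simp add: spectral_projection_projection[OF projections_D(2)[OF r]] del: if_split)

lemma bdd_below_F_norm: "bdd_below ((\<lambda>l. max l (f l :: real)) ` {0<..})"
  by (rule bdd_belowI[of _ 0]) auto

lemma F_norm_projection_le:
  assumes r: "r \<in> projections M" and l: "0 < l" "l < 1"
  shows "F_norm \<mu> D (op_graph r) \<le> max l (measure \<mu> {\<omega> \<in> space \<mu>. D r \<omega> > ennreal l})"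
proof -
  have "F_norm \<mu> D (op_graph r) \<le> max l (measure \<mu> {\<omega> \<in> space \<mu>. D (if l < 1 then r else zero_op) \<omega> > ennreal l})"
    unfolding F_norm_projection[OF r] by (rule cINF_lower[OF bdd_below_F_norm]) (use l in simp)
  then show ?thesis using l by simp
qed

lemma F_norm_projection_le_1:
  assumes r: "r \<in> projections M" shows "F_norm \<mu> D (op_graph r) \<le> 1"
proof -
  have "F_norm \<mu> D (op_graph r) \<le> max 1 (measure \<mu> {\<omega> \<in> space \<mu>. D (if (1::real) < 1 then r else zero_op) \<omega> > ennreal 1})"
    unfolding F_norm_projection[OF r] by (rule cINF_lower[OF bdd_below_F_norm]) simp
  then show ?thesis by (simp add: max_absorb1 prob_le_1)
qed

text \<open>Levels from \<open>b\<close> on contribute at least \<open>b\<close> by themselves;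
  \<open>b \<le> 1\<close> ensures that the levels below \<open>b\<close> still see
  \<open>r\<close>.\<close>

lemma F_norm_projection_ge:
  assumes r: "r \<in> projections M" and b: "b \<le> 1"
    and ge: "\<And>l. 0 < l \<Longrightarrow> l < b \<Longrightarrow> b \<le> measure \<mu> {\<omega> \<in> space \<mu>. D r \<omega> > ennreal l}"
  shows "b \<le> F_norm \<mu> D (op_graph r)"
  unfolding F_norm_projection[OF r]
proof (rule cINF_greatest)
  fix l :: real assume l: "l \<in> {0<..}"
  show "b \<le> max l (measure \<mu> {\<omega> \<in> space \<mu>. D (if l < 1 then r else zero_op) \<omega> > ennreal l})"
  proof (cases "l < b")
    case True
    then have "l < 1" using b by simp
    then show ?thesis using ge[of l] True l by (simp add: le_max_iff_disj)
  qed simp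
qed simp

text \<open>Up to null sets the superlevel sets of \<open>D r\<close> are contained in
  \<open>A\<close>, and equal to it at every level below \<open>measure \<mu> A\<close>; so the
  level \<open>measure \<mu> A\<close> gives the infimum.\<close>

lemma F_norm_projection_eq_measure:
  assumes r: "r \<in> projections M" and A: "A \<in> sets \<mu>" "0 < measure \<mu> A"
    and on: "AE \<omega> in \<mu>. \<omega> \<in> A \<longrightarrow> ennreal (measure \<mu> A) \<le> D r \<omega>"
    and off: "AE \<omega> in \<mu>. \<omega> \<notin> A \<longrightarrow> D r \<omega> = 0"
  shows "F_norm \<mu> D (op_graph r) = measure \<mu> A"
proof (rule antisym)
  have m [measurable]: "D r \<in> borel_measurable \<mu>" by (rule dim_measurable[OF df r])
  have le: "measure \<mu> {\<omega> \<in> space \<mu>. D r \<omega> > ennreal l} \<le> measure \<mu> A" for l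
    by (rule finite_measure_mono_AE[OF _ A(1)]) (use off in \<open>eventually_elim, auto\<close>)
  show "F_norm \<mu> D (op_graph r) \<le> measure \<mu> A"
  proof (cases "measure \<mu> A < 1")
    case True
    show ?thesis using F_norm_projection_le[OF r A(2) True] le[of "measure \<mu> A"] by simp
  next
    case False
    then show ?thesis using F_norm_projection_le_1[OF r] by simp
  qed
  show "measure \<mu> A \<le> F_norm \<mu> D (op_graph r)"
  proof (rule F_norm_projection_ge[OF r prob_le_1])
    fix l assume l: "0 < l" "l < measure \<mu> A"
    then have "ennreal l < ennreal (measure \<mu> A)" by (simp add: ennreal_less_iff)
    then show "measure \<mu> A \<le> measure \<mu> {\<omega> \<in> space \<mu>. D r \<omega> > ennreal l}"
      by (intro finite_measure_mono_AE) (use on AE_space in \<open>eventually_elim, auto intro: less_le_trans\<close>, measurable)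
  qed
qed

end

section \<open>Comparison of two pairs\<close>

lemma AE_cong_null_sets:
  assumes "sets \<mu>' = sets \<mu>" "null_sets \<mu>' = null_sets \<mu>"
  shows "(AE \<omega> in \<mu>'. P \<omega>) \<longleftrightarrow> (AE \<omega> in \<mu>. P \<omega>)"
  unfolding eventually_ae_filter assms(2) sets_eq_imp_space_eq[OF assms(1)] ..

locale two_pairs = P: dim_pair M \<phi> \<mu> D + P': dim_pair M \<phi> \<mu>' D'
  for M :: "'h::complex_hilbert_space op set" and \<phi> :: "'h op \<Rightarrow> 'w \<Rightarrow> complex" and \<mu> \<mu>' D D' +
  assumes sets_eq: "sets \<mu>' = sets \<mu>" and null_eq: "null_sets \<mu>' = null_sets \<mu>"
    and F_eq: "p \<in> projections M \<Longrightarrow> F_norm \<mu> D (op_graph p) = F_norm \<mu>' D' (op_graph p)"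
begin

lemmas AE_iff = AE_cong_null_sets[OF sets_eq null_eq]
lemmas space_eq = sets_eq_imp_space_eq[OF sets_eq]

text \<open>The inequalities below are proved in one direction; this symmetry supplies the
  other.\<close>

lemma swap: "two_pairs M \<phi> \<mu>' \<mu> D' D"
  by unfold_locales (simp_all add: sets_eq null_eq F_eq)

lemma measurable': "f \<in> borel_measurable \<mu>' \<longleftrightarrow> f \<in> borel_measurable \<mu>"
  using measurable_cong_sets[OF sets_eq refl] by blast

lemma dim_le_type_II:
  assumes nab: "\<And>s. abelian_proj M s \<Longrightarrow> s = zero_op" and p: "p \<in> projections M"
  shows "AE \<omega> in \<mu>. D p \<omega> \<le> D' p \<omega>"
proof (rule ccontr)
  assume not: "\<not> ?thesis"
  have m [measurable]: "D p \<in> borel_measurable \<mu>" "D' p \<in> borel_measurable \<mu>"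
    using dim_measurable[OF P.df p] dim_measurable[OF P'.df p] measurable' by auto
  \<comment> \<open>Rational thresholds split the failure of the inequality into countably many
    sets, one of which is not null.\<close>
  define A where "A a b = {\<omega> \<in> space \<mu>. D' p \<omega> < ennreal a \<and> ennreal b < D p \<omega>}" for a b :: real
  have Am: "A a b \<in> sets \<mu>" for a b unfolding A_def by measurable
  obtain a b where ab: "0 < a" "a < b" and nn: "A a b \<notin> null_sets \<mu>"
  proof -
    have "\<exists>a\<in>\<rat>. \<exists>b\<in>\<rat>. 0 < a \<and> a < b \<and> A a b \<notin> null_sets \<mu>"
    proof (rule ccontr)
      assume "\<not> ?thesis"
      then have "AE \<omega> in \<mu>. \<forall>a\<in>\<rat>. \<forall>b\<in>\<rat>. 0 < a \<and> a < b \<longrightarrow> \<omega> \<notin> A a b"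
        using AE_not_in by (intro AE_ball_countable[THEN iffD2] ballI countable_rat) fastforce
      then have "AE \<omega> in \<mu>. D p \<omega> \<le> D' p \<omega>"
        using AE_space
      proof eventually_elim
        fix \<omega> assume *: "\<forall>a\<in>\<rat>. \<forall>b\<in>\<rat>. 0 < a \<and> a < b \<longrightarrow> \<omega> \<notin> A a b" and sp: "\<omega> \<in> space \<mu>"
        show "D p \<omega> \<le> D' p \<omega>"
        proof (rule ccontr)
          assume "\<not> D p \<omega> \<le> D' p \<omega>"
          then have lt: "D' p \<omega> < D p \<omega>" by simp
          \<comment> \<open>\<open>D p\<close> may be infinite; an intermediate value brings the
            search for \<open>a\<close> and \<open>b\<close> back to finite reals.\<close>
          then obtain y where y: "D' p \<omega> < y" "y < D p \<omega>" using dense by blast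
          obtain x' where x': "D' p \<omega> = ennreal x'" "0 \<le> x'" using y(1) by (cases "D' p \<omega>") auto
          obtain y' where y': "y = ennreal y'" "0 \<le> y'" using y(2) by (cases y) auto
          have "x' < y'" using y(1) x' y' by (simp add: ennreal_less_iff)
          then obtain a where a: "a \<in> \<rat>" "x' < a" "a < y'" using Rats_dense_in_real by blast
          then obtain b where b: "b \<in> \<rat>" "a < b" "b < y'" using Rats_dense_in_real by blast
          have "D' p \<omega> < ennreal a" using x' a by (simp add: ennreal_less_iff)
          moreover have "ennreal b < D p \<omega>"
          proof -
            have "ennreal b \<le> y" using b(3) y'(1) by (simp add: ennreal_leI)
            then show ?thesis using y(2) by simp
          qed
          ultimately have "\<omega> \<in> A a b" using sp by (simp add: A_def)
          moreover have "0 < a" using x'(2) a(2) by simp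
          ultimately show False using * a(1) b(1,2) by blast
        qed
      qed
      then show False using not by blast
    qed
    then show ?thesis using that by blast
  qed
  let ?A = "A a b"
  have m0: "0 < measure \<mu> ?A"
    using nn Am[of a b] by (simp add: null_sets_def P.emeasure_eq_measure zero_less_measure_iff)
  \<comment> \<open>The lower bound for the norm can exceed neither the measure of the supporting
    set nor 1; dividing by \<open>2 ^ n\<close> brings both thresholds under
    \<open>measure \<mu> ?A\<close>, hence under 1.\<close>
  obtain n where n: "b / measure \<mu> ?A < 2 ^ n" using real_arch_pow[of 2 "b / measure \<mu> ?A"] by auto
  define \<beta> where "\<beta> = b / 2 ^ n"
  define \<alpha> where "\<alpha> = a / 2 ^ n"
  have \<beta>m: "\<beta> \<le> measure \<mu> ?A" using n m0 by (simp add: \<beta>_def field_simps)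
  have \<alpha>\<beta>: "0 < \<alpha>" "\<alpha> < \<beta>" "\<beta> \<le> 1"
    using ab order_trans[OF \<beta>m P.prob_le_1] by (simp_all add: \<alpha>_def \<beta>_def divide_strict_right_mono)
  have b_eq: "ennreal b = 2 ^ n * ennreal \<beta>" and a_eq: "ennreal a = 2 ^ n * ennreal \<alpha>"
  proof -
    have "(2::ennreal) ^ n = ennreal (2 ^ n)" by (simp add: ennreal_power[symmetric])
    then show "ennreal b = 2 ^ n * ennreal \<beta>" "ennreal a = 2 ^ n * ennreal \<alpha>"
      using ab by (simp_all add: \<alpha>_def \<beta>_def ennreal_mult[symmetric])
  qed
  obtain q where q: "q \<in> projections M"
    and qD: "\<And>\<phi> \<mu> (D :: 'h op \<Rightarrow> 'w \<Rightarrow> ennreal). dimension_function M \<phi> \<mu> D \<Longrightarrow> AE \<omega> in \<mu>. D p \<omega> = 2 ^ n * D q \<omega>"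
    using P.dimension_halving_iterated[OF nab p] by metis
  have qm [measurable]: "D q \<in> borel_measurable \<mu>" by (rule dim_measurable[OF P.df q])
  obtain z where z: "z \<in> projections (center M)" "AE \<omega> in \<mu>. \<phi> z \<omega> = indicator ?A \<omega>"
    using P.central_projection_exists[OF Am] by blast
  let ?r = "z \<circ> q"
  have r: "?r \<in> projections M" by (rule P.central_cut(1)[OF Am z q])
  have rm [measurable]: "D ?r \<in> borel_measurable \<mu>" by (rule dim_measurable[OF P.df r])
  have "\<beta> \<le> F_norm \<mu> D (op_graph ?r)"
  proof (rule P.F_norm_projection_ge[OF r \<alpha>\<beta>(3)])
    fix l assume l: "0 < l" "l < \<beta>"
    have "measure \<mu> ?A \<le> measure \<mu> {\<omega> \<in> space \<mu>. D ?r \<omega> > ennreal l}"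
    proof (rule P.finite_measure_mono_AE)
      show "AE \<omega> in \<mu>. \<omega> \<in> ?A \<longrightarrow> \<omega> \<in> {\<omega> \<in> space \<mu>. D ?r \<omega> > ennreal l}"
        using P.central_cut(2)[OF Am z q] qD[OF P.df]
      proof eventually_elim
        fix \<omega> assume 1: "D ?r \<omega> = indicator ?A \<omega> * D q \<omega>" and 2: "D p \<omega> = 2 ^ n * D q \<omega>"
        show "\<omega> \<in> ?A \<longrightarrow> \<omega> \<in> {\<omega> \<in> space \<mu>. D ?r \<omega> > ennreal l}"
        proof
          assume w: "\<omega> \<in> ?A"
          then have "2 ^ n * ennreal \<beta> < 2 ^ n * D q \<omega>" unfolding A_def b_eq[symmetric] 2[symmetric] by simp
          then have "ennreal \<beta> < D q \<omega>" by (meson mult_left_mono not_less zero_le)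
          then have "ennreal l < D q \<omega>" using l by (meson ennreal_leI less_imp_le order_le_less_trans)
          then show "\<omega> \<in> {\<omega> \<in> space \<mu>. D ?r \<omega> > ennreal l}" using w 1 by (simp add: A_def)
        qed
      qed
    qed measurable
    then show "\<beta> \<le> measure \<mu> {\<omega> \<in> space \<mu>. D ?r \<omega> > ennreal l}" using \<beta>m by linarith
  qed
  moreover have "F_norm \<mu>' D' (op_graph ?r) \<le> \<alpha>"
  proof -
    have A': "?A \<in> sets \<mu>'" and z': "AE \<omega> in \<mu>'. \<phi> z \<omega> = indicator ?A \<omega>"
      using Am sets_eq z(2) AE_iff by auto
    have "AE \<omega> in \<mu>'. \<not> D' ?r \<omega> > ennreal \<alpha>"
      using P'.central_cut(2)[OF A' z(1) z' q] qD[OF P'.df]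
    proof eventually_elim
      fix \<omega> assume 1: "D' ?r \<omega> = indicator ?A \<omega> * D' q \<omega>" and 2: "D' p \<omega> = 2 ^ n * D' q \<omega>"
      show "\<not> D' ?r \<omega> > ennreal \<alpha>"
      proof (cases "\<omega> \<in> ?A")
        case True
        then have "2 ^ n * D' q \<omega> < 2 ^ n * ennreal \<alpha>" unfolding A_def a_eq[symmetric] 2[symmetric] by simp
        then have "D' q \<omega> < ennreal \<alpha>" by (meson mult_left_mono not_less zero_le)
        then show ?thesis using 1 True by simp
      qed (use 1 in simp)
    qed
    then have "measure \<mu>' {\<omega> \<in> space \<mu>'. D' ?r \<omega> > ennreal \<alpha>} = measure \<mu>' {}"
      by (intro P'.finite_measure_eq_AE) (use dim_measurable[OF P'.df r] in \<open>auto elim: eventually_mono\<close>)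
    then show ?thesis using P'.F_norm_projection_le[OF r \<alpha>\<beta>(1)] \<alpha>\<beta> by simp
  qed
  ultimately show False using F_eq[OF r] \<alpha>\<beta>(2) by simp
qed

text \<open>Only the zero sets have to be compared, and \<open>central_cut_zero\<close> transports
  them from one pair to the other through the projection \<open>z \<circ> p\<close>.\<close>

lemma dim_le_type_III:
  assumes III: "type_III M" and p: "p \<in> projections M"
  shows "AE \<omega> in \<mu>. D p \<omega> \<le> D' p \<omega>"
proof -
  have m [measurable]: "D' p \<in> borel_measurable \<mu>"
    using dim_measurable[OF P'.df p] measurable' by auto
  define A where "A = {\<omega> \<in> space \<mu>. D' p \<omega> = 0}"
  have A: "A \<in> sets \<mu>" unfolding A_def by measurable
  obtain z where z: "z \<in> projections (center M)" "AE \<omega> in \<mu>. \<phi> z \<omega> = indicator A \<omega>"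
    using P.central_projection_exists[OF A] by blast
  have A': "A \<in> sets \<mu>'" and z': "AE \<omega> in \<mu>'. \<phi> z \<omega> = indicator A \<omega>"
    using A sets_eq z(2) AE_iff by auto
  have "z \<circ> p = zero_op" unfolding P'.central_cut_zero[OF A' z(1) z' p] by (simp add: A_def)
  then have 0: "AE \<omega> in \<mu>. \<omega> \<in> A \<longrightarrow> D p \<omega> = 0" using P.central_cut_zero[OF A z p] by simp
  have "AE \<omega> in \<mu>'. D' p \<omega> < \<infinity> \<longrightarrow> D' p \<omega> = 0"
    by (rule P'.purely_infinite[OF p]) (use III in \<open>auto simp: type_III_def\<close>)
  then have "AE \<omega> in \<mu>. D' p \<omega> < \<infinity> \<longrightarrow> D' p \<omega> = 0" unfolding AE_iff .
  with 0 AE_space show ?thesis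
    by eventually_elim (auto simp: A_def less_top[symmetric])
qed

lemma measure_eq_infinite:
  assumes inf: "\<And>z. z \<in> projections (center M) \<Longrightarrow> finite_proj M z \<Longrightarrow> z = zero_op" and A: "A \<in> sets \<mu>"
  shows "measure \<mu> A = measure \<mu>' A"
proof (cases "A \<in> null_sets \<mu>")
  case True
  then show ?thesis using null_eq by (simp add: measure_eq_0_null_sets)
next
  case False
  have A': "A \<in> sets \<mu>'" using A sets_eq by simp
  have pos: "0 < measure \<mu> A" "0 < measure \<mu>' A"
    using False A A' null_eq
    by (auto simp: null_sets_def P.emeasure_eq_measure P'.emeasure_eq_measure zero_less_measure_iff)
  obtain z where z: "z \<in> projections (center M)" "AE \<omega> in \<mu>. \<phi> z \<omega> = indicator A \<omega>"
    using P.central_projection_exists[OF A] by blast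
  have z': "AE \<omega> in \<mu>'. \<phi> z \<omega> = indicator A \<omega>" using z(2) AE_iff by auto
  let ?z = "z \<circ> id"
  have zp: "?z \<in> projections M" by (rule P.central_cut(1)[OF A z P.projections_id])
  have "AE \<omega> in \<mu>. D id \<omega> < \<infinity> \<longrightarrow> D id \<omega> = 0"
    by (rule P.purely_infinite[OF P.projections_id]) (simp add: inf)
  with P.dim_id_nonzero have top: "AE \<omega> in \<mu>. D id \<omega> = \<infinity>"
    by eventually_elim (auto simp: less_top[symmetric])
  have "AE \<omega> in \<mu>'. D' id \<omega> < \<infinity> \<longrightarrow> D' id \<omega> = 0"
    by (rule P'.purely_infinite[OF P.projections_id]) (simp add: inf)
  with P'.dim_id_nonzero have top': "AE \<omega> in \<mu>'. D' id \<omega> = \<infinity>"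
    by eventually_elim (auto simp: less_top[symmetric])
  have "F_norm \<mu> D (op_graph ?z) = measure \<mu> A"
    by (rule P.F_norm_projection_eq_measure[OF zp A pos(1)])
      (use P.central_cut(2)[OF A z P.projections_id] top in \<open>eventually_elim, auto\<close>)+
  moreover have "F_norm \<mu>' D' (op_graph ?z) = measure \<mu>' A"
    by (rule P'.F_norm_projection_eq_measure[OF zp A' pos(2)])
      (use P'.central_cut(2)[OF A' z(1) z' P.projections_id] top' in \<open>eventually_elim, auto\<close>)+
  ultimately show ?thesis using F_eq[OF zp] by simp
qed

text \<open>Central projections of a factor are scalar, so the indicator of \<open>A\<close> is
  almost everywhere constant: \<open>A\<close> is null or of full measure, for both measures
  alike.\<close>

lemma measure_eq_factor:
  assumes factor: "factor M" and A: "A \<in> sets \<mu>"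
  shows "measure \<mu> A = measure \<mu>' A"
proof -
  obtain z where z: "z \<in> projections (center M)" "AE \<omega> in \<mu>. \<phi> z \<omega> = indicator A \<omega>"
    using P.central_projection_exists[OF A] by blast
  have "z \<in> center M" using z(1) by (simp add: projections_def)
  then obtain c where c: "z = (\<lambda>\<xi>. c *\<^sub>C id \<xi>)" using factor by (auto simp: factor_def)
  have ind: "AE \<omega> in \<mu>. indicator A \<omega> = c"
    using z(2) P.phi_id P.phi_scale[OF P.center_id, of c] unfolding c by eventually_elim simp
  have A': "A \<in> sets \<mu>'" using A sets_eq by simp
  show ?thesis
  proof (cases "c = 1")
    case True
    then have 1: "AE \<omega> in \<mu>. \<omega> \<in> A" using ind by (auto split: split_indicator_asm elim!: eventually_mono)
    then have "AE \<omega> in \<mu>'. \<omega> \<in> A" unfolding AE_iff .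
    then show ?thesis using 1 P.prob_eq_1[OF A] P'.prob_eq_1[OF A'] by simp
  next
    case False
    then have 0: "AE \<omega> in \<mu>. \<omega> \<notin> A" using ind by (auto split: split_indicator_asm elim!: eventually_mono)
    then have "AE \<omega> in \<mu>'. \<omega> \<notin> A" unfolding AE_iff .
    then show ?thesis using 0 P.prob_eq_0[OF A] P'.prob_eq_0[OF A'] by simp
  qed
qed

text \<open>\<open>\<delta>\<close> is a common threshold, above both measures of \<open>B\<close>
  and below both dimensions of the identity on \<open>B\<close>; so both norms of the central
  projection of \<open>B\<close> are measures of \<open>B\<close>.\<close>

lemma measure_eq_small:
  assumes B: "B \<in> sets \<mu>" and \<delta>: "measure \<mu> B \<le> \<delta>" "measure \<mu>' B \<le> \<delta>"
    and d: "\<And>\<omega>. \<omega> \<in> B \<Longrightarrow> ennreal \<delta> \<le> D id \<omega> \<and> ennreal \<delta> \<le> D' id \<omega>"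
  shows "measure \<mu> B = measure \<mu>' B"
proof (cases "B \<in> null_sets \<mu>")
  case True
  then show ?thesis using null_eq by (simp add: measure_eq_0_null_sets)
next
  case False
  have B': "B \<in> sets \<mu>'" using B sets_eq by simp
  have pos: "0 < measure \<mu> B" "0 < measure \<mu>' B"
    using False B B' null_eq
    by (auto simp: null_sets_def P.emeasure_eq_measure P'.emeasure_eq_measure zero_less_measure_iff)
  obtain z where z: "z \<in> projections (center M)" "AE \<omega> in \<mu>. \<phi> z \<omega> = indicator B \<omega>"
    using P.central_projection_exists[OF B] by blast
  have z': "AE \<omega> in \<mu>'. \<phi> z \<omega> = indicator B \<omega>" using z(2) AE_iff by auto
  let ?z = "z \<circ> id"
  have zp: "?z \<in> projections M" by (rule P.central_cut(1)[OF B z P.projections_id])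
  have d1: "ennreal (measure \<mu> B) \<le> D id \<omega>" "ennreal (measure \<mu>' B) \<le> D' id \<omega>" if "\<omega> \<in> B" for \<omega>
    using d[OF that] ennreal_leI[OF \<delta>(1)] ennreal_leI[OF \<delta>(2)] by (auto intro: order_trans)
  have "F_norm \<mu> D (op_graph ?z) = measure \<mu> B"
    by (rule P.F_norm_projection_eq_measure[OF zp B pos(1)])
      (use P.central_cut(2)[OF B z P.projections_id] in \<open>eventually_elim, simp add: d1\<close>)+
  moreover have "F_norm \<mu>' D' (op_graph ?z) = measure \<mu>' B"
    by (rule P'.F_norm_projection_eq_measure[OF zp B' pos(2)])
      (use P'.central_cut(2)[OF B' z(1) z' P.projections_id] in \<open>eventually_elim, simp add: d1\<close>)+
  ultimately show ?thesis using F_eq[OF zp] by simp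
qed

end

section \<open>Atomless centers\<close>

context dim_pair
begin

text \<open>A proper central subprojection \<open>q\<close> of the projection of \<open>A\<close> is
  the indicator of a set, because \<open>\<phi> q\<close> is idempotent and so takes only the values
  0 and 1.\<close>

lemma atomless_split:
  assumes atomless: "atomless (center M)" and A: "A \<in> sets \<mu>" "A \<notin> null_sets \<mu>"
  shows "\<exists>B\<in>sets \<mu>. B \<subseteq> A \<and> B \<notin> null_sets \<mu> \<and> A - B \<notin> null_sets \<mu>"
proof -
  obtain z where z: "z \<in> projections (center M)" "AE \<omega> in \<mu>. \<phi> z \<omega> = indicator A \<omega>"
    using central_projection_exists[OF A(1)] by blast
  have "z \<noteq> zero_op"
  proof
    assume "z = zero_op"
    from central_zero[OF this z(2)] show False using A AE_iff_null_sets[OF A(1)] by simp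
  qed
  then obtain q where q: "q \<in> projections (center M)" "proj_le q z" "q \<noteq> zero_op" "q \<noteq> z"
    using atomless z(1) unfolding atomless_def by blast
  have qc: "q \<in> center M" and zc: "z \<in> center M" using q(1) z(1) by (auto simp: projections_def)
  have "q \<circ> q = q" using projections_D(3)[OF q(1)] by (auto simp: fun_eq_iff)
  then have idem: "AE \<omega> in \<mu>. \<phi> q \<omega> = \<phi> q \<omega> * \<phi> q \<omega>" using phi_comp[OF qc qc] by simp
  have "z \<circ> q = q" using q(2) by (simp add: proj_le_def)
  then have le: "AE \<omega> in \<mu>. \<phi> q \<omega> = \<phi> z \<omega> * \<phi> q \<omega>" using phi_comp[OF zc qc] by simp
  have [measurable]: "\<phi> q \<in> borel_measurable \<mu>" by (rule phi_meas[OF qc])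
  define B where "B = {\<omega> \<in> space \<mu>. \<phi> q \<omega> = 1} \<inter> A"
  have B: "B \<in> sets \<mu>" unfolding B_def using A(1) by measurable
  have BA: "B \<subseteq> A" unfolding B_def by blast
  have ind: "AE \<omega> in \<mu>. \<phi> q \<omega> = indicator B \<omega>"
    using idem le z(2) AE_space
    by eventually_elim (auto simp: B_def split: split_indicator split_indicator_asm)
  have "B \<notin> null_sets \<mu>"
  proof
    assume "B \<in> null_sets \<mu>"
    then have "AE \<omega> in \<mu>. \<omega> \<notin> B" by (rule AE_not_in)
    with ind phi_zero have "AE \<omega> in \<mu>. \<phi> q \<omega> = \<phi> zero_op \<omega>" by eventually_elim simp
    then show False using phi_inj[OF qc center_zero] q(3) by blast
  qed
  moreover have "A - B \<notin> null_sets \<mu>"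
  proof
    assume "A - B \<in> null_sets \<mu>"
    then have "AE \<omega> in \<mu>. \<omega> \<notin> A - B" by (rule AE_not_in)
    with ind z(2) have "AE \<omega> in \<mu>. \<phi> q \<omega> = \<phi> z \<omega>"
      by eventually_elim (use BA in \<open>auto simp: indicator_def\<close>)
    then show False using phi_inj[OF qc zc] q(4) by blast
  qed
  ultimately show ?thesis using B BA by blast
qed

text \<open>Split repeatedly and keep the piece of smaller measure, at most half of the previous
  bound.\<close>

lemma atomless_small_subset:
  assumes atomless: "atomless (center M)" and A: "A \<in> sets \<mu>" "A \<notin> null_sets \<mu>" and e: "0 < e"
  shows "\<exists>B\<in>sets \<mu>. B \<subseteq> A \<and> B \<notin> null_sets \<mu> \<and> measure \<mu> B \<le> e"
proof -
  have "\<exists>B\<in>sets \<mu>. B \<subseteq> A \<and> B \<notin> null_sets \<mu> \<and> measure \<mu> B \<le> 1 / 2 ^ n" for n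
  proof (induction n)
    case 0
    then show ?case using A prob_le_1 by auto
  next
    case (Suc n)
    then obtain B where B: "B \<in> sets \<mu>" "B \<subseteq> A" "B \<notin> null_sets \<mu>" "measure \<mu> B \<le> 1 / 2 ^ n" by blast
    obtain C where C: "C \<in> sets \<mu>" "C \<subseteq> B" "C \<notin> null_sets \<mu>" "B - C \<notin> null_sets \<mu>"
      using atomless_split[OF atomless B(1,3)] by blast
    have "measure \<mu> (B - C) = measure \<mu> B - measure \<mu> C" by (rule finite_measure_Diff[OF B(1) C(1,2)])
    then have "measure \<mu> C \<le> 1 / 2 ^ Suc n \<or> measure \<mu> (B - C) \<le> 1 / 2 ^ Suc n"
    proof -
      have "1 / 2 ^ Suc n + 1 / 2 ^ Suc n = (1 / 2 ^ n :: real)" by simp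
      then show ?thesis using B(4) \<open>measure \<mu> (B - C) = measure \<mu> B - measure \<mu> C\<close> by linarith
    qed
    then show ?case using B C by (metis Diff_subset order_trans sets.Diff)
  qed
  moreover obtain n where "1 / e < 2 ^ n" using real_arch_pow[of 2 "1 / e"] by auto
  then have "1 / 2 ^ n \<le> e" using e by (simp add: field_simps)
  ultimately show ?thesis by (meson order_trans)
qed

end

context two_pairs
begin

text \<open>If the density \<open>h\<close> of \<open>\<mu>'\<close> exceeded 1 on a non-null set,
  it would be at least \<open>1 + \<delta> k\<close> on a non-null subset where both dimensions of
  the identity are at least \<open>\<delta> k\<close>. A small piece of that subset has equal
  measures by \<open>measure_eq_small\<close>, a contradiction.\<close>

lemma measure_le_atomless:
  assumes atomless: "atomless (center M)" and A: "A \<in> sets \<mu>"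
  shows "emeasure \<mu>' A \<le> emeasure \<mu> A"
proof -
  have "absolutely_continuous \<mu> \<mu>'" by (simp add: absolutely_continuous_def null_eq)
  then obtain h where h [measurable]: "h \<in> borel_measurable \<mu>" and dens: "density \<mu> h = \<mu>'"
    using P.Radon_Nikodym[OF _ sets_eq] by blast
  have m [measurable]: "D id \<in> borel_measurable \<mu>" "D' id \<in> borel_measurable \<mu>"
    using dim_measurable[OF P.df P.projections_id] dim_measurable[OF P'.df P.projections_id] measurable' by auto
  define \<delta> where "\<delta> k = inverse (real (Suc k))" for k
  \<comment> \<open>One \<open>\<delta> k\<close> serves three thresholds, each of which is met for
    all large \<open>k\<close>; so the sets \<open>B k\<close> exhaust the set where
    \<open>h\<close> exceeds 1, up to a null set.\<close>
  define B where "B k = {\<omega> \<in> space \<mu>. ennreal (1 + \<delta> k) \<le> h \<omega> \<and> ennreal (\<delta> k) \<le> D id \<omega> \<and> ennreal (\<delta> k) \<le> D' id \<omega>}" for k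
  have Bm: "B k \<in> sets \<mu>" for k unfolding B_def by measurable
  have \<delta>0: "0 < \<delta> k" for k by (simp add: \<delta>_def)
  have null: "B k \<in> null_sets \<mu>" for k
  proof (rule ccontr)
    assume nn: "B k \<notin> null_sets \<mu>"
    obtain C where C: "C \<in> sets \<mu>" "C \<subseteq> B k" "C \<notin> null_sets \<mu>" "measure \<mu> C \<le> \<delta> k"
      using P.atomless_small_subset[OF atomless Bm nn \<delta>0] by blast
    \<comment> \<open>\<open>measure_eq_small\<close> needs smallness for both measures, so the set
      is shrunk a second time, now for \<open>\<mu>'\<close>.\<close>
    then obtain C' where C': "C' \<in> sets \<mu>" "C' \<subseteq> C" "C' \<notin> null_sets \<mu>" "measure \<mu>' C' \<le> \<delta> k"
      using P'.atomless_small_subset[OF atomless, of C "\<delta> k"] sets_eq null_eq \<delta>0 by auto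
    have "measure \<mu> C' \<le> \<delta> k"
      using P.finite_measure_mono[OF C'(2) C(1)] C(4) by linarith
    then have eq: "measure \<mu> C' = measure \<mu>' C'"
      by (rule measure_eq_small[OF C'(1) _ C'(4)]) (use C'(2) C(2) in \<open>auto simp: B_def\<close>)
    have pos: "0 < measure \<mu> C'"
      using C'(1,3) by (auto simp: null_sets_def P.emeasure_eq_measure zero_less_measure_iff)
    have "ennreal ((1 + \<delta> k) * measure \<mu> C') = (\<integral>\<^sup>+ \<omega>. ennreal (1 + \<delta> k) * indicator C' \<omega> \<partial>\<mu>)"
      using C'(1) \<delta>0[of k] by (simp add: nn_integral_cmult_indicator P.emeasure_eq_measure ennreal_mult)
    also have "\<dots> \<le> (\<integral>\<^sup>+ \<omega>. h \<omega> * indicator C' \<omega> \<partial>\<mu>)"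
      using C'(2) C(2) by (intro nn_integral_mono) (auto simp: B_def split: split_indicator)
    also have "\<dots> = emeasure \<mu>' C'" using C'(1) by (simp add: dens[symmetric] emeasure_density)
    also have "\<dots> = ennreal (measure \<mu> C')" by (simp add: P'.emeasure_eq_measure eq)
    finally have "(1 + \<delta> k) * measure \<mu> C' \<le> measure \<mu> C'" by simp
    then show False using pos \<delta>0[of k] by simp
  qed
  have "AE \<omega> in \<mu>. \<forall>k. \<omega> \<notin> B k" by (rule AE_all_countable[THEN iffD2]) (use AE_not_in[OF null] in blast)
  moreover have "AE \<omega> in \<mu>. D' id \<omega> \<noteq> 0" using P'.dim_id_nonzero unfolding AE_iff .
  ultimately have "AE \<omega> in \<mu>. h \<omega> \<le> 1"
    using AE_space P.dim_id_nonzero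
  proof eventually_elim
    fix \<omega> assume w: "\<forall>k. \<omega> \<notin> B k" "D' id \<omega> \<noteq> 0" "\<omega> \<in> space \<mu>" "D id \<omega> \<noteq> 0"
    have small: "\<exists>e>0. \<forall>d. 0 < d \<and> d < e \<longrightarrow> ennreal d \<le> y" if "y \<noteq> 0" for y :: ennreal
    proof (cases y)
      case (real r)
      then show ?thesis using that by (intro exI[of _ r]) (auto intro: ennreal_leI)
    next
      case top
      then show ?thesis by (intro exI[of _ 1]) auto
    qed
    show "h \<omega> \<le> 1"
    proof (rule ccontr)
      assume "\<not> h \<omega> \<le> 1"
      have "\<exists>e>0. \<forall>d. 0 < d \<and> d < e \<longrightarrow> ennreal (1 + d) \<le> h \<omega>"
      proof (cases "h \<omega>")
        case (real r)
        then have "1 < r" using \<open>\<not> h \<omega> \<le> 1\<close> by (simp add: not_le)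
        then show ?thesis using real by (intro exI[of _ "r - 1"]) (auto intro: ennreal_leI simp del: ennreal_plus)
      next
        case top
        then show ?thesis by (intro exI[of _ 1]) auto
      qed
      then obtain e1 where e1: "0 < e1" "\<And>d. 0 < d \<Longrightarrow> d < e1 \<Longrightarrow> ennreal (1 + d) \<le> h \<omega>" by blast
      obtain e2 where e2: "0 < e2" "\<And>d. 0 < d \<Longrightarrow> d < e2 \<Longrightarrow> ennreal d \<le> D id \<omega>" using small[OF w(4)] by blast
      obtain e3 where e3: "0 < e3" "\<And>d. 0 < d \<Longrightarrow> d < e3 \<Longrightarrow> ennreal d \<le> D' id \<omega>" using small[OF w(2)] by blast
      obtain k where "\<delta> k < min e1 (min e2 e3)"
        using reals_Archimedean[of "min e1 (min e2 e3)"] e1(1) e2(1) e3(1) unfolding \<delta>_def by auto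
      then have "\<omega> \<in> B k" using e1(2) e2(2) e3(2) \<delta>0[of k] w(3) by (simp add: B_def)
      then show False using w(1) by blast
    qed
  qed
  then have "(\<integral>\<^sup>+ \<omega>. h \<omega> * indicator A \<omega> \<partial>\<mu>) \<le> (\<integral>\<^sup>+ \<omega>. indicator A \<omega> \<partial>\<mu>)"
    by (intro nn_integral_mono_AE) (auto elim!: eventually_mono split: split_indicator)
  then show ?thesis using A by (simp add: dens[symmetric] emeasure_density)
qed

lemma F_norm_eq:
  assumes meas: "\<And>A. A \<in> sets \<mu> \<Longrightarrow> measure \<mu> A = measure \<mu>' A"
    and dim: "\<And>p. p \<in> projections M \<Longrightarrow> AE \<omega> in \<mu>. D p \<omega> = D' p \<omega>"
    and x: "x \<in> LS M"
  shows "F_norm \<mu> D x = F_norm \<mu>' D' x"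
  unfolding F_norm_def
proof (intro INF_cong refl arg_cong2[where f = max])
  fix l :: real assume l: "l \<in> {0<..}"
  let ?p = "spectral_projection (uop_abs x) {l<..}"
  have p: "?p \<in> projections M"
    using x l by (intro P.spectral_projection_in_M) (auto simp: LS_def)
  have m [measurable]: "D ?p \<in> borel_measurable \<mu>" "D' ?p \<in> borel_measurable \<mu>"
    using dim_measurable[OF P.df p] dim_measurable[OF P'.df p] measurable' by auto
  have "measure \<mu> {\<omega> \<in> space \<mu>. D ?p \<omega> > ennreal l} = measure \<mu> {\<omega> \<in> space \<mu>. D' ?p \<omega> > ennreal l}"
    by (rule P.finite_measure_eq_AE) (use dim[OF p] in \<open>auto elim!: eventually_mono\<close>)
  also have "\<dots> = measure \<mu>' {\<omega> \<in> space \<mu>'. D' ?p \<omega> > ennreal l}"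
    unfolding space_eq by (rule meas) measurable
  finally show "measure \<mu> {\<omega> \<in> space \<mu>. D ?p \<omega> > ennreal l} = measure \<mu>' {\<omega> \<in> space \<mu>'. D' ?p \<omega> > ennreal l}" .
qed

end

theorem corollary1p5:
  fixes M :: "'h::complex_hilbert_space op set"
    and \<phi> :: "'h op \<Rightarrow> 'w \<Rightarrow> complex"
    and \<mu> \<mu>' :: "'w measure"
    and D D' :: "'h op \<Rightarrow> 'w \<Rightarrow> ennreal"
  assumes "von_neumann_algebra M"
    and "countably_decomposable (center M)"
    and "(type_II_inf M \<or> type_III M) \<or>
         (type_II_1 M \<and> atomless (center M)) \<or> (type_II_1 M \<and> factor M)"
    and "dimension_pair M \<phi> \<mu> D"
    and "dimension_pair M \<phi> \<mu>' D'"
    and "sets \<mu>' = sets \<mu>"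
    and "null_sets \<mu>' = null_sets \<mu>"
    and "\<forall>p\<in>projections M. F_norm \<mu> D (op_graph p) = F_norm \<mu>' D' (op_graph p)"
  shows "\<forall>x\<in>LS M. F_norm \<mu> D x = F_norm \<mu>' D' x"
proof -
  interpret two_pairs M \<phi> \<mu> \<mu>' D D'
    by unfold_locales (use assms in auto)
  interpret S: two_pairs M \<phi> \<mu>' \<mu> D' D by (rule swap)
  have "measure \<mu> A = measure \<mu>' A" if A: "A \<in> sets \<mu>" for A
    using assms(3)
  proof (elim disjE conjE)
    assume "type_II_inf M"
    then show ?thesis by (intro measure_eq_infinite[OF _ A]) (auto simp: type_II_inf_def)
  next
    assume "type_III M"
    then show ?thesis by (intro measure_eq_infinite[OF _ A]) (auto simp: type_III_def)
  next
    assume "atomless (center M)"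
    then have "emeasure \<mu>' A = emeasure \<mu> A"
      using measure_le_atomless[OF _ A] S.measure_le_atomless[of A] A sets_eq by (intro antisym) auto
    then show ?thesis by (simp add: measure_def)
  next
    assume "factor M"
    then show ?thesis by (rule measure_eq_factor[OF _ A])
  qed
  moreover have "AE \<omega> in \<mu>. D p \<omega> = D' p \<omega>" if p: "p \<in> projections M" for p
  proof -
    have "type_II M \<or> type_III M" using assms(3) by (auto simp: type_II_inf_def type_II_1_def)
    then have "(AE \<omega> in \<mu>. D p \<omega> \<le> D' p \<omega>) \<and> (AE \<omega> in \<mu>'. D' p \<omega> \<le> D p \<omega>)"
    proof
      assume "type_II M"
      then have "\<And>s. abelian_proj M s \<Longrightarrow> s = zero_op" by (simp add: type_II_def)
      then show ?thesis using dim_le_type_II[OF _ p] S.dim_le_type_II[OF _ p] by blast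
    next
      assume "type_III M"
      then show ?thesis using dim_le_type_III[OF _ p] S.dim_le_type_III[OF _ p] by blast
    qed
    then show ?thesis unfolding AE_iff by (auto elim: eventually_elim2)
  qed
  ultimately show ?thesis using F_norm_eq by blast
qed

end
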